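(* Let $\alpha\in[-1/2,\infty)$. If $\alpha\in\{-1/2\}\cup[1/2,\infty)$, then $\{T_t^{\alpha,\psi}\}_{t\ge0}$ is a submarkovian (Markovian if and only if $\alpha=-1/2$) symmetric diffusion semigroup on $(\mathbb{R}_+,dx)$. If $\alpha\in(-1/2,1/2)$, then $\{T_t^{\alpha,\psi}\}_{t\ge0}$ is not an $L^p$-contractive semigroup, but there exists a constant $c=c(\alpha)>1$ such that, for all $1\le p\le\infty$, $$\|T_t^{\alpha,\psi}\|_{p\to p}\le c,\qquad t>0.$$
   Context: Notation: $\mathbb{R}_+=(0,\infty)$, $L^p=L^p(\mathbb{R}_+,dx)$, $\|\cdot\|_{p\to p}$ is the operator norm on $L^p$, $\mathbf 1$ is the constant function $1$; $J_\nu$ and $I_\nu$ are, respectively, the Bessel function and the modified Bessel function of the first kind of order $\nu$. The semigroup. Let $\psi_\lambda^\alpha(x)=\sqrt{x\lambda}\,J_\alpha(x\lambda)$, $x,\lambda>0$; these are eigenfunctions, with eigenvalues $\lambda^2$, of the Bessel operator $L_\alpha^\psi=-\frac{d^2}{dx^2}+\frac1{x^2}(\alpha^2-\frac14)$. The Hankel transform $\mathcal H_\alpha f(\lambda)=\int_0^\infty\psi_\lambda^\alpha(x)f(x)\,dx$ extends to an isometry of $L^2(\mathbb{R}_+)$ with $\mathcal H_\alpha\circ\mathcal H_\alpha=\mathrm{Id}$, and $L_\alpha^\psi$ also denotes the self-adjoint extension whose spectral decomposition is given via $\mathcal H_\alpha$. The Bessel semigroup is $T_t^{\alpha,\psi}f=\exp(-tL_\alpha^\psi)f=\mathcal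 H_\alpha\big(e^{-t(\cdot)^2}\mathcal H_\alpha f\big)$, $f\in L^2(\mathbb{R}_+)$. For $t>0$ it has the integral representation $$T_t^{\alpha,\psi}f(x)=\int_0^\infty G_t^{\alpha,\psi}(x,y)f(y)\,dy,\qquad G_t^{\alpha,\psi}(x,y)=\frac1{2t}\sqrt{xy}\exp\Big(-\frac{x^2+y^2}{4t}\Big)I_\alpha\Big(\frac{xy}{2t}\Big),$$ which for $\alpha\ge-1/2$ defines $T_t^{\alpha,\psi}$ on $L^1+L^\infty$; $T_0^{\alpha,\psi}=\mathrm{Id}$. Definitions. On a $\sigma$-finite measure space $(X,\mu)$, a symmetric diffusion semigroup is a family of linear operators $\{T_t\}_{t\ge0}$, $T_0=\mathrm{Id}$, mapping a linear subspace of the measurable functions that contains all $L^p(X,\mu)$, $1\le p\le\infty$ (e.g. $L^1+L^\infty$) into measurable functions, such that: (i) for each $1\le p\le\infty$ every $T_t$ is a contraction on $L^p$ and $\{T_t\}_{t\ge0}$ is a semigroup there; (ii) each $T_t$ is self-adjoint on $L^2$; (iii) $\lim_{t\to0^+}T_tf=f$ in $L^2$ for each $f\in L^2$. It is Markovian if in addition (iv) $T_tf\ge0$ whenever $f\ge0$, for all $t$, and (v) $T_t\mathbf 1=\mathbf 1$ for all $t$. It is submarkovian if (i)-(iv) hold and (v') $T_t\mathbf 1\le\mathbf 1$ for all $t$. A semigroup $\{T_t\}_{t\ge 0}=\{\exp(-tL)\}_{t\ge0}$ generated by a positive self-adjoint operator $L$ on $L^2(X,\mu)$ is called $L^p$-contractive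 if $\|T_tf\|_p\le\|f\|_p$ for all $1\le p\le\infty$, all $t\ge0$ and all $f\in L^2\cap L^p(X,\mu)$. *)

theory Defs
  imports
    "HOL-Analysis.Analysis"
    "HOL-Probability.Essential_Supremum"
    "HOL-Library.Complex_Order"
begin

section \<open>Lebesgue spaces with exponents in the closed interval from 1 to infinity\<close>

text \<open>Elements of a Lebesgue space are represented by measurable functions, and equalities
  between them are stated almost everywhere. The norm of a non-measurable function is infinite.\<close>

definition Lp_norm :: "ennreal \<Rightarrow> 'a measure \<Rightarrow> ('a \<Rightarrow> complex) \<Rightarrow> ennreal" where
  "Lp_norm p M f =
    (if f \<notin> borel_measurable M then \<infinity>
     else if p = \<infinity> then esssup M (\<lambda>x. ennreal (norm (f x)))
     else let I = (\<integral>\<^sup>+x. ennreal (norm (f x) powr enn2real p) \<partial>M)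
          in if I = \<infinity> then \<infinity> else ennreal (enn2real I powr (1 / enn2real p)))"

definition Lp :: "ennreal \<Rightarrow> 'a measure \<Rightarrow> ('a \<Rightarrow> complex) set" where
  "Lp p M = {f \<in> borel_measurable M. Lp_norm p M f < \<infinity>}"

definition L1_plus_Linf :: "'a measure \<Rightarrow> ('a \<Rightarrow> complex) set" where
  "L1_plus_Linf M =
    {f \<in> borel_measurable M. \<exists>g\<in>Lp 1 M. \<exists>h\<in>Lp \<infinity> M. AE x in M. f x = g x + h x}"

text \<open>The operator norm is infinite if some function in the unit ball is mapped outside the
  Lebesgue space.\<close>

definition Lp_opnorm ::
    "ennreal \<Rightarrow> 'a measure \<Rightarrow> (('a \<Rightarrow> complex) \<Rightarrow> 'a \<Rightarrow> complex) \<Rightarrow> ennreal" where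
  "Lp_opnorm p M T = (SUP f\<in>{f \<in> Lp p M. Lp_norm p M f \<le> 1}. Lp_norm p M (T f))"

section \<open>Symmetric diffusion semigroups\<close>

text \<open>The set \<open>D\<close> is the common domain of the operators, for instance
  \<^term>\<open>L1_plus_Linf M\<close>.\<close>

definition linear_operator_family ::
    "'a measure \<Rightarrow> ('a \<Rightarrow> complex) set \<Rightarrow> (real \<Rightarrow> ('a \<Rightarrow> complex) \<Rightarrow> 'a \<Rightarrow> complex) \<Rightarrow> bool" where
  "linear_operator_family M D T \<longleftrightarrow>
    D \<subseteq> borel_measurable M \<and>
    (\<forall>f\<in>D. \<forall>g\<in>borel_measurable M. (AE x in M. f x = g x) \<longrightarrow> g \<in> D) \<and>
    (\<forall>f\<in>D. \<forall>g\<in>D. \<forall>a b. (\<lambda>x. a * f x + b * g x) \<in> D) \<and>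
    (\<forall>p\<ge>1. Lp p M \<subseteq> D) \<and>
    (\<forall>t\<ge>0. \<forall>f\<in>D. T t f \<in> borel_measurable M) \<and>
    (\<forall>t\<ge>0. \<forall>f\<in>D. \<forall>g\<in>D. (AE x in M. f x = g x) \<longrightarrow> (AE x in M. T t f x = T t g x)) \<and>
    (\<forall>t\<ge>0. \<forall>f\<in>D. \<forall>g\<in>D. \<forall>a b.
      AE x in M. T t (\<lambda>y. a * f y + b * g y) x = a * T t f x + b * T t g x)"

definition symmetric_diffusion_semigroup ::
    "'a measure \<Rightarrow> ('a \<Rightarrow> complex) set \<Rightarrow> (real \<Rightarrow> ('a \<Rightarrow> complex) \<Rightarrow> 'a \<Rightarrow> complex) \<Rightarrow> bool" where
  "symmetric_diffusion_semigroup M D T \<longleftrightarrow>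
    sigma_finite_measure M \<and>
    linear_operator_family M D T \<and>
    (\<forall>f\<in>D. AE x in M. T 0 f x = f x) \<and>
    (\<forall>p\<ge>1. \<forall>t\<ge>0. \<forall>f\<in>Lp p M. T t f \<in> Lp p M \<and> Lp_norm p M (T t f) \<le> Lp_norm p M f) \<and>
    (\<forall>p\<ge>1. \<forall>s\<ge>0. \<forall>t\<ge>0. \<forall>f\<in>Lp p M. AE x in M. T s (T t f) x = T (s + t) f x) \<and>
    (\<forall>t\<ge>0. \<forall>f\<in>Lp 2 M. \<forall>g\<in>Lp 2 M.
      (LINT x|M. T t f x * cnj (g x)) = (LINT x|M. f x * cnj (T t g x))) \<and>
    (\<forall>f\<in>Lp 2 M. ((\<lambda>t. Lp_norm 2 M (\<lambda>x. T t f x - f x)) \<longlongrightarrow> 0) (at_right 0))"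

text \<open>The order on \<^typ>\<open>complex\<close> is the one of \<^theory>\<open>HOL-Library.Complex_Order\<close>: comparable
  numbers have the same imaginary part, so \<open>0 \<le> z\<close> says that \<open>z\<close> is real and nonnegative.\<close>

definition positivity_preserving ::
    "'a measure \<Rightarrow> ('a \<Rightarrow> complex) set \<Rightarrow> (real \<Rightarrow> ('a \<Rightarrow> complex) \<Rightarrow> 'a \<Rightarrow> complex) \<Rightarrow> bool" where
  "positivity_preserving M D T \<longleftrightarrow>
    (\<forall>t\<ge>0. \<forall>f\<in>D. (AE x in M. 0 \<le> f x) \<longrightarrow> (AE x in M. 0 \<le> T t f x))"

definition submarkovian_semigroup ::
    "'a measure \<Rightarrow> ('a \<Rightarrow> complex) set \<Rightarrow> (real \<Rightarrow> ('a \<Rightarrow> complex) \<Rightarrow> 'a \<Rightarrow> complex) \<Rightarrow> bool" where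
  "submarkovian_semigroup M D T \<longleftrightarrow>
    symmetric_diffusion_semigroup M D T \<and> positivity_preserving M D T \<and>
    (\<forall>t\<ge>0. AE x in M. T t (\<lambda>_. 1) x \<le> 1)"

definition markovian_semigroup ::
    "'a measure \<Rightarrow> ('a \<Rightarrow> complex) set \<Rightarrow> (real \<Rightarrow> ('a \<Rightarrow> complex) \<Rightarrow> 'a \<Rightarrow> complex) \<Rightarrow> bool" where
  "markovian_semigroup M D T \<longleftrightarrow>
    symmetric_diffusion_semigroup M D T \<and> positivity_preserving M D T \<and>
    (\<forall>t\<ge>0. AE x in M. T t (\<lambda>_. 1) x = 1)"

text \<open>The following notion is meant for families that act on the space of square integrable
  functions as \<open>exp (- t L)\<close> with a positive self-adjoint operator \<open>L\<close>. This is not a conjunct of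
  the definition, so that its negation says that the norm inequality fails.\<close>

definition Lp_contractive ::
    "'a measure \<Rightarrow> (real \<Rightarrow> ('a \<Rightarrow> complex) \<Rightarrow> 'a \<Rightarrow> complex) \<Rightarrow> bool" where
  "Lp_contractive M T \<longleftrightarrow>
    (\<forall>p\<ge>1. \<forall>t\<ge>0. \<forall>f\<in>Lp 2 M \<inter> Lp p M. Lp_norm p M (T t f) \<le> Lp_norm p M f)"

section \<open>Bessel functions on the positive half-line\<close>

definition besselJ :: "real \<Rightarrow> real \<Rightarrow> real" where
  "besselJ \<nu> z = (z / 2) powr \<nu> *
    (\<Sum>n. (-1) ^ n * (z / 2) ^ (2 * n) / (fact n * Gamma (\<nu> + real n + 1)))"

definition besselI :: "real \<Rightarrow> real \<Rightarrow> real" where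
  "besselI \<nu> z = (z / 2) powr \<nu> *
    (\<Sum>n. (z / 2) ^ (2 * n) / (fact n * Gamma (\<nu> + real n + 1)))"

section \<open>The Hankel transform and the Bessel semigroup\<close>

abbreviation halfline :: "real measure" where
  "halfline \<equiv> restrict_space lborel {0<..}"

definition bessel_psi :: "real \<Rightarrow> real \<Rightarrow> real \<Rightarrow> real" where
  "bessel_psi \<alpha> l x = sqrt (x * l) * besselJ \<alpha> (x * l)"

definition hankel_integral :: "real \<Rightarrow> (real \<Rightarrow> complex) \<Rightarrow> real \<Rightarrow> complex" where
  "hankel_integral \<alpha> f l = (LINT x|halfline. bessel_psi \<alpha> l x *\<^sub>R f x)"

text \<open>The integral need not converge for a general square integrable function. The Hankel
  transform is the extension by continuity of the integral operator from the dense subspace of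
  square integrable functions with compact support in the open half-line; \<open>is_hankel \<alpha> f g\<close>
  says that \<open>g\<close> represents the transform of \<open>f\<close>, which is unique up to null sets.\<close>

definition L2_compact_support :: "(real \<Rightarrow> complex) set" where
  "L2_compact_support =
    {f \<in> Lp 2 halfline. \<exists>a b. 0 < a \<and> a < b \<and> (\<forall>x. x \<notin> {a..b} \<longrightarrow> f x = 0)}"

definition is_hankel :: "real \<Rightarrow> (real \<Rightarrow> complex) \<Rightarrow> (real \<Rightarrow> complex) \<Rightarrow> bool" where
  "is_hankel \<alpha> f g \<longleftrightarrow> f \<in> Lp 2 halfline \<and> g \<in> Lp 2 halfline \<and>
    (\<exists>F :: nat \<Rightarrow> real \<Rightarrow> complex. (\<forall>n. F n \<in> L2_compact_support) \<and>
      (\<lambda>n. Lp_norm 2 halfline (\<lambda>x. F n x - f x)) \<longlonglongrightarrow> 0 \<and>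
      (\<lambda>n. Lp_norm 2 halfline (\<lambda>l. hankel_integral \<alpha> (F n) l - g l)) \<longlonglongrightarrow> 0)"

definition hankel :: "real \<Rightarrow> (real \<Rightarrow> complex) \<Rightarrow> real \<Rightarrow> complex" where
  "hankel \<alpha> f = (SOME g. is_hankel \<alpha> f g)"

definition bessel_kernel :: "real \<Rightarrow> real \<Rightarrow> real \<Rightarrow> real \<Rightarrow> real" where
  "bessel_kernel \<alpha> t x y =
    1 / (2 * t) * sqrt (x * y) * exp (- (x\<^sup>2 + y\<^sup>2) / (4 * t)) * besselI \<alpha> (x * y / (2 * t))"

text \<open>On square integrable functions the semigroup is defined spectrally, by the functional
  calculus of the self-adjoint Bessel operator, which the Hankel transform diagonalizes as
  multiplication by the square of the variable. On the remaining functions that are sums of an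
  integrable and an essentially bounded one it is defined by the heat kernel. For positive times
  and \<open>\<alpha> \<ge> - 1 / 2\<close> the kernel formula gives the spectral operator on square integrable functions
  as well; this is a theorem, not part of the definition.\<close>

definition bessel_semigroup :: "real \<Rightarrow> real \<Rightarrow> (real \<Rightarrow> complex) \<Rightarrow> real \<Rightarrow> complex" where
  "bessel_semigroup \<alpha> t f =
    (if t = 0 then f
     else if f \<in> Lp 2 halfline then hankel \<alpha> (\<lambda>l. exp (- t * l\<^sup>2) *\<^sub>R hankel \<alpha> f l)
     else (\<lambda>x. LINT y|halfline. bessel_kernel \<alpha> t x y *\<^sub>R f y))"

end

theory Submission
  imports Defs
begin

text \<open>Weber's second exponential integral, which follows from the power series of the Bessel
  functions, shows that the heat kernels compose and that, for \<open>f\<close> with compact support and Hankel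
  transform \<open>H f\<close>, the integral of \<open>exp (- t l\<^sup>2) \<bar>H f l\<bar>\<^sup>2\<close> is the quadratic form of the heat kernel
  at \<open>f\<close>. By Chebyshev's inequality for the Bessel process this form tends to the squared norm of
  \<open>f\<close> as \<open>t\<close> tends to 0. Hence \<open>H\<close> is isometric, and the spectral semigroup is given by the heat
  kernel; no asymptotics of Bessel functions are needed. By Schur's test everything now depends on
  the mass of the kernel, the integral of \<open>bessel_kernel \<alpha> t x y\<close> over \<open>y\<close>. It is a function of
  \<open>w = x\<^sup>2 / (4 t)\<close> alone, equal to 1 for \<open>\<alpha> = - 1 / 2\<close>, and otherwise, with \<open>b = \<alpha> / 2 + 1 / 4\<close>, equal
  to \<open>w powr b / Gamma b\<close> times the integral of \<open>exp (- w u) (1 - u) powr (b - 1 / 2) u powr (b - 1)\<close>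
  over \<open>0 < u < 1\<close>. For \<open>b \<ge> 1 / 2\<close> it is at most 1 and it is small for small \<open>w\<close>; for \<open>0 < b < 1 / 2\<close>
  it is bounded, but exceeds 1 for large \<open>w\<close>, which contradicts contractivity on bounded functions.\<close>

section \<open>Lebesgue spaces\<close>

text \<open>The semigroup is spectral on the square integrable functions and an integral operator
  elsewhere, and the transforms inside it are unspecified representatives. Hence little can be read
  off from the definition until both descriptions are known to agree almost everywhere; afterwards
  each claim concerns a positive symmetric kernel. In the spectral description the second transform
  acts only on the Gaussian exp(-t l^2) times the first one, and for compactly supported
  \<open>f\<close> this makes its integral absolutely convergent at every point. Very crude
  majorants then suffice: the power series with all signs made positive.

  I and J differ only in the sign of the squared argument of one entire function. One integral
  formula with parameters of either sign therefore yields both the composition of heat kernels and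
  their expansion into products of eigenfunctions.

  Distances in L^2 are measured by squared norms and (a + b)^2 \<le> 2 a^2 + 2 b^2. These estimates
  serve only limits and null sets, where constants do not matter. The sharp constant 1 enters
  through Schur's test alone.\<close>

definition sq_norm :: "'a measure \<Rightarrow> ('a \<Rightarrow> complex) \<Rightarrow> ennreal" where
  "sq_norm M f = (\<integral>\<^sup>+x. ennreal ((norm (f x))\<^sup>2) \<partial>M)"

lemma Lp_norm_finite_eq:
  assumes "f \<in> borel_measurable M" "p \<noteq> \<infinity>"
  shows "Lp_norm p M f = (if (\<integral>\<^sup>+x. ennreal (norm (f x) powr enn2real p) \<partial>M) = \<infinity> then \<infinity>
     else ennreal (enn2real (\<integral>\<^sup>+x. ennreal (norm (f x) powr enn2real p) \<partial>M) powr (1 / enn2real p)))"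
  using assms by (simp add: Lp_norm_def Let_def)

lemma Lp_norm_1: "f \<in> borel_measurable M \<Longrightarrow> Lp_norm 1 M f = (\<integral>\<^sup>+x. ennreal (norm (f x)) \<partial>M)"
  by (cases "\<integral>\<^sup>+x. ennreal (norm (f x)) \<partial>M") (simp_all add: Lp_norm_finite_eq)

lemma Lp_norm_2: "f \<in> borel_measurable M \<Longrightarrow>
    Lp_norm 2 M f = (if sq_norm M f = \<infinity> then \<infinity> else ennreal (sqrt (enn2real (sq_norm M f))))"
  by (simp add: Lp_norm_finite_eq sq_norm_def powr_half_sqrt)

lemma in_L2_iff: "f \<in> Lp 2 M \<longleftrightarrow> f \<in> borel_measurable M \<and> sq_norm M f < \<infinity>"
  by (auto simp: Lp_def Lp_norm_2 less_top split: if_splits)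

lemma in_L1_iff: "f \<in> Lp 1 M \<longleftrightarrow> f \<in> borel_measurable M \<and> (\<integral>\<^sup>+x. ennreal (norm (f x)) \<partial>M) < \<infinity>"
  by (auto simp: Lp_def Lp_norm_1)

lemma in_L1_iff_integrable: "f \<in> Lp 1 M \<longleftrightarrow> integrable M f"
  by (auto simp: in_L1_iff integrable_iff_bounded)

lemma Lp_norm_top: "f \<in> borel_measurable M \<Longrightarrow> Lp_norm \<infinity> M f = esssup M (\<lambda>x. ennreal (norm (f x)))"
  by (simp add: Lp_norm_def)

lemma Lp_norm_top_le:
  assumes "f \<in> borel_measurable M" "AE x in M. ennreal (norm (f x)) \<le> C"
  shows "Lp_norm \<infinity> M f \<le> C"
  unfolding Lp_norm_top[OF assms(1)] by (intro esssup_I) (use assms in auto)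

lemma AE_le_Lp_norm_top:
  assumes "f \<in> borel_measurable M"
  shows "AE x in M. ennreal (norm (f x)) \<le> Lp_norm \<infinity> M f"
  unfolding Lp_norm_top[OF assms] by (rule esssup_AE)

lemma in_Linf_iff: "f \<in> Lp \<infinity> M \<longleftrightarrow> f \<in> borel_measurable M \<and> (\<exists>C::real. AE x in M. norm (f x) \<le> C)"
proof safe
  assume f: "f \<in> Lp \<infinity> M"
  then show m: "f \<in> borel_measurable M" by (simp add: Lp_def)
  have "Lp_norm \<infinity> M f < top" using f by (simp add: Lp_def)
  then obtain C where C: "Lp_norm \<infinity> M f = ennreal C" "C \<ge> 0" by (metis less_top_ennreal less_imp_le)
  from AE_le_Lp_norm_top[OF m] have "AE x in M. norm (f x) \<le> C" unfolding C using C by simp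
  then show "\<exists>C::real. AE x in M. norm (f x) \<le> C" ..
next
  fix C :: real assume f: "f \<in> borel_measurable M" "AE x in M. norm (f x) \<le> C"
  have "AE x in M. ennreal (norm (f x)) \<le> ennreal C" using f(2) by eventually_elim (rule ennreal_leI)
  from Lp_norm_top_le[OF f(1) this] have "Lp_norm \<infinity> M f < \<infinity>" by (rule order.strict_trans1) simp
  then show "f \<in> Lp \<infinity> M" using f by (simp add: Lp_def)
qed

lemma Lp_norm_cong_AE:
  assumes "AE x in M. f x = g x" "f \<in> borel_measurable M" "g \<in> borel_measurable M"
  shows "Lp_norm p M f = Lp_norm p M g"
proof -
  have 1: "(\<integral>\<^sup>+x. ennreal (norm (f x) powr r) \<partial>M) = (\<integral>\<^sup>+x. ennreal (norm (g x) powr r) \<partial>M)" for r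
    by (rule nn_integral_cong_AE) (use assms(1) in eventually_elim, simp)
  have 2: "esssup M (\<lambda>x. ennreal (norm (f x))) = esssup M (\<lambda>x. ennreal (norm (g x)))"
    by (rule esssup_AE_cong) (use assms in auto)
  show ?thesis using assms(2,3) by (simp add: Lp_norm_def 1 2)
qed

lemma sq_norm_cong_AE: "AE x in M. f x = g x \<Longrightarrow> sq_norm M f = sq_norm M g"
  unfolding sq_norm_def by (rule nn_integral_cong_AE) (auto elim: eventually_mono)

text \<open>This is the form in which Schur's test delivers finite exponents. An infinite integral
  on the right makes the right-hand norm infinite, because \<open>c\<close> is positive; otherwise
  both integrals are real numbers and the root can be taken.\<close>

lemma Lp_norm_le_scale:
  assumes p: "1 \<le> p" "p \<noteq> \<infinity>" and c: "c > 0" and m: "f \<in> borel_measurable M" "g \<in> borel_measurable M"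
    and le: "(\<integral>\<^sup>+x. ennreal (norm (g x) powr enn2real p) \<partial>M) \<le> ennreal (c powr enn2real p) * (\<integral>\<^sup>+x. ennreal (norm (f x) powr enn2real p) \<partial>M)"
  shows "Lp_norm p M g \<le> ennreal c * Lp_norm p M f"
proof -
  let ?r = "enn2real p"
  let ?F = "\<integral>\<^sup>+x. ennreal (norm (f x) powr ?r) \<partial>M" and ?G = "\<integral>\<^sup>+x. ennreal (norm (g x) powr ?r) \<partial>M"
  have r: "?r \<ge> 1" using p by (metis enn2real_1 enn2real_mono infinity_ennreal_def less_top)
  show ?thesis
  proof (cases "?F = \<infinity>")
    case True
    then show ?thesis using m p c by (simp add: Lp_norm_finite_eq ennreal_mult_top)
  next
    case F: False
    then have G: "?G \<noteq> \<infinity>" using le by (auto simp: top_unique ennreal_mult_eq_top_iff)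
    have "enn2real ?G \<le> c powr ?r * enn2real ?F"
      using enn2real_mono[OF le] F by (simp add: enn2real_mult ennreal_mult_less_top less_top)
    then have "enn2real ?G powr (1 / ?r) \<le> (c powr ?r * enn2real ?F) powr (1 / ?r)"
      using r by (intro powr_mono2) auto
    also have "\<dots> = c * enn2real ?F powr (1 / ?r)" using r c by (simp add: powr_mult powr_powr)
    finally show ?thesis using F G m p c by (simp add: Lp_norm_finite_eq ennreal_mult''[symmetric] ennreal_leI)
  qed
qed

section \<open>The sum space of integrable and essentially bounded functions\<close>

lemma Lp_subset_L1_plus_Linf:
  assumes p: "1 \<le> p"
  shows "Lp p M \<subseteq> L1_plus_Linf M"
proof
  fix f assume f: "f \<in> Lp p M"
  then have m[measurable]: "f \<in> borel_measurable M" by (simp add: Lp_def)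
  have z1: "(\<lambda>_. 0) \<in> Lp 1 M" by (simp add: in_L1_iff)
  show "f \<in> L1_plus_Linf M"
  proof (cases "p = \<infinity>")
    case True
    then show ?thesis using f m z1 unfolding L1_plus_Linf_def by force
  next
    case False
    let ?r = "enn2real p"
    have r: "?r \<ge> 1" using p False by (metis enn2real_1 enn2real_mono infinity_ennreal_def less_top)
    have I: "(\<integral>\<^sup>+x. ennreal (norm (f x) powr ?r) \<partial>M) < \<infinity>"
      using f False by (auto simp: Lp_def Lp_norm_finite_eq less_top split: if_splits)
    \<comment> \<open>The split is at height 1: above it the modulus is at most its power with
      exponent \<open>?r\<close>, since \<open>?r\<close> is at least 1; below it the function is
      bounded.\<close>
    let ?g = "\<lambda>x. if norm (f x) > 1 then f x else 0" and ?h = "\<lambda>x. if norm (f x) > 1 then 0 else f x"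
    have "(\<integral>\<^sup>+x. ennreal (norm (?g x)) \<partial>M) \<le> (\<integral>\<^sup>+x. ennreal (norm (f x) powr ?r) \<partial>M)"
    proof (intro nn_integral_mono ennreal_leI)
      fix x show "norm (?g x) \<le> norm (f x) powr ?r"
        using powr_mono[of 1 ?r "norm (f x)"] r by auto
    qed
    then have "?g \<in> Lp 1 M" using I by (auto simp: in_L1_iff)
    moreover have "?h \<in> Lp \<infinity> M" unfolding in_Linf_iff by (auto intro!: exI[of _ 1])
    moreover have "AE x in M. f x = ?g x + ?h x" by auto
    ultimately show ?thesis unfolding L1_plus_Linf_def
      by (intro CollectI conjI m bexI[of _ ?g] bexI[of _ ?h])
  qed
qed

lemma L1_plus_Linf_measurable: "f \<in> L1_plus_Linf M \<Longrightarrow> f \<in> borel_measurable M"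
  by (simp add: L1_plus_Linf_def)

lemma L1_plus_Linf_cong_AE:
  "f \<in> L1_plus_Linf M \<Longrightarrow> g \<in> borel_measurable M \<Longrightarrow> AE x in M. f x = g x \<Longrightarrow> g \<in> L1_plus_Linf M"
  unfolding L1_plus_Linf_def
proof safe
  fix g1 h1 assume "AE x in M. f x = g x" "g1 \<in> Lp 1 M" "h1 \<in> Lp \<infinity> M" "AE x in M. f x = g1 x + h1 x"
  then show "\<exists>g'\<in>Lp 1 M. \<exists>h\<in>Lp \<infinity> M. AE x in M. g x = g' x + h x"
    by (intro bexI[of _ g1] bexI[of _ h1]) auto
qed

lemma L1_plus_Linf_linear:
  assumes "f \<in> L1_plus_Linf M" "g \<in> L1_plus_Linf M"
  shows "(\<lambda>x. a * f x + b * g x) \<in> L1_plus_Linf M"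
proof -
  obtain f1 f2 where f: "f \<in> borel_measurable M" "f1 \<in> Lp 1 M" "f2 \<in> Lp \<infinity> M" "AE x in M. f x = f1 x + f2 x"
    using assms(1) by (auto simp: L1_plus_Linf_def)
  obtain g1 g2 where g: "g \<in> borel_measurable M" "g1 \<in> Lp 1 M" "g2 \<in> Lp \<infinity> M" "AE x in M. g x = g1 x + g2 x"
    using assms(2) by (auto simp: L1_plus_Linf_def)
  have "(\<lambda>x. a * f1 x + b * g1 x) \<in> Lp 1 M"
    using f(2) g(2) by (simp add: in_L1_iff_integrable)
  moreover have "(\<lambda>x. a * f2 x + b * g2 x) \<in> Lp \<infinity> M"
  proof -
    obtain C D where CD: "AE x in M. norm (f2 x) \<le> C" "AE x in M. norm (g2 x) \<le> D"
      using f(3) g(3) unfolding in_Linf_iff by blast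
    from CD have "AE x in M. norm (a * f2 x + b * g2 x) \<le> norm a * C + norm b * D"
    proof eventually_elim
      case (elim x)
      have "norm (a * f2 x + b * g2 x) \<le> norm a * norm (f2 x) + norm b * norm (g2 x)"
        by (metis norm_triangle_ineq norm_mult)
      also have "\<dots> \<le> norm a * C + norm b * D" using elim by (intro add_mono mult_left_mono) auto
      finally show ?case .
    qed
    moreover have "f2 \<in> borel_measurable M" "g2 \<in> borel_measurable M" using f(3) g(3) unfolding in_Linf_iff by auto
    ultimately show ?thesis unfolding in_Linf_iff by (auto intro!: exI)
  qed
  moreover have "AE x in M. a * f x + b * g x = (a * f1 x + b * g1 x) + (a * f2 x + b * g2 x)"
    using f(4) g(4) by eventually_elim (simp add: algebra_simps)
  moreover have "(\<lambda>x. a * f x + b * g x) \<in> borel_measurable M" using f(1) g(1) by measurable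
  ultimately show ?thesis unfolding L1_plus_Linf_def
    by (intro CollectI conjI bexI[of _ "\<lambda>x. a * f1 x + b * g1 x"] bexI[of _ "\<lambda>x. a * f2 x + b * g2 x"])
qed

section \<open>Quadratic estimates and convergence in the mean\<close>

lemma norm_mult_le_squares: "norm (f * cnj g) \<le> (norm f)\<^sup>2 + (norm g)\<^sup>2"
  using sum_squares_bound[of "norm f" "norm g"] mult_nonneg_nonneg[OF norm_ge_zero[of f] norm_ge_zero[of g]]
  unfolding norm_mult complex_mod_cnj by linarith

lemma sq_norm_add:
  assumes "f \<in> borel_measurable M" "g \<in> borel_measurable M"
  shows "sq_norm M (\<lambda>x. f x + g x) \<le> 2 * sq_norm M f + 2 * sq_norm M g"
proof -
  have "sq_norm M (\<lambda>x. f x + g x) \<le> (\<integral>\<^sup>+x. 2 * ennreal ((norm (f x))\<^sup>2) + 2 * ennreal ((norm (g x))\<^sup>2) \<partial>M)"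
    unfolding sq_norm_def
  proof (intro nn_integral_mono)
    fix x
    have "(norm (f x + g x))\<^sup>2 \<le> (norm (f x) + norm (g x))\<^sup>2" by (intro power_mono norm_triangle_ineq) auto
    also have "\<dots> \<le> 2 * (norm (f x))\<^sup>2 + 2 * (norm (g x))\<^sup>2"
      using sum_squares_bound[of "norm (f x)" "norm (g x)"] by (simp add: power2_sum)
    finally have "ennreal ((norm (f x + g x))\<^sup>2) \<le> ennreal (2 * (norm (f x))\<^sup>2 + 2 * (norm (g x))\<^sup>2)" by (rule ennreal_leI)
    then show "ennreal ((norm (f x + g x))\<^sup>2) \<le> 2 * ennreal ((norm (f x))\<^sup>2) + 2 * ennreal ((norm (g x))\<^sup>2)"
      by (simp add: ennreal_plus ennreal_mult')
  qed
  also have "\<dots> = 2 * sq_norm M f + 2 * sq_norm M g"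
    unfolding sq_norm_def using assms by (subst nn_integral_add) (auto simp: nn_integral_cmult)
  finally show ?thesis .
qed

lemma sq_norm_scale: "f \<in> borel_measurable M \<Longrightarrow> sq_norm M (\<lambda>x. a * f x) = ennreal ((norm a)\<^sup>2) * sq_norm M f"
  unfolding sq_norm_def by (subst nn_integral_cmult[symmetric]) (auto simp: norm_mult power_mult_distrib ennreal_mult')

lemma sq_norm_minus: "sq_norm M (\<lambda>x. f x - g x) = sq_norm M (\<lambda>x. g x - f x)"
  by (simp add: sq_norm_def norm_minus_commute)

lemma sq_norm_diff_triangle:
  assumes "f \<in> borel_measurable M" "g \<in> borel_measurable M" "h \<in> borel_measurable M"
  shows "sq_norm M (\<lambda>x. f x - h x) \<le> 2 * sq_norm M (\<lambda>x. f x - g x) + 2 * sq_norm M (\<lambda>x. g x - h x)"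
  using sq_norm_add[of "\<lambda>x. f x - g x" M "\<lambda>x. g x - h x"] assms by simp

lemma L2_add: "f \<in> Lp 2 M \<Longrightarrow> g \<in> Lp 2 M \<Longrightarrow> (\<lambda>x. f x + g x) \<in> Lp 2 M"
  using sq_norm_add[of f M g]
  by (auto simp: in_L2_iff ennreal_mult_less_top intro: order.strict_trans1)

lemma L2_scale: "f \<in> Lp 2 M \<Longrightarrow> (\<lambda>x. a * f x) \<in> Lp 2 M"
  by (auto simp: in_L2_iff sq_norm_scale ennreal_mult_less_top)

lemma L2_diff: "f \<in> Lp 2 M \<Longrightarrow> g \<in> Lp 2 M \<Longrightarrow> (\<lambda>x. f x - g x) \<in> Lp 2 M"
  using L2_add[of f M "\<lambda>x. (-1) * g x"] L2_scale[of g M "-1"] by simp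

lemma L2_mono:
  assumes "f \<in> borel_measurable M" "g \<in> Lp 2 M" "\<And>x. x \<in> space M \<Longrightarrow> norm (f x) \<le> norm (g x)"
  shows "f \<in> Lp 2 M"
proof -
  have "sq_norm M f \<le> sq_norm M g" unfolding sq_norm_def
    by (intro nn_integral_mono ennreal_leI power_mono assms) auto
  then show ?thesis using assms by (auto simp: in_L2_iff)
qed

lemma ennreal_tendsto_0I:
  fixes f :: "'a \<Rightarrow> ennreal"
  assumes "\<And>e::real. e > 0 \<Longrightarrow> \<forall>\<^sub>F x in F. f x \<le> ennreal e"
  shows "(f \<longlongrightarrow> 0) F"
proof (rule order_tendstoI)
  fix a :: ennreal assume a: "0 < a"
  obtain e where e: "e > 0" "ennreal e < a"
  proof (cases a)
    case (real r)
    then have "r > 0" using a by simp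
    then show thesis using real by (intro that[of "r / 2"]) (auto simp: ennreal_less_iff)
  qed (auto intro: that[of 1])
  show "\<forall>\<^sub>F x in F. f x < a"
    using assms[OF e(1)] by eventually_elim (use e in auto)
qed auto

text \<open>Limits in the definitions are stated with \<open>Lp_norm\<close>, whose root and case
  distinction at infinity are awkward in estimates; this replaces it by the additive quantity
  \<open>sq_norm\<close>.\<close>

lemma Lp_norm_2_tendsto_0_iff:
  assumes m: "\<forall>\<^sub>F n in F. f n \<in> borel_measurable M"
  shows "((\<lambda>n. Lp_norm 2 M (f n)) \<longlongrightarrow> 0) F \<longleftrightarrow> ((\<lambda>n. sq_norm M (f n)) \<longlongrightarrow> 0) F"
proof
  assume *: "((\<lambda>n. Lp_norm 2 M (f n)) \<longlongrightarrow> 0) F"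
  show "((\<lambda>n. sq_norm M (f n)) \<longlongrightarrow> 0) F"
  proof (rule ennreal_tendsto_0I)
    fix e :: real assume e: "e > 0"
    have "\<forall>\<^sub>F n in F. Lp_norm 2 M (f n) < ennreal (sqrt e)" using order_tendstoD(2)[OF *] e by simp
    then show "\<forall>\<^sub>F n in F. sq_norm M (f n) \<le> ennreal e" using m
    proof eventually_elim
      case (elim n)
      show ?case
      proof (cases "sq_norm M (f n) = \<infinity>")
        case False
        then show ?thesis using elim e
          by (cases "sq_norm M (f n)") (auto simp: Lp_norm_2 ennreal_less_iff)
      qed (use elim in \<open>auto simp: Lp_norm_2\<close>)
    qed
  qed
next
  assume *: "((\<lambda>n. sq_norm M (f n)) \<longlongrightarrow> 0) F"
  show "((\<lambda>n. Lp_norm 2 M (f n)) \<longlongrightarrow> 0) F"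
  proof (rule ennreal_tendsto_0I)
    fix e :: real assume e: "e > 0"
    have "\<forall>\<^sub>F n in F. sq_norm M (f n) < ennreal (e\<^sup>2)" using order_tendstoD(2)[OF *] e by simp
    then show "\<forall>\<^sub>F n in F. Lp_norm 2 M (f n) \<le> ennreal e" using m
    proof eventually_elim
      case (elim n)
      then have "sq_norm M (f n) \<noteq> \<infinity>" by auto
      then show ?case using elim e
        by (cases "sq_norm M (f n)") (auto simp: Lp_norm_2 ennreal_less_iff real_le_lsqrt less_imp_le)
    qed
  qed
qed

lemma ennreal_le_suminf: "f n \<le> suminf f" for f :: "nat \<Rightarrow> ennreal"
  using sum_le_suminf[of f "{n}"] by simp

text \<open>Riesz--Fischer: rapid convergence in the mean makes the weighted sum of squared increments
  finite almost everywhere, so the increments are dominated by a geometric series.\<close>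

lemma L2_rapidly_Cauchy_converges:
  fixes F :: "nat \<Rightarrow> 'a \<Rightarrow> complex"
  assumes F: "\<And>n. F n \<in> Lp 2 M"
    and C: "\<And>n m. n \<le> m \<Longrightarrow> sq_norm M (\<lambda>x. F m x - F n x) \<le> ennreal ((1 / 8) ^ n)"
  obtains g where "g \<in> Lp 2 M" "(\<lambda>n. sq_norm M (\<lambda>x. F n x - g x)) \<longlonglongrightarrow> 0"
proof -
  have m[measurable]: "F n \<in> borel_measurable M" for n using F by (simp add: in_L2_iff)
  \<comment> \<open>The weight 4^n is chosen between two rates: against the assumed (1/8)^n it
    leaves a convergent series (1/2)^n of integrals, and a finite value of \<open>S\<close> still
    forces increments of order (1/2)^n.\<close>
  define S where "S x = (\<Sum>n. ennreal (4 ^ n * (norm (F (Suc n) x - F n x))\<^sup>2))" for x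
  have [measurable]: "S \<in> borel_measurable M" unfolding S_def[abs_def] by measurable
  have "(\<integral>\<^sup>+x. S x \<partial>M) = (\<Sum>n. (\<integral>\<^sup>+x. ennreal (4 ^ n * (norm (F (Suc n) x - F n x))\<^sup>2) \<partial>M))"
    unfolding S_def by (rule nn_integral_suminf) measurable
  also have "\<dots> \<le> (\<Sum>n. ennreal ((1 / 2) ^ n))"
  proof (rule suminf_le)
    fix n
    have "(\<integral>\<^sup>+x. ennreal (4 ^ n * (norm (F (Suc n) x - F n x))\<^sup>2) \<partial>M) = ennreal (4 ^ n) * sq_norm M (\<lambda>x. F (Suc n) x - F n x)"
      unfolding sq_norm_def by (subst nn_integral_cmult[symmetric]) (auto simp: ennreal_mult')
    also have "\<dots> \<le> ennreal (4 ^ n) * ennreal ((1 / 8) ^ n)" by (intro mult_left_mono C) auto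
    also have "\<dots> = ennreal ((1 / 2) ^ n)" by (simp add: ennreal_mult'[symmetric] power_mult_distrib[symmetric])
    finally show "(\<integral>\<^sup>+x. ennreal (4 ^ n * (norm (F (Suc n) x - F n x))\<^sup>2) \<partial>M) \<le> ennreal ((1 / 2) ^ n)" .
  qed auto
  also have "\<dots> = ennreal (\<Sum>n. (1 / 2) ^ n)" by (rule suminf_ennreal2) auto
  finally have "(\<integral>\<^sup>+x. S x \<partial>M) \<noteq> \<infinity>" by (metis ennreal_neq_top top.extremum_uniqueI infinity_ennreal_def)
  then have AEfin: "AE x in M. S x \<noteq> \<infinity>" by (intro nn_integral_noteq_infinite) auto
  have conv: "convergent (\<lambda>n. F n x)" if fin: "S x \<noteq> \<infinity>" for x
  proof -
    obtain K where K: "S x = ennreal K" "K \<ge> 0" using fin by (cases "S x") auto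
    have b: "norm (F (Suc n) x - F n x) \<le> sqrt K * (1 / 2) ^ n" for n
    proof -
      have "ennreal (4 ^ n * (norm (F (Suc n) x - F n x))\<^sup>2) \<le> ennreal K"
        unfolding K(1)[symmetric] S_def by (rule ennreal_le_suminf)
      then have "4 ^ n * (norm (F (Suc n) x - F n x))\<^sup>2 \<le> K" using K by simp
      then have "sqrt (4 ^ n * (norm (F (Suc n) x - F n x))\<^sup>2) \<le> sqrt K" by simp
      then have "2 ^ n * norm (F (Suc n) x - F n x) \<le> sqrt K"
        by (simp add: real_sqrt_mult real_sqrt_power)
      then show ?thesis by (simp add: field_simps power_one_over)
    qed
    have "summable (\<lambda>n. norm (F (Suc n) x - F n x))"
      by (rule summable_comparison_test'[of "\<lambda>n. sqrt K * (1 / 2) ^ n" 0]) (use b in auto)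
    then have "summable (\<lambda>n. F (Suc n) x - F n x)" by (rule summable_norm_cancel)
    from tendsto_add[OF summable_LIMSEQ[OF this] tendsto_const[of "F 0 x"]]
    have "(\<lambda>n. F n x) \<longlonglongrightarrow> (\<Sum>n. F (Suc n) x - F n x) + F 0 x"
      by (simp add: sum_lessThan_telescope[of "\<lambda>n. F n x"])
    then show ?thesis by (rule convergentI)
  qed
  define g where "g = (\<lambda>x. lim (\<lambda>n. F n x))"
  have gm[measurable]: "g \<in> borel_measurable M" unfolding g_def by measurable
  have lim: "AE x in M. (\<lambda>n. F n x) \<longlonglongrightarrow> g x"
    using AEfin by eventually_elim (use conv in \<open>auto simp: g_def convergent_LIMSEQ_iff\<close>)
  \<comment> \<open>Fatou's lemma in \<open>m\<close> for fixed \<open>n\<close> transfers the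
    Cauchy estimate to the pointwise limit.\<close>
  have le: "sq_norm M (\<lambda>x. F n x - g x) \<le> ennreal ((1 / 8) ^ n)" for n
  proof -
    have "sq_norm M (\<lambda>x. F n x - g x) = (\<integral>\<^sup>+x. liminf (\<lambda>m. ennreal ((norm (F n x - F m x))\<^sup>2)) \<partial>M)"
      unfolding sq_norm_def
    proof (intro nn_integral_cong_AE, use lim in eventually_elim)
      case (elim x)
      have "(\<lambda>m. ennreal ((norm (F n x - F m x))\<^sup>2)) \<longlonglongrightarrow> ennreal ((norm (F n x - g x))\<^sup>2)"
        by (intro tendsto_ennrealI tendsto_intros elim)
      then show ?case by (rule lim_imp_Liminf[OF trivial_limit_sequentially, symmetric])
    qed
    also have "\<dots> \<le> liminf (\<lambda>m. (\<integral>\<^sup>+x. ennreal ((norm (F n x - F m x))\<^sup>2) \<partial>M))"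
      by (rule nn_integral_liminf) measurable
    also have "\<dots> \<le> ennreal ((1 / 8) ^ n)"
    proof (rule Liminf_le[THEN order_trans])
      show "\<forall>\<^sub>F m in sequentially. (\<integral>\<^sup>+x. ennreal ((norm (F n x - F m x))\<^sup>2) \<partial>M) \<le> ennreal ((1 / 8) ^ n)"
        using C[of n] by (intro eventually_sequentiallyI[of n]) (auto simp: sq_norm_def norm_minus_commute)
    qed auto
    finally show ?thesis .
  qed
  have "(\<lambda>n. ennreal ((1 / 8) ^ n)) \<longlonglongrightarrow> ennreal 0" by (rule tendsto_ennrealI, rule LIMSEQ_power_zero) simp
  then have "(\<lambda>n. ennreal ((1 / 8) ^ n)) \<longlonglongrightarrow> 0" by simp
  from tendsto_sandwich[OF _ _ tendsto_const this, of "\<lambda>n. sq_norm M (\<lambda>x. F n x - g x)"] le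
  have "(\<lambda>n. sq_norm M (\<lambda>x. F n x - g x)) \<longlonglongrightarrow> 0" by simp
  moreover have "g \<in> Lp 2 M"
  proof -
    have "(\<lambda>x. F 0 x - g x) \<in> Lp 2 M" using le[of 0] by (auto simp: in_L2_iff intro: order.strict_trans1)
    from L2_diff[OF F[of 0] this] show ?thesis by simp
  qed
  ultimately show ?thesis using that by blast
qed

section \<open>Symmetric kernels of bounded mass\<close>

lemma borel_measurable_cnj [measurable (raw)]: "f \<in> borel_measurable M \<Longrightarrow> (\<lambda>x. cnj (f x)) \<in> borel_measurable M"
  by (rule borel_measurable_continuous_on[OF continuous_on_cnj[OF continuous_on_id]])

lemma (in sigma_finite_measure) pair_sigma_finite_self: "pair_sigma_finite M M"
  by unfold_locales

text \<open>Tonelli's theorem turns a finite iterated integral of the norm into integrability on the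
  product, so that each application has to bound iterated integrals only.\<close>

lemma complex_Fubini:
  fixes f :: "'a \<Rightarrow> 'a \<Rightarrow> complex"
  assumes "sigma_finite_measure M" and m: "case_prod f \<in> borel_measurable (M \<Otimes>\<^sub>M M)"
    and fin: "(\<integral>\<^sup>+x. (\<integral>\<^sup>+y. ennreal (norm (f x y)) \<partial>M) \<partial>M) < \<infinity>"
  shows "(LINT x|M. LINT y|M. f x y) = (LINT y|M. LINT x|M. f x y)"
    and "integrable M (\<lambda>x. LINT y|M. f x y)"
proof -
  interpret sigma_finite_measure M by fact
  interpret P: pair_sigma_finite M M by (rule pair_sigma_finite_self)
  have m': "(\<lambda>z. ennreal (norm (case_prod f z))) \<in> borel_measurable (M \<Otimes>\<^sub>M M)" using m by measurable
  have "(\<integral>\<^sup>+z. ennreal (norm (case_prod f z)) \<partial>(M \<Otimes>\<^sub>M M)) < \<infinity>"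
    using fin unfolding nn_integral_fst[OF m', symmetric] by simp
  then have i: "integrable (M \<Otimes>\<^sub>M M) (case_prod f)" using m by (simp add: integrable_iff_bounded)
  show "(LINT x|M. LINT y|M. f x y) = (LINT y|M. LINT x|M. f x y)" by (rule P.Fubini_integral[OF i, symmetric])
  show "integrable M (\<lambda>x. LINT y|M. f x y)" using P.integrable_fst'[OF i] by simp
qed

text \<open>The convex function u^r lies above its tangent at \<open>a\<close>. This is Young's
  inequality for the conjugate exponents r and r / (r - 1), and it takes the place of Hoelder's
  inequality in Schur's test.\<close>

lemma powr_tangent_le:
  fixes a u r :: real
  assumes "a > 0" "u \<ge> 0" "r \<ge> 1"
  shows "r * a powr (r - 1) * u \<le> u powr r + (r - 1) * a powr r"
proof (cases "r = 1")
  case False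
  then have r: "r > 1" using assms by simp
  have "u * a powr (r - 1) \<le> u powr r / r + (a powr (r - 1)) powr (r / (r - 1)) / (r / (r - 1))"
    using r assms by (intro Youngs_inequality) (auto simp: field_simps)
  also have "(a powr (r - 1)) powr (r / (r - 1)) = a powr r" using r by (simp add: powr_powr)
  finally have "r * (u * a powr (r - 1)) \<le> r * (u powr r / r + a powr r / (r / (r - 1)))"
    using r by (intro mult_left_mono) auto
  also have "\<dots> = u powr r + (r - 1) * a powr r" using r by (simp add: field_simps)
  finally show ?thesis by (simp add: mult_ac)
qed (use assms in auto)

section \<open>Schur's test for a nonnegative symmetric kernel\<close>

locale schur_kernel = sigma_finite_measure M for M :: "'a measure" +
  fixes k :: "'a \<Rightarrow> 'a \<Rightarrow> real" and c :: real
  assumes k_measurable: "case_prod k \<in> borel_measurable (M \<Otimes>\<^sub>M M)"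
    and k_nonneg: "\<And>x y. x \<in> space M \<Longrightarrow> y \<in> space M \<Longrightarrow> 0 \<le> k x y"
    and k_sym: "\<And>x y. k x y = k y x"
    and c_pos: "c > 0"
    and mass_le: "\<And>x. x \<in> space M \<Longrightarrow> (\<integral>\<^sup>+y. ennreal (k x y) \<partial>M) \<le> ennreal c"
begin

definition op :: "('a \<Rightarrow> complex) \<Rightarrow> 'a \<Rightarrow> complex" where
  "op f x = (LINT y|M. k x y *\<^sub>R f y)"

lemma k_measurable2 [measurable (raw)]:
  assumes "f \<in> measurable N M" "g \<in> measurable N M"
  shows "(\<lambda>x. k (f x) (g x)) \<in> borel_measurable N"
proof -
  have "(\<lambda>x. (f x, g x)) \<in> measurable N (M \<Otimes>\<^sub>M M)" using assms by measurable
  from measurable_compose[OF this k_measurable] show ?thesis by simp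
qed

lemma k_measurable1: "x \<in> space M \<Longrightarrow> k x \<in> borel_measurable M"
  by measurable

lemma op_measurable:
  assumes [measurable]: "f \<in> borel_measurable M"
  shows "op f \<in> borel_measurable M"
  unfolding op_def[abs_def] by (rule borel_measurable_lebesgue_integral) measurable

lemma op_cong_AE:
  assumes "AE x in M. f x = g x" "f \<in> borel_measurable M" "g \<in> borel_measurable M" "x \<in> space M"
  shows "op f x = op g x"
  unfolding op_def
proof (rule integral_cong_AE)
  show "AE y in M. k x y *\<^sub>R f y = k x y *\<^sub>R g y" using assms(1) by eventually_elim simp
qed (use assms k_measurable1 in measurable)

text \<open>The case of exponent 1. By symmetry the bound on the mass in \<open>y\<close> is also
  one in \<open>x\<close>, so after Tonelli the inner integral is at most \<open>c\<close>.\<close>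

lemma nn_integral_kernel_le:
  assumes [measurable]: "u \<in> borel_measurable M"
  shows "(\<integral>\<^sup>+x. (\<integral>\<^sup>+y. ennreal (k x y) * u y \<partial>M) \<partial>M) \<le> ennreal c * (\<integral>\<^sup>+y. u y \<partial>M)"
proof -
  interpret P: pair_sigma_finite M M by (rule pair_sigma_finite_self)
  have "(\<integral>\<^sup>+x. (\<integral>\<^sup>+y. ennreal (k x y) * u y \<partial>M) \<partial>M) = (\<integral>\<^sup>+y. (\<integral>\<^sup>+x. ennreal (k x y) * u y \<partial>M) \<partial>M)"
    by (rule P.Fubini'[symmetric]) measurable
  also have "\<dots> \<le> (\<integral>\<^sup>+y. ennreal c * u y \<partial>M)"
  proof (intro nn_integral_mono)
    fix y assume y: "y \<in> space M"
    have "(\<integral>\<^sup>+x. ennreal (k x y) * u y \<partial>M) = (\<integral>\<^sup>+x. ennreal (k y x) \<partial>M) * u y"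
      unfolding k_sym[of _ y] by (rule nn_integral_multc) (use k_measurable1[OF y] in measurable)
    then show "(\<integral>\<^sup>+x. ennreal (k x y) * u y \<partial>M) \<le> ennreal c * u y"
      using mass_le[OF y] by (simp add: mult_right_mono)
  qed
  also have "\<dots> = ennreal c * (\<integral>\<^sup>+y. u y \<partial>M)" by (rule nn_integral_cmult) measurable
  finally show ?thesis .
qed

text \<open>Valid for every measurable \<open>f\<close>: if the right-hand integral is infinite
  there is nothing to prove, and this includes the points at which the Bochner integral falls back
  to its default value 0.\<close>

lemma op_norm_le:
  assumes f: "f \<in> borel_measurable M" and x: "x \<in> space M"
  shows "ennreal (norm (op f x)) \<le> (\<integral>\<^sup>+y. ennreal (k x y) * ennreal (norm (f y)) \<partial>M)"
proof (cases "(\<integral>\<^sup>+y. ennreal (k x y) * ennreal (norm (f y)) \<partial>M) = \<infinity>")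
  case False
  have eq: "(\<integral>\<^sup>+y. ennreal (norm (k x y *\<^sub>R f y)) \<partial>M) = (\<integral>\<^sup>+y. ennreal (k x y) * ennreal (norm (f y)) \<partial>M)"
    by (intro nn_integral_cong) (use k_nonneg[OF x] in \<open>auto simp: ennreal_mult'\<close>)
  then have "integrable M (\<lambda>y. k x y *\<^sub>R f y)"
    using False f k_measurable1[OF x] by (auto simp: integrable_iff_bounded less_top)
  from integral_norm_bound_ennreal[OF this] show ?thesis unfolding op_def eq .
qed simp

text \<open>Jensen's inequality for the measure with density \<open>k x\<close>, whose mass is at
  most \<open>c\<close> instead of exactly 1; the deficit in mass costs nothing, since the bound is
  expressed by \<open>c\<close>.\<close>

lemma op_powr_le:
  assumes f: "f \<in> borel_measurable M" and x: "x \<in> space M" and r: "r \<ge> 1"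
  shows "ennreal (norm (op f x) powr r) \<le> ennreal (c powr (r - 1)) * (\<integral>\<^sup>+y. ennreal (k x y) * ennreal (norm (f y) powr r) \<partial>M)"
proof -
  note [measurable] = f k_measurable1[OF x]
  let ?B = "\<integral>\<^sup>+y. ennreal (k x y) * ennreal (norm (f y) powr r) \<partial>M"
  let ?A = "\<integral>\<^sup>+y. ennreal (k x y) * ennreal (norm (f y)) \<partial>M"
  show ?thesis
  proof (cases "?B = \<infinity>")
    case True
    then show ?thesis using c_pos by (simp add: ennreal_mult_top)
  next
    case False
    then obtain B where B: "?B = ennreal B" "B \<ge> 0" by (cases ?B) auto
    \<comment> \<open>The tangent inequality is integrated against the kernel with the point of
      tangency left free. The choice 1 shows that \<open>?A\<close> is finite; the optimal choice is
      made afterwards.\<close>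
    have tangent: "ennreal (r * a powr (r - 1)) * ?A \<le> ennreal (B + (r - 1) * a powr r * c)" if a: "a > 0" for a
    proof -
      have "ennreal (r * a powr (r - 1)) * ?A = (\<integral>\<^sup>+y. ennreal (r * a powr (r - 1)) * (ennreal (k x y) * ennreal (norm (f y))) \<partial>M)"
        by (rule nn_integral_cmult[symmetric]) measurable
      also have "\<dots> \<le> (\<integral>\<^sup>+y. ennreal (k x y) * ennreal (norm (f y) powr r) + ennreal ((r - 1) * a powr r) * ennreal (k x y) \<partial>M)"
      proof (intro nn_integral_mono)
        fix y assume y: "y \<in> space M"
        have "k x y * (r * a powr (r - 1) * norm (f y)) \<le> k x y * (norm (f y) powr r + (r - 1) * a powr r)"
          using k_nonneg[OF x y] r a by (intro mult_left_mono powr_tangent_le) auto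
        moreover have "ennreal (r * a powr (r - 1)) * (ennreal (k x y) * ennreal (norm (f y))) = ennreal (k x y * (r * a powr (r - 1) * norm (f y)))"
          using k_nonneg[OF x y] r a by (simp add: ennreal_mult''[symmetric] mult_ac)
        moreover have "ennreal (k x y) * ennreal (norm (f y) powr r) + ennreal ((r - 1) * a powr r) * ennreal (k x y) =
            ennreal (k x y * (norm (f y) powr r + (r - 1) * a powr r))"
        proof -
          have "k x y * (norm (f y) powr r + (r - 1) * a powr r) = k x y * norm (f y) powr r + (r - 1) * a powr r * k x y"
            by (simp only: distrib_left mult_ac)
          then show ?thesis using k_nonneg[OF x y] r by (simp only: ennreal_plus ennreal_mult'' powr_ge_zero mult_nonneg_nonneg diff_ge_0_iff_ge)
        qed
        ultimately show "ennreal (r * a powr (r - 1)) * (ennreal (k x y) * ennreal (norm (f y))) \<le>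
           ennreal (k x y) * ennreal (norm (f y) powr r) + ennreal ((r - 1) * a powr r) * ennreal (k x y)"
          by (simp only: ennreal_leI)
      qed
      also have "\<dots> = ?B + ennreal ((r - 1) * a powr r) * (\<integral>\<^sup>+y. ennreal (k x y) \<partial>M)"
        by (subst nn_integral_add) (auto simp: nn_integral_cmult)
      also have "\<dots> \<le> ennreal B + ennreal ((r - 1) * a powr r) * ennreal c"
        unfolding B by (intro add_left_mono mult_left_mono mass_le x) auto
      also have "\<dots> = ennreal (B + (r - 1) * a powr r * c)"
        using B r c_pos by (simp add: ennreal_mult''[symmetric] ennreal_plus[symmetric] del: ennreal_plus)
      finally show ?thesis .
    qed
    have "?A \<noteq> \<infinity>"
    proof
      assume "?A = \<infinity>"
      then show False using tangent[of 1] r by (simp add: ennreal_mult_top top_unique)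
    qed
    then obtain A where A: "?A = ennreal A" "A \<ge> 0" by (cases ?A) auto
    have "norm (op f x) \<le> A" using op_norm_le[OF f x] A by simp
    then have "norm (op f x) powr r \<le> A powr r" using r by (intro powr_mono2) auto
    also have "\<dots> \<le> c powr (r - 1) * B"
    proof (cases "A = 0")
      case False
      \<comment> \<open>The mean value of the modulus if the mass were \<open>c\<close>. With A = a
        c the tangent inequality collapses to a^r c \<le> B.\<close>
      define a where "a = A / c"
      have a: "a > 0" "A = a * c" using False A c_pos by (auto simp: a_def)
      have "r * a powr (r - 1) * A \<le> B + (r - 1) * a powr r * c"
      proof -
        have "ennreal (r * a powr (r - 1) * A) \<le> ennreal (B + (r - 1) * a powr r * c)"
          using tangent[OF a(1)] unfolding A(1) ennreal_mult''[OF A(2)] .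
        then show ?thesis using B r c_pos by (subst (asm) ennreal_le_iff) auto
      qed
      also have "r * a powr (r - 1) * A = r * a powr r * c"
        using a powr_add[of a 1 "r - 1"] by simp
      finally have "a powr r * c \<le> B" by (simp add: algebra_simps)
      then have "c powr (r - 1) * (a powr r * c) \<le> c powr (r - 1) * B" by (intro mult_left_mono) auto
      moreover have "c powr (r - 1) * (a powr r * c) = A powr r"
        using a c_pos powr_add[of c 1 "r - 1"] by (simp add: powr_mult)
      ultimately show ?thesis by simp
    qed (use B in auto)
    finally have "ennreal (norm (op f x) powr r) \<le> ennreal (c powr (r - 1) * B)" by (rule ennreal_leI)
    then show ?thesis using B by (simp add: ennreal_mult'')
  qed
qed

text \<open>For exponent infinity the mass bound is used directly. For a finite exponent r the
  pointwise Jensen bound contributes c^(r-1) and the integration in the other variable one more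
  factor c, so the norm picks up exactly c.\<close>

lemma Lp_norm_op_le:
  assumes p: "1 \<le> p" and f: "f \<in> borel_measurable M"
  shows "Lp_norm p M (op f) \<le> ennreal c * Lp_norm p M f"
proof (cases "p = \<infinity>")
  case True
  have "ennreal (norm (op f x)) \<le> ennreal c * Lp_norm \<infinity> M f" if x: "x \<in> space M" for x
  proof -
    note [measurable] = k_measurable1[OF x]
    have "ennreal (norm (op f x)) \<le> (\<integral>\<^sup>+y. ennreal (k x y) * ennreal (norm (f y)) \<partial>M)" by (rule op_norm_le[OF f x])
    also have "\<dots> \<le> (\<integral>\<^sup>+y. ennreal (k x y) * Lp_norm \<infinity> M f \<partial>M)"
      by (intro nn_integral_mono_AE, use AE_le_Lp_norm_top[OF f] in eventually_elim) (auto intro: mult_left_mono)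
    also have "\<dots> = (\<integral>\<^sup>+y. ennreal (k x y) \<partial>M) * Lp_norm \<infinity> M f" by (rule nn_integral_multc) measurable
    also have "\<dots> \<le> ennreal c * Lp_norm \<infinity> M f" by (intro mult_right_mono mass_le x) auto
    finally show ?thesis .
  qed
  then show ?thesis unfolding True by (intro Lp_norm_top_le op_measurable[OF f] AE_I2) auto
next
  case False
  let ?r = "enn2real p"
  have r: "?r \<ge> 1" using p False by (metis enn2real_1 enn2real_mono infinity_ennreal_def less_top)
  show ?thesis
  proof (rule Lp_norm_le_scale[OF p False c_pos f op_measurable[OF f]])
    have "(\<integral>\<^sup>+x. ennreal (norm (op f x) powr ?r) \<partial>M) \<le>
      (\<integral>\<^sup>+x. ennreal (c powr (?r - 1)) * (\<integral>\<^sup>+y. ennreal (k x y) * ennreal (norm (f y) powr ?r) \<partial>M) \<partial>M)"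
      by (intro nn_integral_mono op_powr_le f r)
    also have "\<dots> = ennreal (c powr (?r - 1)) * (\<integral>\<^sup>+x. (\<integral>\<^sup>+y. ennreal (k x y) * ennreal (norm (f y) powr ?r) \<partial>M) \<partial>M)"
      by (rule nn_integral_cmult) (use f in measurable)
    also have "\<dots> \<le> ennreal (c powr (?r - 1)) * (ennreal c * (\<integral>\<^sup>+x. ennreal (norm (f x) powr ?r) \<partial>M))"
      by (intro mult_left_mono nn_integral_kernel_le) (use f in auto)
    also have "\<dots> = ennreal (c powr ?r) * (\<integral>\<^sup>+x. ennreal (norm (f x) powr ?r) \<partial>M)"
      using c_pos powr_add[of c 1 "?r - 1"] by (simp add: mult.assoc[symmetric] ennreal_mult''[symmetric] mult.commute)
    finally show "(\<integral>\<^sup>+x. ennreal (norm (op f x) powr ?r) \<partial>M) \<le> ennreal (c powr ?r) * (\<integral>\<^sup>+x. ennreal (norm (f x) powr ?r) \<partial>M)" .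
  qed
qed

lemma op_in_Lp:
  assumes "1 \<le> p" "f \<in> Lp p M"
  shows "op f \<in> Lp p M"
proof -
  have f: "f \<in> borel_measurable M" "Lp_norm p M f < \<infinity>" using assms by (auto simp: Lp_def)
  have "ennreal c * Lp_norm p M f < \<infinity>" using f by (simp add: ennreal_mult_less_top)
  then show ?thesis using Lp_norm_op_le[OF assms(1) f(1)] op_measurable[OF f(1)]
    by (auto simp: Lp_def intro: order.strict_trans1)
qed

lemma sq_norm_op_le:
  assumes f: "f \<in> borel_measurable M"
  shows "sq_norm M (op f) \<le> ennreal (c\<^sup>2) * sq_norm M f"
proof -
  have eq: "norm z powr 2 = (norm z)\<^sup>2" for z :: complex by simp
  have "sq_norm M (op f) \<le> (\<integral>\<^sup>+x. ennreal (c powr (2 - 1)) * (\<integral>\<^sup>+y. ennreal (k x y) * ennreal (norm (f y) powr 2) \<partial>M) \<partial>M)"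
    unfolding sq_norm_def eq[symmetric] by (intro nn_integral_mono op_powr_le f) auto
  also have "\<dots> = ennreal c * (\<integral>\<^sup>+x. (\<integral>\<^sup>+y. ennreal (k x y) * ennreal (norm (f y) powr 2) \<partial>M) \<partial>M)"
  proof -
    note [measurable] = f
    show ?thesis using c_pos by (subst nn_integral_cmult) auto
  qed
  also have "\<dots> \<le> ennreal c * (ennreal c * (\<integral>\<^sup>+x. ennreal (norm (f x) powr 2) \<partial>M))"
    by (intro mult_left_mono nn_integral_kernel_le) (use f in auto)
  finally show ?thesis using c_pos
    by (simp add: sq_norm_def eq mult.assoc[symmetric] ennreal_mult''[symmetric] power2_eq_square)
qed

text \<open>The integrable part converges absolutely almost everywhere by Tonelli, the bounded part
  everywhere by the mass bound. Hence the kernel integral makes sense on the whole sum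
  space.\<close>

lemma AE_kernel_integrable:
  assumes "f \<in> L1_plus_Linf M"
  shows "AE x in M. (\<integral>\<^sup>+y. ennreal (k x y) * ennreal (norm (f y)) \<partial>M) < \<infinity>"
proof -
  obtain g h where gh: "g \<in> Lp 1 M" "h \<in> Lp \<infinity> M" "AE x in M. f x = g x + h x"
    using assms by (auto simp: L1_plus_Linf_def)
  have [measurable]: "f \<in> borel_measurable M" "g \<in> borel_measurable M" "h \<in> borel_measurable M"
    using assms gh by (auto simp: L1_plus_Linf_def Lp_def)
  obtain C where C: "AE y in M. norm (h y) \<le> C" using gh(2) unfolding in_Linf_iff by blast
  have "(\<integral>\<^sup>+x. (\<integral>\<^sup>+y. ennreal (k x y) * ennreal (norm (g y)) \<partial>M) \<partial>M) < \<infinity>"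
    using nn_integral_kernel_le[of "\<lambda>y. ennreal (norm (g y))"] gh(1)
    by (auto simp: in_L1_iff ennreal_mult_less_top intro: order.strict_trans1)
  then have "AE x in M. (\<integral>\<^sup>+y. ennreal (k x y) * ennreal (norm (g y)) \<partial>M) \<noteq> \<infinity>"
    by (intro nn_integral_noteq_infinite) auto
  with AE_space show ?thesis
  proof eventually_elim
    case (elim x)
    note [measurable] = k_measurable1[OF elim(1)]
    have "(\<integral>\<^sup>+y. ennreal (k x y) * ennreal (norm (f y)) \<partial>M) \<le>
       (\<integral>\<^sup>+y. ennreal (k x y) * ennreal (norm (g y)) + ennreal (k x y) * ennreal C \<partial>M)"
    proof (intro nn_integral_mono_AE, use C gh(3) in eventually_elim)
      case (elim y)
      have "norm (f y) \<le> norm (g y) + C" using elim norm_triangle_ineq[of "g y" "h y"] by simp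
      moreover have "0 \<le> C" using elim norm_ge_zero[of "h y"] by linarith
      ultimately have "ennreal (norm (f y)) \<le> ennreal (norm (g y)) + ennreal C" 
        by (simp add: ennreal_plus[symmetric] ennreal_leI del: ennreal_plus)
      then show ?case by (metis distrib_left mult_left_mono zero_le)
    qed
    also have "\<dots> = (\<integral>\<^sup>+y. ennreal (k x y) * ennreal (norm (g y)) \<partial>M) + (\<integral>\<^sup>+y. ennreal (k x y) \<partial>M) * ennreal C"
      by (subst nn_integral_add) (auto simp: nn_integral_multc)
    also have "\<dots> < \<infinity>" using elim(2) order.strict_trans1[OF mass_le[OF elim(1)], of \<infinity>]
      by (auto simp: less_top[symmetric] ennreal_mult_eq_top_iff)
    finally show ?case .
  qed
qed

lemma integrable_kernel:
  fixes f :: "'a \<Rightarrow> complex"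
  assumes f: "f \<in> borel_measurable M" and x: "x \<in> space M"
    and fin: "(\<integral>\<^sup>+y. ennreal (k x y) * ennreal (norm (f y)) \<partial>M) < \<infinity>"
  shows "integrable M (\<lambda>y. k x y *\<^sub>R f y)"
proof -
  have eq: "(\<integral>\<^sup>+y. ennreal (norm (k x y *\<^sub>R f y)) \<partial>M) = (\<integral>\<^sup>+y. ennreal (k x y) * ennreal (norm (f y)) \<partial>M)"
    by (intro nn_integral_cong) (use k_nonneg[OF x] in \<open>auto simp: ennreal_mult'\<close>)
  show ?thesis
    by (rule integrableI_bounded, use f k_measurable1[OF x] in measurable) (unfold eq, rule fin)
qed

lemma op_linear_AE:
  assumes "f \<in> L1_plus_Linf M" "g \<in> L1_plus_Linf M"
  shows "AE x in M. op (\<lambda>y. a * f y + b * g y) x = a * op f x + b * op g x"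
  using AE_space AE_kernel_integrable[OF assms(1)] AE_kernel_integrable[OF assms(2)]
proof eventually_elim
  case (elim x)
  have i: "integrable M (\<lambda>y. k x y *\<^sub>R f y)" "integrable M (\<lambda>y. k x y *\<^sub>R g y)"
    using elim assms by (auto intro!: integrable_kernel L1_plus_Linf_measurable)
  have eq: "(\<lambda>y. k x y *\<^sub>R (a * f y + b * g y)) = (\<lambda>y. a * (k x y *\<^sub>R f y) + b * (k x y *\<^sub>R g y))"
    by (auto simp: scaleR_conv_of_real algebra_simps)
  show ?case unfolding op_def eq using i by (simp del: scaleR_add_right mult_scaleR_right add: integral_mult_right)
qed

lemma op_nonneg:
  assumes f: "f \<in> borel_measurable M" "AE x in M. 0 \<le> f x" and x: "x \<in> space M"
  shows "0 \<le> op f x"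
proof -
  note [measurable] = f(1) k_measurable1[OF x]
  have "op f x = (LINT y|M. complex_of_real (k x y * Re (f y)))"
    unfolding op_def
  proof (rule integral_cong_AE)
    show "AE y in M. k x y *\<^sub>R f y = complex_of_real (k x y * Re (f y))"
      using f(2) by eventually_elim (auto simp: less_eq_complex_def complex_eq_iff)
  qed measurable
  also have "\<dots> = complex_of_real (LINT y|M. k x y * Re (f y))" by (rule integral_complex_of_real)
  finally have "op f x = complex_of_real (LINT y|M. k x y * Re (f y))" .
  moreover have "0 \<le> (LINT y|M. k x y * Re (f y))"
    by (rule integral_nonneg_AE, use f(2) AE_space in eventually_elim)
       (use k_nonneg[OF x] in \<open>auto simp: less_eq_complex_def\<close>)
  ultimately show ?thesis by (simp add: less_eq_complex_def)
qed

text \<open>Fubini and the symmetry of \<open>k\<close>. Absolute convergence follows from |f(y)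
  g(x)| \<le> |f(y)|^2 + |g(x)|^2, where the mass bound is used in each variable once.\<close>

lemma op_selfadjoint:
  assumes f: "f \<in> Lp 2 M" and g: "g \<in> Lp 2 M"
  shows "(LINT x|M. op f x * cnj (g x)) = (LINT x|M. f x * cnj (op g x))"
proof -
  have [measurable]: "f \<in> borel_measurable M" "g \<in> borel_measurable M" using f g by (auto simp: in_L2_iff)
  interpret P: pair_sigma_finite M M by (rule pair_sigma_finite_self)
  let ?F = "\<lambda>x y. k x y *\<^sub>R (f y * cnj (g x))"
  have fin: "(\<integral>\<^sup>+x. (\<integral>\<^sup>+y. ennreal (norm (?F x y)) \<partial>M) \<partial>M) < \<infinity>"
  proof -
    let ?f = "\<lambda>y. ennreal ((norm (f y))\<^sup>2)" and ?g = "\<lambda>y. ennreal ((norm (g y))\<^sup>2)"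
    have "(\<integral>\<^sup>+x. (\<integral>\<^sup>+y. ennreal (norm (?F x y)) \<partial>M) \<partial>M) \<le> (\<integral>\<^sup>+x. (\<integral>\<^sup>+y. ennreal (k x y) * ?f y + ennreal (k x y) * ?g x \<partial>M) \<partial>M)"
    proof (intro nn_integral_mono)
      fix x y assume xy: "x \<in> space M" "y \<in> space M"
      have "norm (f y) * norm (g x) \<le> (norm (f y))\<^sup>2 + (norm (g x))\<^sup>2"
        using norm_mult_le_squares[of "f y" "g x"] by (simp add: norm_mult)
      then have "k x y * (norm (f y) * norm (g x)) \<le> k x y * ((norm (f y))\<^sup>2 + (norm (g x))\<^sup>2)"
        using k_nonneg[OF xy] by (intro mult_left_mono)
      from ennreal_leI[OF this]
      show "ennreal (norm (?F x y)) \<le> ennreal (k x y) * ?f y + ennreal (k x y) * ?g x"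
        using k_nonneg[OF xy] by (simp add: norm_mult ennreal_mult''[symmetric] ennreal_plus[symmetric] distrib_left del: ennreal_plus)
    qed
    also have "\<dots> = (\<integral>\<^sup>+x. (\<integral>\<^sup>+y. ennreal (k x y) * ?f y \<partial>M) + (\<integral>\<^sup>+y. ennreal (k x y) \<partial>M) * ?g x \<partial>M)"
    proof (intro nn_integral_cong)
      fix x assume "x \<in> space M"
      note [measurable] = k_measurable1[OF this]
      show "(\<integral>\<^sup>+y. ennreal (k x y) * ?f y + ennreal (k x y) * ?g x \<partial>M) = (\<integral>\<^sup>+y. ennreal (k x y) * ?f y \<partial>M) + (\<integral>\<^sup>+y. ennreal (k x y) \<partial>M) * ?g x"
        by (subst nn_integral_add) (auto simp: nn_integral_multc)
    qed
    also have "\<dots> \<le> (\<integral>\<^sup>+x. (\<integral>\<^sup>+y. ennreal (k x y) * ?f y \<partial>M) + ennreal c * ?g x \<partial>M)"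
      by (intro nn_integral_mono add_left_mono mult_right_mono mass_le) auto
    also have "\<dots> = (\<integral>\<^sup>+x. (\<integral>\<^sup>+y. ennreal (k x y) * ?f y \<partial>M) \<partial>M) + ennreal c * (\<integral>\<^sup>+x. ?g x \<partial>M)"
      by (subst nn_integral_add) (auto simp: nn_integral_cmult)
    also have "\<dots> \<le> ennreal c * (\<integral>\<^sup>+x. ?f x \<partial>M) + ennreal c * (\<integral>\<^sup>+x. ?g x \<partial>M)"
      by (intro add_right_mono nn_integral_kernel_le) measurable
    also have "\<dots> < \<infinity>" using f g by (auto simp: in_L2_iff sq_norm_def ennreal_mult_less_top)
    finally show ?thesis .
  qed
  have "(LINT x|M. op f x * cnj (g x)) = (LINT x|M. LINT y|M. ?F x y)"
    unfolding op_def by (simp add: integral_mult_left_zero[symmetric] del: integral_mult_left_zero)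
  also have "\<dots> = (LINT y|M. LINT x|M. ?F x y)"
    by (rule complex_Fubini(1)[OF sigma_finite_measure_axioms _ fin]) measurable
  also have "\<dots> = (LINT y|M. f y * cnj (op g y))"
  proof (intro Bochner_Integration.integral_cong refl)
    fix y
    have "f y * cnj (op g y) = f y * (LINT x|M. cnj (k y x *\<^sub>R g x))" unfolding op_def by (simp only: Bochner_Integration.integral_cnj)
    also have "\<dots> = (LINT x|M. ?F x y)"
      unfolding integral_mult_right_zero[symmetric]
      by (intro Bochner_Integration.integral_cong refl) (simp add: k_sym[of y] scaleR_conv_of_real)
    finally show "(LINT x|M. ?F x y) = f y * cnj (op g y)" ..
  qed
  finally show ?thesis .
qed

end

section \<open>Composition of kernel operators\<close>

lemma schur_kernel_compose:
  assumes 1: "schur_kernel M k1 c1" and 2: "schur_kernel M k2 c2" and 3: "schur_kernel M k3 c3"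
    and comp: "\<And>x y. x \<in> space M \<Longrightarrow> y \<in> space M \<Longrightarrow> has_bochner_integral M (\<lambda>z. k1 x z * k2 z y) (k3 x y)"
    and f: "f \<in> L1_plus_Linf M"
  shows "AE x in M. schur_kernel.op M k1 (schur_kernel.op M k2 f) x = schur_kernel.op M k3 f x"
proof -
  interpret K1: schur_kernel M k1 c1 by fact
  interpret K2: schur_kernel M k2 c2 by fact
  interpret K3: schur_kernel M k3 c3 by fact
  interpret P: pair_sigma_finite M M by (rule K1.pair_sigma_finite_self)
  have [measurable]: "f \<in> borel_measurable M" using f by (rule L1_plus_Linf_measurable)
  have nn: "(\<integral>\<^sup>+z. ennreal (k1 x z * k2 z y) \<partial>M) = ennreal (k3 x y)" if xy: "x \<in> space M" "y \<in> space M" for x y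
    using comp[OF xy] nn_integral_eq_integral[of M "\<lambda>z. k1 x z * k2 z y"] K1.k_nonneg K2.k_nonneg xy
    by (auto simp: has_bochner_integral_iff)
  from AE_space K3.AE_kernel_integrable[OF f] show ?thesis
  proof eventually_elim
    case (elim x)
    note [measurable] = K1.k_measurable1[OF elim(1)] K3.k_measurable1[OF elim(1)]
    let ?F = "\<lambda>z y. (k1 x z * k2 z y) *\<^sub>R f y"
    \<comment> \<open>All kernels are nonnegative, so integrating out \<open>z\<close> reproduces
      \<open>k3\<close>. The hypothesis of Fubini's theorem is therefore the absolute convergence of
      the third kernel integral at \<open>x\<close>, known almost everywhere.\<close>
    have "(\<integral>\<^sup>+z. (\<integral>\<^sup>+y. ennreal (norm (?F z y)) \<partial>M) \<partial>M) = (\<integral>\<^sup>+y. (\<integral>\<^sup>+z. ennreal (norm (?F z y)) \<partial>M) \<partial>M)"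
      by (rule P.Fubini'[symmetric]) measurable
    also have "\<dots> = (\<integral>\<^sup>+y. ennreal (k3 x y) * ennreal (norm (f y)) \<partial>M)"
    proof (intro nn_integral_cong)
      fix y assume y: "y \<in> space M"
      have [measurable]: "(\<lambda>z. k2 z y) \<in> borel_measurable M"
        using K2.k_measurable1[OF y] unfolding K2.k_sym[of y] .
      have "(\<integral>\<^sup>+z. ennreal (norm (?F z y)) \<partial>M) = (\<integral>\<^sup>+z. ennreal (k1 x z * k2 z y) * ennreal (norm (f y)) \<partial>M)"
        by (intro nn_integral_cong) (use K1.k_nonneg K2.k_nonneg elim(1) y in \<open>auto simp: ennreal_mult''[symmetric] abs_mult\<close>)
      also have "\<dots> = ennreal (k3 x y) * ennreal (norm (f y))"
        unfolding nn[OF elim(1) y, symmetric] by (rule nn_integral_multc) measurable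
      finally show "(\<integral>\<^sup>+z. ennreal (norm (?F z y)) \<partial>M) = ennreal (k3 x y) * ennreal (norm (f y))" .
    qed
    finally have fin: "(\<integral>\<^sup>+z. (\<integral>\<^sup>+y. ennreal (norm (?F z y)) \<partial>M) \<partial>M) < \<infinity>" using elim(2) by simp
    have "K1.op (K2.op f) x = (LINT z|M. LINT y|M. ?F z y)"
      unfolding K1.op_def K2.op_def by (simp add: integral_scaleR_right[symmetric] del: integral_scaleR_right)
    also have "\<dots> = (LINT y|M. LINT z|M. ?F z y)"
      by (rule complex_Fubini(1)[OF K1.sigma_finite_measure_axioms _ fin]) measurable
    also have "\<dots> = K3.op f x"
      unfolding K3.op_def
    proof (intro Bochner_Integration.integral_cong refl)
      fix y assume y: "y \<in> space M"
      have "(LINT z|M. ?F z y) = (LINT z|M. k1 x z * k2 z y) *\<^sub>R f y"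
        by (rule integral_scaleR_left) (use comp[OF elim(1) y] in \<open>simp add: has_bochner_integral_iff\<close>)
      then show "(LINT z|M. ?F z y) = k3 x y *\<^sub>R f y"
        using comp[OF elim(1) y] by (simp add: has_bochner_integral_iff)
    qed
    finally show ?case .
  qed
qed

section \<open>Gaussian moments on the half-line\<close>

lemma halfline_simps [simp]: "space halfline = {0<..}" "sets halfline = sets (restrict_space borel {0<..})"
  by (auto simp: space_restrict_space sets_restrict_space)

lemma halfline_borel: "f \<in> borel_measurable borel \<Longrightarrow> f \<in> borel_measurable halfline"
  by (simp add: measurable_restrict_space1)

lemma power_even_eq_powr: "z ^ (2 * n) = z powr (2 * real n)" if "z > 0" for z :: real
  using powr_realpow[OF that, of "2 * n"] by simp

lemma Gamma_real_neq_0: "Gamma x \<noteq> 0" if "x > 0" for x :: real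
  using Gamma_real_pos[OF that] by simp

lemma Gamma_plus1_pos: "Gamma (x + 1) = x * Gamma x" if "x > 0" for x :: real
proof -
  have "x \<notin> \<int>\<^sub>\<le>\<^sub>0" using that by (auto dest!: nonpos_Ints_nonpos)
  then show ?thesis by (rule Gamma_plus1)
qed

text \<open>The substitution p z^2 in Euler's integral for the Gamma function. All later integrals
  of Bessel functions are series of these moments.\<close>

lemma gaussian_moment:
  fixes p s :: real
  assumes p: "p > 0" and s: "s > 0"
  shows "has_bochner_integral halfline (\<lambda>z. z powr (2 * s - 1) * exp (- p * z\<^sup>2)) (Gamma s / (2 * p powr s))"
proof -
  let ?f = "\<lambda>t. t powr (s - 1) / exp t"
  let ?g = "\<lambda>z::real. p * z\<^sup>2" and ?g' = "\<lambda>z::real. 2 * p * z"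
  have im: "?g ` {0<..} = {0<..}"
  proof (intro equalityI subsetI)
    fix y :: real assume "y \<in> {0<..}"
    then have "y = ?g (sqrt (y / p))" "sqrt (y / p) > 0" using p by auto
    then show "y \<in> ?g ` {0<..}" by blast
  qed (use p in auto)
  have inj: "inj_on ?g {0<..}" using p by (auto simp: inj_on_def)
  have der: "(?g has_field_derivative ?g' z) (at z within {0<..})" for z
    by (auto intro!: derivative_eq_intros)
  have G: "?f absolutely_integrable_on {0<..}" "integral {0<..} ?f = Gamma s"
  proof -
    have "(?f has_integral Gamma s) {0..}" using Gamma_integral_real[OF s] .
    then have i: "(?f has_integral Gamma s) {0<..}"
      by (rule has_integral_spike_set_eq[THEN iffD1, rotated 2])
         (rule negligible_subset[of "{0}"]; force)+
    then show "integral {0<..} ?f = Gamma s" by auto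
    show "?f absolutely_integrable_on {0<..}"
      using i by (intro nonnegative_absolutely_integrable_1) (auto simp: has_integral_integrable)
  qed
  have ai: "(\<lambda>z. \<bar>?g' z\<bar> *\<^sub>R ?f (?g z)) absolutely_integrable_on {0<..} \<and>
      integral {0<..} (\<lambda>z. \<bar>?g' z\<bar> *\<^sub>R ?f (?g z)) = Gamma s"
    using has_absolute_integral_change_of_variables_1'[OF _ der inj, of ?f "Gamma s"] G unfolding im by simp
  have eq: "\<bar>?g' z\<bar> *\<^sub>R ?f (?g z) = (2 * p powr s) * (z powr (2 * s - 1) * exp (- p * z\<^sup>2))" if "z > 0" for z
  proof -
    have "z\<^sup>2 powr (s - 1) = z powr (2 * s - 2)"
      using that by (simp add: powr_powr powr_numeral[symmetric] algebra_simps del: powr_numeral)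
    moreover have "z powr (2 * s - 1) = z * z powr (2 * s - 2)"
      using that powr_add[of z 1 "2 * s - 2"] by simp
    moreover have "p powr s = p * p powr (s - 1)"
      using p powr_add[of p 1 "s - 1"] by simp
    ultimately show ?thesis using p that
      by (simp add: powr_mult exp_minus field_simps)
  qed
  have "(\<lambda>z. (2 * p powr s) * (z powr (2 * s - 1) * exp (- p * z\<^sup>2))) absolutely_integrable_on {0<..} \<and>
      integral {0<..} (\<lambda>z. (2 * p powr s) * (z powr (2 * s - 1) * exp (- p * z\<^sup>2))) = Gamma s"
    (is "?A \<and> ?B = _")
  proof -
    have "?A \<longleftrightarrow> (\<lambda>z. \<bar>?g' z\<bar> *\<^sub>R ?f (?g z)) absolutely_integrable_on {0<..}"
      by (intro set_integrable_cong refl eq[symmetric]) auto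
    moreover have "?B = integral {0<..} (\<lambda>z. \<bar>?g' z\<bar> *\<^sub>R ?f (?g z))"
      by (intro Henstock_Kurzweil_Integration.integral_cong eq[symmetric]) auto
    ultimately show ?thesis using ai by metis
  qed
  then have *: "(\<lambda>z. z powr (2 * s - 1) * exp (- p * z\<^sup>2)) absolutely_integrable_on {0<..}"
    and i2: "(2 * p powr s) * integral {0<..} (\<lambda>z. z powr (2 * s - 1) * exp (- p * z\<^sup>2)) = Gamma s"
    using p by simp_all
  \<comment> \<open>The substitution theorem speaks of Lebesgue measure; Borel measurability of the
    integrand brings the result back to \<open>lborel\<close> restricted to the half-line.\<close>
  have m: "(\<lambda>z::real. z powr (2 * s - 1) * exp (- p * z\<^sup>2)) \<in> borel_measurable borel" by measurable
  have I: "integrable halfline (\<lambda>z. z powr (2 * s - 1) * exp (- p * z\<^sup>2))"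
    using * m by (subst integrable_restrict_space)
      (auto simp: set_integrable_def integrable_completion)
  have "(LINT z|halfline. z powr (2 * s - 1) * exp (- p * z\<^sup>2)) = integral {0<..} (\<lambda>z. z powr (2 * s - 1) * exp (- p * z\<^sup>2))"
    using set_lebesgue_integral_eq_integral(2)[OF *] m
    by (subst integral_restrict_space) (auto simp: set_lebesgue_integral_def integral_completion)
  also have "\<dots> = Gamma s / (2 * p powr s)" using i2 p by (auto simp: field_simps)
  finally show ?thesis using I by (auto simp: has_bochner_integral_iff)
qed

section \<open>The entire part of the Bessel functions\<close>

text \<open>Up to the factor 1 / Gamma(a + 1) this is the hypergeometric function 0F1 with parameter
  a + 1. In the variable w = z^2 / 4 the non-integral power is split off, positive \<open>w\<close>
  gives I and negative \<open>w\<close> gives J.\<close>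

definition bessel_entire :: "real \<Rightarrow> real \<Rightarrow> real" where
  "bessel_entire a w = (\<Sum>n. w ^ n / (fact n * Gamma (a + real n + 1)))"

text \<open>From the second value on, each step multiplies by a factor of at least 1, so the smaller
  of the first two values is a lower bound. The exponential series is then a majorant of
  \<open>bessel_entire\<close>.\<close>

lemma Gamma_lower_bound:
  assumes "a > - 1"
  obtains c :: real where "c > 0" "\<And>n::nat. c \<le> Gamma (a + real n + 1)"
proof -
  define c where "c = min (Gamma (a + 1)) (Gamma (a + 2))"
  have 1: "c \<le> Gamma (a + real (Suc n) + 1)" for n
  proof (induction n)
    case (Suc n)
    have "Gamma (a + real (Suc (Suc n)) + 1) = (a + real (Suc n) + 1) * Gamma (a + real (Suc n) + 1)"
    proof -
      have "a + real (Suc n) + 1 \<notin> \<int>\<^sub>\<le>\<^sub>0" using assms by (auto dest!: nonpos_Ints_nonpos)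
      from Gamma_plus1[OF this] show ?thesis by (simp add: add_ac)
    qed
    also have "\<dots> \<ge> 1 * Gamma (a + real (Suc n) + 1)"
      by (intro mult_right_mono) (use assms Gamma_real_pos[of "a + real (Suc n) + 1"] in auto)
    finally show ?case using Suc by simp
  qed (simp add: c_def add.commute add.left_commute)
  have "c > 0" using assms by (auto simp: c_def Gamma_real_pos)
  moreover have "c \<le> Gamma (a + real n + 1)" for n
    using 1 by (cases n) (auto simp: c_def)
  ultimately show ?thesis using that by blast
qed

lemma Gamma_shift_pos: "a > - 1 \<Longrightarrow> Gamma (a + real n + 1) > 0"
  by (intro Gamma_real_pos) auto

lemma summable_bessel_entire_abs:
  assumes "a > - 1"
  shows "summable (\<lambda>n. \<bar>w\<bar> ^ n / (fact n * Gamma (a + real n + 1)))"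
proof -
  obtain c where c: "c > 0" "\<And>n::nat. c \<le> Gamma (a + real n + 1)"
    using Gamma_lower_bound[OF assms] by blast
  have s: "summable (\<lambda>n. \<bar>w\<bar> ^ n /\<^sub>R fact n * inverse c)"
    by (intro summable_mult2 summable_exp_generic)
  show ?thesis
  proof (rule summable_comparison_test'[OF s, of 0])
    fix n :: nat
    have "\<bar>w\<bar> ^ n / (fact n * Gamma (a + real n + 1)) \<le> \<bar>w\<bar> ^ n / (fact n * c)"
      using c Gamma_shift_pos[OF assms, of n] by (intro divide_left_mono mult_left_mono mult_pos_pos) auto
    then show "norm (\<bar>w\<bar> ^ n / (fact n * Gamma (a + real n + 1))) \<le> \<bar>w\<bar> ^ n /\<^sub>R fact n * inverse c"
      using c Gamma_shift_pos[OF assms, of n] by (simp add: abs_mult field_simps)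
  qed
qed

lemma abs_bessel_entire_term:
  assumes "a > - 1"
  shows "\<bar>w ^ n / (fact n * Gamma (a + real n + 1))\<bar> = \<bar>w\<bar> ^ n / (fact n * Gamma (a + real n + 1))"
  using Gamma_shift_pos[OF assms, of n] by (simp add: abs_mult power_abs)

lemma summable_bessel_entire:
  assumes "a > - 1"
  shows "summable (\<lambda>n. w ^ n / (fact n * Gamma (a + real n + 1)))"
  by (rule summable_rabs_cancel) (use summable_bessel_entire_abs[OF assms] abs_bessel_entire_term[OF assms] in simp)

lemma abs_bessel_entire_le:
  assumes "a > - 1"
  shows "\<bar>bessel_entire a w\<bar> \<le> bessel_entire a \<bar>w\<bar>"
  using summable_rabs[of "\<lambda>n. w ^ n / (fact n * Gamma (a + real n + 1))"]
    summable_bessel_entire_abs[OF assms, of w]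
  unfolding bessel_entire_def abs_bessel_entire_term[OF assms] by simp

lemma bessel_entire_pos:
  assumes "a > - 1" "w \<ge> 0"
  shows "bessel_entire a w > 0"
proof -
  have "0 < w ^ 0 / (fact 0 * Gamma (a + real 0 + 1))" using Gamma_shift_pos[OF assms(1), of 0] by simp
  also have "\<dots> \<le> (\<Sum>n. w ^ n / (fact n * Gamma (a + real n + 1)))"
    using sum_le_suminf[OF summable_bessel_entire[OF assms(1), of w], of "{0}"] assms Gamma_shift_pos[OF assms(1)]
    by (auto intro: less_imp_le)
  finally show ?thesis by (simp add: bessel_entire_def)
qed

lemma bessel_entire_mono:
  assumes "a > - 1" "0 \<le> v" "v \<le> w"
  shows "bessel_entire a v \<le> bessel_entire a w"
  unfolding bessel_entire_def
  by (intro suminf_le summable_bessel_entire assms divide_right_mono power_mono)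
     (use Gamma_shift_pos[OF assms(1)] in \<open>auto intro: less_imp_le\<close>)

lemma bessel_entire_measurable [measurable]: "bessel_entire a \<in> borel_measurable borel"
  unfolding bessel_entire_def[abs_def] by measurable

section \<open>Laguerre polynomials and Weber's integral\<close>

lemma Gamma_ratio_Vandermonde:
  fixes a :: real
  assumes a: "a > - 1"
  shows "Gamma (a + real m + real n + 1) / (fact n * Gamma (a + real n + 1)) =
    (\<Sum>k\<le>n. (real (m choose k) * Gamma (a + real m + 1) / Gamma (a + real k + 1)) * (1 / fact (n - k)))"
proof -
  have gb: "(b gchoose j) = Gamma (b + 1) / (fact j * Gamma (b - real j + 1))" if "b > - 1" for b :: real and j
    using that by (intro gbinomial_Gamma) (auto dest!: nonpos_Ints_nonpos)
  \<comment> \<open>The Chu-Vandermonde identity with the upper argument split into n and a + m.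
    Multiplying it by m! / n! exchanges the roles of \<open>m\<close> and \<open>n\<close> and
    produces the coefficients of a Cauchy product.\<close>
  have "(a + real m + real n) gchoose m = (\<Sum>k\<le>m. real (n choose k) * ((a + real m) gchoose (m - k)))"
    using gbinomial_Vandermonde[of "real n" "a + real m" m]
    by (simp add: add_ac binomial_gbinomial atMost_atLeast0)
  then have "Gamma (a + real m + real n + 1) / (fact m * Gamma (a + real n + 1)) =
     (\<Sum>k\<le>m. real (n choose k) * (Gamma (a + real m + 1) / (fact (m - k) * Gamma (a + real k + 1))))"
    using a by (subst (asm) gb) (auto simp: gb of_nat_diff algebra_simps intro!: sum.cong)
  then have "Gamma (a + real m + real n + 1) / (fact n * Gamma (a + real n + 1)) = (fact m / fact n) *
     (\<Sum>k\<le>m. real (n choose k) * (Gamma (a + real m + 1) / (fact (m - k) * Gamma (a + real k + 1))))"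
    (is "_ = _ * ?S") by (simp only: divide_divide_eq_left[symmetric]) (simp add: divide_simps)
  also have "\<dots> = (\<Sum>k\<le>m. fact m / fact n * (real (n choose k) * (Gamma (a + real m + 1) / (fact (m - k) * Gamma (a + real k + 1)))))"
    by (simp add: sum_distrib_left)
  \<comment> \<open>Terms with k > n vanish on this side through n choose k, terms with k > m on the
    other side through m choose k; the common range links both sums.\<close>
  also have "\<dots> = (\<Sum>k\<le>min m n. fact m / fact n * (real (n choose k) * (Gamma (a + real m + 1) / (fact (m - k) * Gamma (a + real k + 1)))))"
    by (intro sum.mono_neutral_right) auto
  also have "\<dots> = (\<Sum>k\<le>min m n. (real (m choose k) * Gamma (a + real m + 1) / Gamma (a + real k + 1)) * (1 / fact (n - k)))"
    by (intro sum.cong refl) (auto simp: binomial_fact field_simps)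
  also have "\<dots> = (\<Sum>k\<le>n. (real (m choose k) * Gamma (a + real m + 1) / Gamma (a + real k + 1)) * (1 / fact (n - k)))"
    by (intro sum.mono_neutral_left) auto
  finally show ?thesis .
qed

text \<open>This is \<open>fact m\<close> times the Laguerre polynomial of degree \<open>m\<close> and parameter \<open>a\<close> at \<open>- B\<close>.\<close>

definition bessel_poly :: "real \<Rightarrow> nat \<Rightarrow> real \<Rightarrow> real" where
  "bessel_poly a m B = (\<Sum>k\<le>m. real (m choose k) * Gamma (a + real m + 1) / Gamma (a + real k + 1) * B ^ k)"

lemma summable_exp_abs: "summable (\<lambda>n. norm (B ^ n / fact n :: real))"
  using summable_norm_exp[of B] by (simp add: divide_inverse mult.commute)

lemma exp_suminf: "(\<Sum>n. B ^ n / fact n) = exp (B::real)"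
  by (simp add: exp_def divide_inverse mult.commute)

text \<open>In effect Kummer's transformation: the confluent hypergeometric series with parameters a
  + m + 1 and a + 1 is an exponential times a polynomial. The Vandermonde identity displays its
  coefficients as a Cauchy product.\<close>

lemma bessel_moment_series:
  assumes a: "a > - 1"
  shows "(\<lambda>n. B ^ n * (Gamma (a + real m + real n + 1) / (fact n * Gamma (a + real n + 1)))) sums
    (bessel_poly a m B * exp B)"
proof -
  let ?a = "\<lambda>k. real (m choose k) * Gamma (a + real m + 1) / Gamma (a + real k + 1) * B ^ k"
  have fin: "?a k = 0" if "k \<notin> {..m}" for k using that by simp
  have sa: "summable (\<lambda>k. norm (?a k))"
    by (rule summable_finite[of "{..m}"]) (use fin in auto)
  have "(\<Sum>k. ?a k) = bessel_poly a m B"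
    unfolding bessel_poly_def by (rule suminf_finite) auto
  moreover have "(\<lambda>n. \<Sum>k\<le>n. ?a k * (B ^ (n - k) / fact (n - k))) sums ((\<Sum>k. ?a k) * (\<Sum>k. B ^ k / fact k))"
    by (rule Cauchy_product_sums[OF sa summable_exp_abs])
  moreover have "(\<Sum>k\<le>n. ?a k * (B ^ (n - k) / fact (n - k))) =
      B ^ n * (Gamma (a + real m + real n + 1) / (fact n * Gamma (a + real n + 1)))" for n
  proof -
    have "?a k * (B ^ (n - k) / fact (n - k)) = B ^ n * (real (m choose k) * Gamma (a + real m + 1) / Gamma (a + real k + 1) * (1 / fact (n - k)))"
      if "k \<in> {..n}" for k
      using that power_add[of B k "n - k"] by (simp add: field_simps)
    then show ?thesis
      unfolding Gamma_ratio_Vandermonde[OF a] sum_distrib_left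
      by (intro sum.cong refl) blast
  qed
  ultimately show ?thesis by (simp add: exp_suminf)
qed

text \<open>The series of \<open>bessel_entire\<close> is integrated term by term against Gaussian
  moments. The integrals of the absolute values form the same series at \<bar>v\<bar>, which
  converges; so the sign of \<open>v\<close> is arbitrary.\<close>

lemma bessel_moment:
  assumes a: "a > - 1" and p: "p > 0"
  shows "has_bochner_integral halfline
    (\<lambda>z. z powr (2 * a + 1) * z ^ (2 * m) * exp (- p * z\<^sup>2) * bessel_entire a (v * z\<^sup>2))
    (bessel_poly a m (v / p) * exp (v / p) / (2 * p powr (a + real m + 1)))"
proof -
  let ?G = "\<lambda>n. fact n * Gamma (a + real n + 1)"
  let ?h = "\<lambda>n z::real. z powr (2 * (a + real m + real n + 1) - 1) * exp (- p * z\<^sup>2)"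
  let ?f = "\<lambda>n z. v ^ n / ?G n * ?h n z"
  have b: "has_bochner_integral halfline (?h n) (Gamma (a + real m + real n + 1) / (2 * p powr (a + real m + real n + 1)))" for n
    by (rule gaussian_moment) (use a p in auto)
  have iv: "u ^ n / ?G n * (Gamma (a + real m + real n + 1) / (2 * p powr (a + real m + real n + 1)))
     = (u / p) ^ n * (Gamma (a + real m + real n + 1) / ?G n) * (1 / (2 * p powr (a + real m + 1)))" for n u
  proof -
    have "p powr (a + real m + real n + 1) = p powr (a + real m + 1) * p ^ n"
      using p by (simp add: powr_add powr_realpow)
    then show ?thesis using p by (simp add: power_divide field_simps)
  qed
  have eq: "z powr (2 * a + 1) * z ^ (2 * m) * exp (- p * z\<^sup>2) * ((u * z\<^sup>2) ^ n / ?G n) = u ^ n / ?G n * ?h n z" if "z > 0" for n z u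
  proof -
    have "2 * (a + real m + real n + 1) - 1 = (2 * a + 1) + 2 * real m + 2 * real n" by simp
    then have "z powr (2 * (a + real m + real n + 1) - 1) = z powr (2 * a + 1) * z ^ (2 * m) * z ^ (2 * n)"
      using that by (simp only: powr_add power_even_eq_powr)
    then show ?thesis by (simp add: power_mult_distrib power_mult[symmetric])
  qed
  have fi: "integrable halfline (?f n)" for n
    using b[of n] by (auto simp: has_bochner_integral_iff)
  have nf: "norm (?f n z) = \<bar>v\<bar> ^ n / ?G n * ?h n z" for n z
    using Gamma_shift_pos[OF a, of n] by (simp add: abs_mult power_abs)
  have s1: "AE z in halfline. summable (\<lambda>n. norm (?f n z))"
  proof (rule AE_I2)
    fix z assume "z \<in> space halfline"
    then have z: "z > 0" by simp
    show "summable (\<lambda>n. norm (?f n z))"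
      unfolding nf unfolding eq[OF z, symmetric]
      using summable_bessel_entire_abs[OF a, of "\<bar>v\<bar> * z\<^sup>2"]
      by (intro summable_mult) (simp only: abs_mult abs_abs abs_power2)
  qed
  have s2: "summable (\<lambda>n. LINT z|halfline. norm (?f n z))"
  proof -
    have "(LINT z|halfline. norm (?f n z)) = (\<bar>v\<bar> / p) ^ n * (Gamma (a + real m + real n + 1) / ?G n) * (1 / (2 * p powr (a + real m + 1)))" for n
      unfolding nf using b[of n] by (simp only: iv[symmetric] integral_mult_right_zero has_bochner_integral_integral_eq)
    then show ?thesis
      using bessel_moment_series[OF a, of "\<bar>v\<bar> / p" m] by (simp only:) (intro summable_mult2, simp add: sums_iff)
  qed
  have sm: "(\<Sum>n. ?f n z) = z powr (2 * a + 1) * z ^ (2 * m) * exp (- p * z\<^sup>2) * bessel_entire a (v * z\<^sup>2)" if "z > 0" for z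
    unfolding bessel_entire_def eq[OF that, symmetric]
    by (rule suminf_mult) (rule summable_bessel_entire[OF a])
  have "(\<lambda>n. integral\<^sup>L halfline (?f n)) sums (LINT z|halfline. (\<Sum>n. ?f n z))"
    by (rule sums_integral[OF fi s1 s2])
  moreover have "(\<lambda>n. integral\<^sup>L halfline (?f n)) sums (bessel_poly a m (v / p) * exp (v / p) * (1 / (2 * p powr (a + real m + 1))))"
  proof -
    have "integral\<^sup>L halfline (?f n) = (v / p) ^ n * (Gamma (a + real m + real n + 1) / ?G n) * (1 / (2 * p powr (a + real m + 1)))" for n
      using b[of n] by (simp only: iv[symmetric] integral_mult_right_zero has_bochner_integral_integral_eq)
    then show ?thesis by (simp only:) (intro sums_mult2 bessel_moment_series[OF a])
  qed
  ultimately have i: "(LINT z|halfline. (\<Sum>n. ?f n z)) = bessel_poly a m (v / p) * exp (v / p) / (2 * p powr (a + real m + 1))"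
    by (simp add: sums_iff)
  have "has_bochner_integral halfline (\<lambda>z. (\<Sum>n. ?f n z)) (bessel_poly a m (v / p) * exp (v / p) / (2 * p powr (a + real m + 1)))"
    using integrable_suminf[OF fi s1 s2] i by (simp add: has_bochner_integral_iff)
  then show ?thesis
    by (rule has_bochner_integral_cong[THEN iffD1, rotated 3]) (use sm in auto)
qed

lemma has_bochner_integral_halfline_cong:
  assumes "has_bochner_integral halfline f I" "\<And>z. z > 0 \<Longrightarrow> f z = g z"
  shows "has_bochner_integral halfline g I"
  using assms by (subst has_bochner_integral_cong[of halfline halfline g f I I]) auto

text \<open>The generating function of the Laguerre polynomials with weights A^m / Gamma(a + m + 1),
  again a Cauchy product. It resums the series that arises in Weber's integral.\<close>

lemma bessel_poly_series:
  assumes a: "a > - 1"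
  shows "(\<lambda>m. A ^ m / (fact m * Gamma (a + real m + 1)) * bessel_poly a m B) sums (bessel_entire a (A * B) * exp A)"
proof -
  have "(\<lambda>m. \<Sum>k\<le>m. (A * B) ^ k / (fact k * Gamma (a + real k + 1)) * (A ^ (m - k) / fact (m - k))) sums
      ((\<Sum>k. (A * B) ^ k / (fact k * Gamma (a + real k + 1))) * (\<Sum>k. A ^ k / fact k))"
    by (rule Cauchy_product_sums)
      (use summable_bessel_entire_abs[OF a, of "A * B"] abs_bessel_entire_term[OF a, of "A * B"] summable_exp_abs in auto)
  moreover have "(\<Sum>k\<le>m. (A * B) ^ k / (fact k * Gamma (a + real k + 1)) * (A ^ (m - k) / fact (m - k))) =
      A ^ m / (fact m * Gamma (a + real m + 1)) * bessel_poly a m B" for m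
    unfolding bessel_poly_def sum_distrib_left
  proof (intro sum.cong refl)
    fix k assume "k \<in> {..m}"
    then have "A ^ m = A ^ k * A ^ (m - k)" "real (m choose k) = fact m / (fact k * fact (m - k))"
      using power_add[of A k "m - k"] by (auto simp: binomial_fact)
    then show "(A * B) ^ k / (fact k * Gamma (a + real k + 1)) * (A ^ (m - k) / fact (m - k)) =
      A ^ m / (fact m * Gamma (a + real m + 1)) * (real (m choose k) * Gamma (a + real m + 1) / Gamma (a + real k + 1) * B ^ k)"
      using Gamma_shift_pos[OF a, of m] by (simp add: power_mult_distrib divide_simps)
  qed
  ultimately show ?thesis by (simp add: exp_suminf bessel_entire_def)
qed

text \<open>Only the first Bessel factor is expanded: every term is then a moment of the second
  factor, and the generating function sums the results. Since \<open>u\<close> and \<open>v\<close>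
  may have either sign, the formula covers products of I and products of J alike.\<close>

lemma weber_integral:
  assumes a: "a > - 1" and p: "p > 0"
  shows "has_bochner_integral halfline
    (\<lambda>z. z powr (2 * a + 1) * exp (- p * z\<^sup>2) * bessel_entire a (u * z\<^sup>2) * bessel_entire a (v * z\<^sup>2))
    (exp ((u + v) / p) * bessel_entire a (u * v / p\<^sup>2) / (2 * p powr (a + 1)))"
proof -
  let ?G = "\<lambda>m. fact m * Gamma (a + real m + 1)"
  let ?h = "\<lambda>v m z. z powr (2 * a + 1) * z ^ (2 * m) * exp (- p * z\<^sup>2) * bessel_entire a (v * z\<^sup>2)"
  let ?f = "\<lambda>m z. u ^ m / ?G m * ?h v m z"
  let ?K = "\<lambda>v. exp (v / p) / (2 * p powr (a + 1))"
  have G: "?G m > 0" for m using Gamma_shift_pos[OF a, of m] by simp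
  have b: "has_bochner_integral halfline (?h v m) (bessel_poly a m (v / p) * exp (v / p) / (2 * p powr (a + real m + 1)))" for v m
    by (rule bessel_moment[OF a p])
  have iv: "u ^ m / ?G m * (bessel_poly a m (v / p) * exp (v / p) / (2 * p powr (a + real m + 1))) =
      (u / p) ^ m / ?G m * bessel_poly a m (v / p) * ?K v" for u v m
  proof -
    have "p powr (a + real m + 1) = p powr (a + 1) * p ^ m"
      using p powr_add[of p "a + 1" "real m"] by (simp add: powr_realpow add_ac)
    then show ?thesis using p by (simp add: power_divide mult_ac)
  qed
  have S: "summable (\<lambda>m. (u / p) ^ m / ?G m * bessel_poly a m (v / p) * ?K v)" for u v
    using bessel_poly_series[OF a, of "u / p" "v / p"] by (intro summable_mult2) (simp add: sums_iff)
  have fi: "integrable halfline (?f m)" for m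
    using b[of m v] by (auto simp: has_bochner_integral_iff)
  have sm: "(\<lambda>m. ?f m z) sums (z powr (2 * a + 1) * exp (- p * z\<^sup>2) * bessel_entire a (u * z\<^sup>2) * bessel_entire a (v * z\<^sup>2))" for z
  proof -
    have "(\<lambda>m. (u * z\<^sup>2) ^ m / ?G m * (z powr (2 * a + 1) * exp (- p * z\<^sup>2) * bessel_entire a (v * z\<^sup>2))) sums
      (bessel_entire a (u * z\<^sup>2) * (z powr (2 * a + 1) * exp (- p * z\<^sup>2) * bessel_entire a (v * z\<^sup>2)))"
      unfolding bessel_entire_def[of a "u * z\<^sup>2"]
      by (intro sums_mult2 summable_sums summable_bessel_entire a)
    moreover have "(u * z\<^sup>2) ^ m / ?G m * (z powr (2 * a + 1) * exp (- p * z\<^sup>2) * bessel_entire a (v * z\<^sup>2)) = u ^ m / ?G m * ?h v m z" for m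
      by (simp add: power_mult_distrib power_mult)
    ultimately show ?thesis by (simp only: mult_ac)
  qed
  have nf: "norm (?f m z) = \<bar>u\<bar> ^ m / ?G m * (z powr (2 * a + 1) * z ^ (2 * m) * exp (- p * z\<^sup>2) * \<bar>bessel_entire a (v * z\<^sup>2)\<bar>)" for m z
    using Gamma_shift_pos[OF a, of m] by (simp add: abs_mult power_abs power_even_abs)
  have s1: "AE z in halfline. summable (\<lambda>m. norm (?f m z))"
  proof (rule AE_I2)
    fix z assume "z \<in> space halfline"
    have "summable (\<lambda>m. (\<bar>u\<bar> * z\<^sup>2) ^ m / ?G m * (z powr (2 * a + 1) * exp (- p * z\<^sup>2) * \<bar>bessel_entire a (v * z\<^sup>2)\<bar>))"
      by (intro summable_mult2 summable_bessel_entire a)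
    then show "summable (\<lambda>m. norm (?f m z))"
      unfolding nf by (simp add: mult_ac power_mult_distrib power_mult[symmetric])
  qed
  \<comment> \<open>Replacing \<open>u\<close> and \<open>v\<close> by their absolute values
    dominates every term, and the dominating integrals form the convergent series \<open>S\<close>
    at the new parameters.\<close>
  have s2: "summable (\<lambda>m. LINT z|halfline. norm (?f m z))"
  proof (rule summable_comparison_test'[OF S[of "\<bar>u\<bar>" "\<bar>v\<bar>"], of 0])
    fix m :: nat
    have "(LINT z|halfline. norm (?f m z)) \<le> (LINT z|halfline. \<bar>u\<bar> ^ m / ?G m * ?h \<bar>v\<bar> m z)"
    proof (rule integral_mono)
      show "integrable halfline (\<lambda>z. norm (?f m z))" by (intro integrable_norm fi)
      show "integrable halfline (\<lambda>z. \<bar>u\<bar> ^ m / ?G m * ?h \<bar>v\<bar> m z)"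
        using b[of m "\<bar>v\<bar>"] by (auto simp: has_bochner_integral_iff)
      show "norm (?f m z) \<le> \<bar>u\<bar> ^ m / ?G m * ?h \<bar>v\<bar> m z" for z
        unfolding nf using abs_bessel_entire_le[OF a, of "v * z\<^sup>2"] G[of m]
        by (intro mult_left_mono) (auto simp: abs_mult less_imp_le)
    qed
    also have "\<dots> = (\<bar>u\<bar> / p) ^ m / ?G m * bessel_poly a m (\<bar>v\<bar> / p) * ?K \<bar>v\<bar>"
      using b[of m "\<bar>v\<bar>"] by (simp only: iv[symmetric] integral_mult_right_zero has_bochner_integral_integral_eq)
    finally show "norm (LINT z|halfline. norm (?f m z)) \<le> \<dots>" by simp
  qed
  have "(\<lambda>m. integral\<^sup>L halfline (?f m)) sums (LINT z|halfline. (\<Sum>m. ?f m z))"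
    by (rule sums_integral[OF fi s1 s2])
  moreover have "(\<lambda>m. integral\<^sup>L halfline (?f m)) sums (bessel_entire a (u / p * (v / p)) * exp (u / p) * ?K v)"
  proof -
    have "integral\<^sup>L halfline (?f m) = (u / p) ^ m / ?G m * bessel_poly a m (v / p) * ?K v" for m
      using b[of m v] by (simp only: iv[symmetric] integral_mult_right_zero has_bochner_integral_integral_eq)
    then show ?thesis by (simp only:) (intro sums_mult2 bessel_poly_series[OF a])
  qed
  ultimately have i: "(LINT z|halfline. (\<Sum>m. ?f m z)) = exp ((u + v) / p) * bessel_entire a (u * v / p\<^sup>2) / (2 * p powr (a + 1))"
    by (simp add: sums_iff exp_add add_divide_distrib power2_eq_square mult_ac)
  have "has_bochner_integral halfline (\<lambda>z. (\<Sum>m. ?f m z)) (exp ((u + v) / p) * bessel_entire a (u * v / p\<^sup>2) / (2 * p powr (a + 1)))"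
    using integrable_suminf[OF fi s1 s2] i by (simp add: has_bochner_integral_iff)
  then show ?thesis using sm by (simp add: sums_iff)
qed

section \<open>The heat kernel\<close>

lemma besselI_eq: "besselI a z = (z / 2) powr a * bessel_entire a (z\<^sup>2 / 4)"
  unfolding besselI_def bessel_entire_def by (simp add: power_mult power_divide)

lemma besselJ_eq: "besselJ a z = (z / 2) powr a * bessel_entire a (- (z\<^sup>2 / 4))"
proof -
  have "(-1) ^ n * (z / 2) ^ (2 * n) = (- (z\<^sup>2 / 4)) ^ n" for n :: nat
    unfolding power_mult power_mult_distrib[symmetric] by (simp add: power_divide)
  then show ?thesis unfolding besselJ_def bessel_entire_def by simp
qed

lemma bessel_psi_eq:
  assumes "x > 0" "l > 0"
  shows "bessel_psi a l x = (x powr (a + 1 / 2) / 2 powr a) * l powr (a + 1 / 2) * bessel_entire a (- (x\<^sup>2 / 4) * l\<^sup>2)"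
  using assms unfolding bessel_psi_def besselJ_eq
  by (simp add: powr_add powr_half_sqrt powr_mult powr_divide real_sqrt_mult power_mult_distrib mult_ac)

lemma bessel_kernel_eq:
  assumes "x > 0" "y > 0" "t > 0"
  shows "bessel_kernel a t x y = (1 / (2 * t) * x powr (a + 1 / 2) * (4 * t) powr (- a) * exp (- (x\<^sup>2 / (4 * t)))) *
     (y powr (a + 1 / 2) * exp (- (1 / (4 * t)) * y\<^sup>2) * bessel_entire a (x\<^sup>2 / (16 * t\<^sup>2) * y\<^sup>2))"
proof -
  have "exp (- (x\<^sup>2 + y\<^sup>2) / (4 * t)) = exp (- (x\<^sup>2 / (4 * t))) * exp (- (1 / (4 * t)) * y\<^sup>2)"
    by (simp add: exp_add[symmetric] diff_divide_distrib)
  moreover have "(x * y / (2 * t) / 2) powr a = x powr a * y powr a * (4 * t) powr (- a)"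
    using assms by (simp add: powr_mult powr_divide powr_minus field_simps)
  ultimately show ?thesis
    using assms unfolding bessel_kernel_def besselI_eq
    by (simp add: powr_add powr_half_sqrt real_sqrt_mult power_mult_distrib power_divide)
qed

lemma bessel_kernel_commute: "bessel_kernel a t x y = bessel_kernel a t y x"
  by (simp add: bessel_kernel_def mult.commute add.commute)

lemma bessel_kernel_pos:
  assumes "a > - 1" "x > 0" "y > 0" "t > 0"
  shows "bessel_kernel a t x y > 0"
  unfolding bessel_kernel_eq[OF assms(2-)] using assms
  by (intro mult_pos_pos bessel_entire_pos) auto

lemma besselI_measurable [measurable]: "besselI a \<in> borel_measurable borel"
  unfolding besselI_eq[abs_def] by measurable

lemma besselJ_measurable [measurable]: "besselJ a \<in> borel_measurable borel"
  unfolding besselJ_eq[abs_def] by measurable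

lemma bessel_kernel_measurable [measurable]:
  assumes "f \<in> borel_measurable M" "g \<in> borel_measurable M"
  shows "(\<lambda>x. bessel_kernel a t (f x) (g x)) \<in> borel_measurable M"
  unfolding bessel_kernel_def using assms by measurable

lemma bessel_psi_measurable [measurable]:
  assumes "f \<in> borel_measurable M" "g \<in> borel_measurable M"
  shows "(\<lambda>x. bessel_psi a (f x) (g x)) \<in> borel_measurable M"
  unfolding bessel_psi_def using assms by measurable

text \<open>Weighting by x^(a + 1/2) makes the kernel behave like a transition density: for m = 0
  the polynomial is 1, so this power is reproduced by the kernel. The cases m = 1 and m = 2 give the
  variance of the Bessel process.\<close>

lemma bessel_kernel_moment:
  assumes a: "a > - 1" and x: "x > 0" and t: "t > 0"
  shows "has_bochner_integral halfline (\<lambda>y. bessel_kernel a t x y * y powr (a + 1 / 2) * y ^ (2 * m))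
     (x powr (a + 1 / 2) * (4 * t) ^ m * bessel_poly a m (x\<^sup>2 / (4 * t)))"
proof -
  let ?C = "1 / (2 * t) * x powr (a + 1 / 2) * (4 * t) powr (- a) * exp (- (x\<^sup>2 / (4 * t)))"
  let ?p = "1 / (4 * t)"
  have v: "x\<^sup>2 / (16 * t\<^sup>2) / ?p = x\<^sup>2 / (4 * t)" using t by (simp add: field_simps power2_eq_square)
  have P: "?p powr (a + real m + 1) = 1 / ((4 * t) powr a * (4 * t) ^ m * (4 * t))"
    using t by (simp add: powr_add powr_divide powr_realpow field_simps powr_mult)
  have E: "exp (- (x\<^sup>2 / (4 * t))) * exp (x\<^sup>2 / (4 * t)) = 1" by (simp add: exp_add[symmetric])
  have Q: "(4 * t) powr - a * (4 * t) powr a = 1" using t by (simp add: powr_add[symmetric])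
  have "?C * (bessel_poly a m (x\<^sup>2 / (4 * t)) * exp (x\<^sup>2 / (4 * t)) / (2 * ?p powr (a + real m + 1))) =
     (exp (- (x\<^sup>2 / (4 * t))) * exp (x\<^sup>2 / (4 * t))) * ((4 * t) powr - a * (4 * t) powr a) * (x powr (a + 1 / 2) * (4 * t) ^ m * bessel_poly a m (x\<^sup>2 / (4 * t)))"
    unfolding P using t by simp
  then have val: "?C * (bessel_poly a m (x\<^sup>2 / (4 * t)) * exp (x\<^sup>2 / (4 * t)) / (2 * ?p powr (a + real m + 1))) =
     x powr (a + 1 / 2) * (4 * t) ^ m * bessel_poly a m (x\<^sup>2 / (4 * t))" unfolding E Q by simp
  have "has_bochner_integral halfline (\<lambda>y. ?C * (y powr (2 * a + 1) * y ^ (2 * m) * exp (- ?p * y\<^sup>2) * bessel_entire a (x\<^sup>2 / (16 * t\<^sup>2) * y\<^sup>2)))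
     (?C * (bessel_poly a m (x\<^sup>2 / (16 * t\<^sup>2) / ?p) * exp (x\<^sup>2 / (16 * t\<^sup>2) / ?p) / (2 * ?p powr (a + real m + 1))))"
    by (intro has_bochner_integral_mult_right bessel_moment) (use a t in auto)
  moreover have "?C * (y powr (2 * a + 1) * y ^ (2 * m) * exp (- ?p * y\<^sup>2) * bessel_entire a (x\<^sup>2 / (16 * t\<^sup>2) * y\<^sup>2)) =
      bessel_kernel a t x y * y powr (a + 1 / 2) * y ^ (2 * m)" if "y > 0" for y
  proof -
    have "y powr (2 * a + 1) = y powr (a + 1 / 2) * y powr (a + 1 / 2)" by (simp add: powr_add[symmetric])
    then show ?thesis unfolding bessel_kernel_eq[OF x that t] by simp
  qed
  ultimately show ?thesis unfolding v val
    by (rule has_bochner_integral_halfline_cong)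
qed

lemma bessel_kernel_semigroup:
  assumes a: "a > - 1" and x: "x > 0" and y: "y > 0" and s: "s > 0" and t: "t > 0"
  shows "has_bochner_integral halfline (\<lambda>z. bessel_kernel a s x z * bessel_kernel a t z y) (bessel_kernel a (s + t) x y)"
proof -
  let ?C = "\<lambda>t x. 1 / (2 * t) * x powr (a + 1 / 2) * (4 * t) powr (- a) * exp (- (x\<^sup>2 / (4 * t)))"
  \<comment> \<open>In the intermediate variable the Gaussian factors of the two kernels multiply to
    exp(- p z^2), and each kernel contributes one entire factor with a positive parameter.\<close>
  let ?p = "1 / (4 * s) + 1 / (4 * t)"
  let ?u = "x\<^sup>2 / (16 * s\<^sup>2)" and ?v = "y\<^sup>2 / (16 * t\<^sup>2)"
  have p: "?p > 0" "?p = (s + t) / (4 * s * t)" using s t by (auto simp: field_simps)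
  have uv: "?u * ?v / ?p\<^sup>2 = x\<^sup>2 / (16 * (s + t)\<^sup>2) * y\<^sup>2"
    unfolding p using s t by (simp add: power_divide power_mult_distrib)
  have e: "exp (- (x\<^sup>2 / (4 * s))) * exp (- (y\<^sup>2 / (4 * t))) * exp ((?u + ?v) / ?p) = exp (- (x\<^sup>2 / (4 * (s + t)))) * exp (- (1 / (4 * (s + t))) * y\<^sup>2)"
  proof -
    have "- (x\<^sup>2 / (4 * s)) + - (y\<^sup>2 / (4 * t)) + (?u + ?v) / ?p = - (x\<^sup>2 / (4 * (s + t))) + - (1 / (4 * (s + t))) * y\<^sup>2"
      unfolding p using s t by (simp add: divide_simps) (simp add: algebra_simps power2_eq_square)
    then show ?thesis by (simp only: exp_add[symmetric])
  qed
  have c: "1 / (2 * s) * (4 * s) powr (- a) * (1 / (2 * t) * (4 * t) powr (- a)) / (2 * ?p powr (a + 1)) = 1 / (2 * (s + t)) * (4 * (s + t)) powr (- a)"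
  proof -
    have "?p powr (a + 1) = (4 * (s + t)) powr a / ((4 * s) powr a * (4 * t) powr a) * ?p"
    proof -
      have "?p = 4 * (s + t) / ((4 * s) * (4 * t))" unfolding p using s t by (simp add: divide_simps)
      then show ?thesis using p(1) s t powr_mult[of 4 4 a] by (simp add: powr_add powr_divide powr_mult)
    qed
    note q = this
    show ?thesis unfolding q unfolding p using s t by (simp add: powr_minus divide_simps)
  qed
  let ?M = "exp ((?u + ?v) / ?p) * bessel_entire a (?u * ?v / ?p\<^sup>2) / (2 * ?p powr (a + 1))"
  have val: "?C s x * ?C t y * ?M = bessel_kernel a (s + t) x y"
  proof -
    have "?C s x * ?C t y * ?M = x powr (a + 1 / 2) * y powr (a + 1 / 2)
       * (exp (- (x\<^sup>2 / (4 * s))) * exp (- (y\<^sup>2 / (4 * t))) * exp ((?u + ?v) / ?p))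
       * (1 / (2 * s) * (4 * s) powr (- a) * (1 / (2 * t) * (4 * t) powr (- a)) / (2 * ?p powr (a + 1)))
       * bessel_entire a (?u * ?v / ?p\<^sup>2)" by (simp add: mult_ac)
    then show ?thesis unfolding e c uv using x y s t by (subst bessel_kernel_eq) (auto simp: mult_ac)
  qed
  have "has_bochner_integral halfline (\<lambda>z. ?C s x * ?C t y * (z powr (2 * a + 1) * exp (- ?p * z\<^sup>2) * bessel_entire a (?u * z\<^sup>2) * bessel_entire a (?v * z\<^sup>2)))
     (?C s x * ?C t y * ?M)"
    by (intro has_bochner_integral_mult_right weber_integral a p)
  moreover have "?C s x * ?C t y * (z powr (2 * a + 1) * exp (- ?p * z\<^sup>2) * bessel_entire a (?u * z\<^sup>2) * bessel_entire a (?v * z\<^sup>2)) =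
      bessel_kernel a s x z * bessel_kernel a t z y" if "z > 0" for z
  proof -
    have 1: "z powr (2 * a + 1) = z powr (a + 1 / 2) * z powr (a + 1 / 2)" by (simp add: powr_add[symmetric])
    have 2: "exp (- ?p * z\<^sup>2) = exp (- (1 / (4 * s)) * z\<^sup>2) * exp (- (1 / (4 * t)) * z\<^sup>2)"
      by (simp add: exp_add[symmetric] algebra_simps)
    show ?thesis unfolding bessel_kernel_commute[of a t z y] bessel_kernel_eq[OF x that s] bessel_kernel_eq[OF y that t] 1 2
      by (simp only: mult_ac)
  qed
  ultimately show ?thesis unfolding val
    by (rule has_bochner_integral_halfline_cong)
qed

text \<open>Weber's integral at two negative parameters. Their product is positive, which is why two
  oscillating functions J produce the positive function I of the heat kernel.\<close>

lemma bessel_psi_heat: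
  assumes a: "a > - 1" and x: "x > 0" and y: "y > 0" and t: "t > 0"
  shows "has_bochner_integral halfline (\<lambda>l. exp (- t * l\<^sup>2) * (bessel_psi a l x * bessel_psi a l y)) (bessel_kernel a t x y)"
proof -
  let ?D = "\<lambda>x. x powr (a + 1 / 2) / 2 powr a"
  let ?u = "- (x\<^sup>2 / 4)" and ?v = "- (y\<^sup>2 / 4)"
  let ?M = "exp ((?u + ?v) / t) * bessel_entire a (?u * ?v / t\<^sup>2) / (2 * t powr (a + 1))"
  have val: "?D x * ?D y * ?M = bessel_kernel a t x y"
  proof -
    have 1: "(4 * t) powr (- a) = 1 / (2 powr a * 2 powr a * t powr a)"
      using t powr_mult[of 2 2 a] by (simp add: powr_mult powr_minus divide_simps)
    have 2: "exp ((?u + ?v) / t) = exp (- (x\<^sup>2 / (4 * t))) * exp (- (1 / (4 * t)) * y\<^sup>2)"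
      using t by (simp add: exp_add[symmetric] field_simps)
    have 3: "?u * ?v / t\<^sup>2 = x\<^sup>2 / (16 * t\<^sup>2) * y\<^sup>2" by simp
    show ?thesis unfolding bessel_kernel_eq[OF x y t] 1 2 3 using t by (simp add: powr_add mult_ac)
  qed
  have "has_bochner_integral halfline (\<lambda>l. ?D x * ?D y * (l powr (2 * a + 1) * exp (- t * l\<^sup>2) * bessel_entire a (?u * l\<^sup>2) * bessel_entire a (?v * l\<^sup>2)))
     (?D x * ?D y * ?M)"
    by (intro has_bochner_integral_mult_right weber_integral a t)
  moreover have "?D x * ?D y * (l powr (2 * a + 1) * exp (- t * l\<^sup>2) * bessel_entire a (?u * l\<^sup>2) * bessel_entire a (?v * l\<^sup>2)) =
      exp (- t * l\<^sup>2) * (bessel_psi a l x * bessel_psi a l y)" if "l > 0" for l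
  proof -
    have 1: "l powr (2 * a + 1) = l powr (a + 1 / 2) * l powr (a + 1 / 2)" by (simp add: powr_add[symmetric])
    show ?thesis unfolding bessel_psi_eq[OF x that] bessel_psi_eq[OF y that] 1 by (simp only: mult_ac)
  qed
  ultimately show ?thesis unfolding val
    by (rule has_bochner_integral_halfline_cong)
qed

lemma nn_integral_has_bochner:
  assumes "has_bochner_integral M f I" "\<And>x. x \<in> space M \<Longrightarrow> 0 \<le> f x"
  shows "(\<integral>\<^sup>+x. ennreal (f x) \<partial>M) = ennreal I"
  using assms nn_integral_eq_integral[of M f] by (auto simp: has_bochner_integral_iff)

section \<open>The total mass of the heat kernel\<close>

text \<open>With \<open>b = a / 2 + 1 / 4\<close> and \<open>w = x\<^sup>2 / (4 * t)\<close>, the mass is \<open>w powr b\<close> times the mean of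
  \<open>mass_coeff b n\<close> over a Poisson variable \<open>n\<close> of parameter \<open>w\<close>.\<close>

definition mass_coeff :: "real \<Rightarrow> nat \<Rightarrow> real" where
  "mass_coeff b n = Gamma (real n + b + 1 / 2) / Gamma (real n + 2 * b + 1 / 2)"

definition mass_series :: "real \<Rightarrow> real \<Rightarrow> ennreal" where
  "mass_series b w = (\<Sum>n. ennreal (exp (- w) * w ^ n / fact n * (w powr b * mass_coeff b n)))"

text \<open>The nonnegative series of the kernel is integrated term by term. The parameter
  \<open>b\<close> satisfies 2 b = a + 1/2, so that x^(a + 1/2) splits into (4 t)^b w^b and all
  remaining powers of t cancel.\<close>

lemma bessel_kernel_mass:
  assumes a: "a = 2 * b - 1 / 2" and b: "b \<ge> 0" and x: "x > 0" and t: "t > 0" and w: "w = x\<^sup>2 / (4 * t)"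
  shows "(\<integral>\<^sup>+y. ennreal (bessel_kernel a t x y) \<partial>halfline) =
    mass_series b w"
proof -
  let ?C = "1 / (2 * t) * x powr (a + 1 / 2) * (4 * t) powr (- a) * exp (- w)"
  let ?p = "1 / (4 * t)"
  let ?v = "x\<^sup>2 / (16 * t\<^sup>2)"
  let ?G = "\<lambda>n. fact n * Gamma (a + real n + 1)"
  have a1: "a > - 1" using a b by simp
  have w0: "w > 0" using w x t by simp
  let ?m = "\<lambda>n y. y powr (2 * (real n + b + 1 / 2) - 1) * exp (- ?p * y\<^sup>2)"
  have C: "?C \<ge> 0" using t by simp
  have 1: "ennreal (bessel_kernel a t x y) = (\<Sum>n. ennreal (?C * ?v ^ n / ?G n * ?m n y))" if y: "y > 0" for y
  proof -
    have "(\<lambda>n. (?v * y\<^sup>2) ^ n / ?G n) sums bessel_entire a (?v * y\<^sup>2)"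
      unfolding bessel_entire_def by (intro summable_sums summable_bessel_entire a1)
    then have "(\<lambda>n. (?C * (y powr (a + 1 / 2) * exp (- ?p * y\<^sup>2))) * ((?v * y\<^sup>2) ^ n / ?G n)) sums
       ((?C * (y powr (a + 1 / 2) * exp (- ?p * y\<^sup>2))) * bessel_entire a (?v * y\<^sup>2))"
      by (rule sums_mult)
    moreover have "(?C * (y powr (a + 1 / 2) * exp (- ?p * y\<^sup>2))) * bessel_entire a (?v * y\<^sup>2) = bessel_kernel a t x y"
      unfolding bessel_kernel_eq[OF x y t] w by (simp only: mult.assoc)
    moreover have "(?C * (y powr (a + 1 / 2) * exp (- ?p * y\<^sup>2))) * ((?v * y\<^sup>2) ^ n / ?G n) = ?C * ?v ^ n / ?G n * ?m n y" for n
    proof -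
      have "y powr (2 * (real n + b + 1 / 2) - 1) = y powr (a + 1 / 2) * y ^ (2 * n)"
        unfolding power_even_eq_powr[OF y] powr_add[symmetric] using a by (simp add: algebra_simps)
      moreover have "(?v * y\<^sup>2) ^ n = ?v ^ n * y ^ (2 * n)" unfolding power_mult_distrib power_mult ..
      ultimately show ?thesis by (simp only: times_divide_eq_left times_divide_eq_right divide_divide_eq_left mult_ac)
    qed
    ultimately have *: "(\<lambda>n. ?C * ?v ^ n / ?G n * ?m n y) sums bessel_kernel a t x y" by (simp only:)
    have "0 \<le> ?C * ?v ^ n / ?G n * ?m n y" for n
      using C t Gamma_shift_pos[OF a1, of n] by (intro mult_nonneg_nonneg divide_nonneg_nonneg) auto
    from suminf_ennreal2[OF this sums_summable[OF *]] show ?thesis using * by (simp add: sums_iff)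
  qed
  have 2: "(\<integral>\<^sup>+y. ennreal (?C * ?v ^ n / ?G n * ?m n y) \<partial>halfline) = ennreal (exp (- w) * w ^ n / fact n * (w powr b * mass_coeff b n))" for n
  proof -
    let ?s = "real n + b + 1 / 2"
    have hb: "has_bochner_integral halfline (\<lambda>y. ?C * ?v ^ n / ?G n * ?m n y) (?C * ?v ^ n / ?G n * (Gamma ?s / (2 * ?p powr ?s)))"
      by (intro has_bochner_integral_mult_right gaussian_moment) (use b t in auto)
    have "?C * ?v ^ n / ?G n * (Gamma ?s / (2 * ?p powr ?s)) = exp (- w) * w ^ n / fact n * (w powr b * mass_coeff b n)"
    proof -
      have x2: "x powr (a + 1 / 2) = (4 * t) powr b * w powr b"
      proof -
        have "(4 * t) powr b * w powr b = (x\<^sup>2) powr b" using w t x by (simp add: powr_mult[symmetric])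
        also have "\<dots> = x powr (a + 1 / 2)" using a x by (simp add: powr_powr powr_numeral[symmetric] del: powr_numeral)
        finally show ?thesis by simp
      qed
      have p: "?p powr ?s = 1 / ((4 * t) ^ n * (4 * t) powr (b + 1 / 2))"
        using t by (simp add: powr_divide powr_add powr_realpow)
      have v: "?v ^ n * (4 * t) ^ n = w ^ n"
      proof -
        have "?v * (4 * t) = w" using w t by (simp add: field_simps power2_eq_square)
        then show ?thesis by (simp only: power_mult_distrib[symmetric])
      qed
      have q: "(4 * t) powr (- a) * ((4 * t) powr b * (4 * t) powr (b + 1 / 2)) = 4 * t"
        unfolding powr_add[symmetric] using t a by simp
      have "?C * ?v ^ n / ?G n * (Gamma ?s / (2 * ?p powr ?s)) =
         exp (- w) * (?v ^ n * (4 * t) ^ n) / fact n * (w powr b * (Gamma ?s / Gamma (a + real n + 1))) * (1 / (4 * t)) *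
         ((4 * t) powr (- a) * ((4 * t) powr b * (4 * t) powr (b + 1 / 2)))"
        unfolding x2 p by (simp add: mult_ac)
      also have "\<dots> = exp (- w) * w ^ n / fact n * (w powr b * (Gamma ?s / Gamma (a + real n + 1)))"
        unfolding v q using t by simp
      moreover have "Gamma (a + real n + 1) = Gamma (real n + 2 * b + 1 / 2)" using a by (simp add: add_ac)
      ultimately show ?thesis unfolding mass_coeff_def by metis
    qed
    moreover have "0 \<le> ?C * ?v ^ n / ?G n * ?m n y" for y
      using C t Gamma_shift_pos[OF a1, of n] by (intro mult_nonneg_nonneg divide_nonneg_nonneg) auto
    ultimately show ?thesis using nn_integral_has_bochner[OF hb] by simp
  qed
  have "(\<integral>\<^sup>+y. ennreal (bessel_kernel a t x y) \<partial>halfline) = (\<integral>\<^sup>+y. (\<Sum>n. ennreal (?C * ?v ^ n / ?G n * ?m n y)) \<partial>halfline)"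
    by (intro nn_integral_cong 1) simp
  also have "\<dots> = (\<Sum>n. (\<integral>\<^sup>+y. ennreal (?C * ?v ^ n / ?G n * ?m n y) \<partial>halfline))"
    by (rule nn_integral_suminf) (intro halfline_borel, measurable)
  finally show ?thesis unfolding 2 mass_series_def .
qed

section \<open>Poisson weights\<close>

lemma poisson_sums: "(\<lambda>n. exp (- w) * w ^ n / fact n) sums (1 :: real)"
proof -
  have "(\<lambda>n. w ^ n / fact n) sums exp w"
    using summable_sums[OF summable_norm_cancel[OF summable_exp_abs[of w]]] unfolding exp_suminf .
  from sums_mult[OF this, of "exp (- w)"] show ?thesis by (simp add: mult_exp_exp)
qed

lemma poisson_suminf: "(\<Sum>n. ennreal (exp (- w) * w ^ n / fact n)) = 1" if "w \<ge> 0"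
proof -
  have "(\<Sum>n. ennreal (exp (- w) * w ^ n / fact n)) = ennreal (\<Sum>n. exp (- w) * w ^ n / fact n)"
    by (rule suminf_ennreal2[OF _ sums_summable[OF poisson_sums]]) (use that in auto)
  then show ?thesis unfolding sums_unique[OF poisson_sums, symmetric] by simp
qed

text \<open>The weights without the one at 0. They arise when the weight at n is multiplied by w /
  (n + 1), which turns it into the weight at n + 1.\<close>

lemma poisson_suminf_Suc: "(\<Sum>n. ennreal (exp (- w) * w ^ Suc n / fact (Suc n))) \<le> 1" if "w \<ge> 0"
proof -
  have s: "(\<lambda>n. exp (- w) * w ^ Suc n / fact (Suc n)) sums (1 - exp (- w))"
    using poisson_sums[of w] by (subst sums_Suc_iff) simp
  have "(\<Sum>n. ennreal (exp (- w) * w ^ Suc n / fact (Suc n))) = ennreal (\<Sum>n. exp (- w) * w ^ Suc n / fact (Suc n))"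
    by (rule suminf_ennreal2[OF _ sums_summable[OF s]]) (use that in auto)
  then show ?thesis unfolding sums_unique[OF s, symmetric] by simp
qed


section \<open>A uniform bound for the mass\<close>

lemma Gamma_gautschi:
  fixes x b :: real
  assumes "x > 0" "0 \<le> b" "b \<le> 1"
  shows "Gamma (x + 1) \<le> Gamma (x + b) * (x + b) powr (1 - b)"
proof (cases "x + b > 0")
  case True
  \<comment> \<open>Log-convexity of the Gamma function, with x + 1 written as a convex combination
    of x + b + 1 and x + b.\<close>
  have "(ln \<circ> Gamma) ((1 - b) *\<^sub>R (x + b + 1) + b *\<^sub>R (x + b)) \<le> (1 - b) * (ln \<circ> Gamma) (x + b + 1) + b * (ln \<circ> Gamma) (x + b)"
    using convex_onD[OF log_convex_Gamma_real, of b "x + b + 1" "x + b"] assms by simp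
  moreover have "(1 - b) *\<^sub>R (x + b + 1) + b *\<^sub>R (x + b) = x + 1" by (simp add: algebra_simps)
  moreover have "Gamma (x + b + 1) = (x + b) * Gamma (x + b)"
    using Gamma_plus1_pos[of "x + b"] True by simp
  moreover have pos: "Gamma (x + b) > 0" "Gamma (x + 1) > 0" using True assms by (auto intro: Gamma_real_pos)
  ultimately have "ln (Gamma (x + 1)) \<le> (1 - b) * (ln (x + b) + ln (Gamma (x + b))) + b * ln (Gamma (x + b))"
    using True by (simp add: ln_mult)
  also have "\<dots> = ln (Gamma (x + b) * (x + b) powr (1 - b))"
  proof -
    have "ln (Gamma (x + b) * (x + b) powr (1 - b)) = ln (Gamma (x + b)) + ln ((x + b) powr (1 - b))"
      by (rule ln_mult_pos) (use True pos in auto)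
    then show ?thesis using True by (simp add: ln_powr algebra_simps)
  qed
  finally have l: "ln (Gamma (x + 1)) \<le> ln (Gamma (x + b) * (x + b) powr (1 - b))" .
  have "0 < Gamma (x + b) * (x + b) powr (1 - b)" using True pos by (intro mult_pos_pos) auto
  then show ?thesis using l pos by (subst (asm) ln_le_cancel_iff)
qed (use assms in auto)

text \<open>Gautschi's inequality bounds the coefficients by a multiple of \<open>(n + 1) powr (- b)\<close>; the factor
  \<open>w powr b\<close> is then absorbed by \<open>s powr b \<le> 1 + s\<close>.\<close>

lemma mass_coeff_bound:
  assumes b: "0 \<le> b" "b \<le> 1" and w: "w > 0"
  shows "w powr b * mass_coeff b n \<le> 2 + 4 * (w / (real n + 1))"
proof -
  \<comment> \<open>The ratio in question is Gamma(x) / Gamma(x + b). The factor 2 below comes from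
    x + b \<le> 2 x, and the factor 4 from doubling it once more through x + b \<ge> (n + 1) /
    2.\<close>
  define x where "x = real n + b + 1 / 2"
  have x: "x > 0" "b \<le> x" "x + b \<ge> (real n + 1) / 2" using b by (auto simp: x_def)
  have "x * Gamma x \<le> Gamma (x + b) * (x + b) powr (1 - b)"
    using Gamma_gautschi[OF x(1) b] Gamma_plus1_pos[of x] x(1) by simp
  also have "\<dots> = (x + b) * (Gamma (x + b) * (x + b) powr (- b))"
    using x b powr_add[of "x + b" 1 "- b"] by simp
  also have "\<dots> \<le> (2 * x) * (Gamma (x + b) * (x + b) powr (- b))"
    using x b by (intro mult_right_mono) (auto intro!: mult_nonneg_nonneg less_imp_le[OF Gamma_real_pos])
  finally have "Gamma x \<le> 2 * (Gamma (x + b) * (x + b) powr (- b))" using x(1) by simp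
  moreover have "mass_coeff b n = Gamma x / Gamma (x + b)" unfolding mass_coeff_def x_def by (simp add: algebra_simps)
  moreover have "Gamma (x + b) > 0" using x b by (intro Gamma_real_pos) auto
  ultimately have "mass_coeff b n \<le> 2 * (x + b) powr (- b)" by (simp add: pos_divide_le_eq mult_ac)
  then have "w powr b * mass_coeff b n \<le> w powr b * (2 * (x + b) powr (- b))" by (intro mult_left_mono) auto
  also have "\<dots> = 2 * (w / (x + b)) powr b" using w x b by (simp add: powr_divide powr_minus field_simps)
  also have "(w / (x + b)) powr b \<le> 1 + w / (x + b)"
  proof (cases "w / (x + b) \<le> 1")
    case True
    moreover have "0 \<le> w / (x + b)" using w x b by simp
    ultimately show ?thesis using powr_le1[of b "w / (x + b)"] b by linarith
  next
    case False
    then have "(w / (x + b)) powr b \<le> (w / (x + b)) powr 1" using b by (intro powr_mono) auto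
    also have "\<dots> = w / (x + b)" using w x b by simp
    finally show ?thesis by simp
  qed
  also have "w / (x + b) \<le> w / ((real n + 1) / 2)" using x w b by (intro divide_left_mono) auto
  finally show ?thesis by simp
qed

lemma mass_coeff_nonneg: "b \<ge> 0 \<Longrightarrow> mass_coeff b n \<ge> 0"
  unfolding mass_coeff_def by (intro divide_nonneg_nonneg less_imp_le[OF Gamma_real_pos]) auto

text \<open>The constant is 2 + 4: the term w / (n + 1) of the coefficient bound shifts the Poisson
  weight by one, so both parts of the sum are at most total Poisson masses.\<close>

lemma mass_series_bound:
  assumes b: "0 \<le> b" "b \<le> 1" and w: "w > 0"
  shows "mass_series b w \<le> 6"
proof -
  have "mass_series b w \<le>
    (\<Sum>n. 2 * ennreal (exp (- w) * w ^ n / fact n) + 4 * ennreal (exp (- w) * w ^ Suc n / fact (Suc n)))"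
    unfolding mass_series_def
  proof (rule suminf_le)
    fix n
    have "exp (- w) * w ^ n / fact n * (w powr b * mass_coeff b n) \<le> exp (- w) * w ^ n / fact n * (2 + 4 * (w / (real n + 1)))"
      using w by (intro mult_left_mono mass_coeff_bound b) auto
    also have "\<dots> = 2 * (exp (- w) * w ^ n / fact n) + 4 * (exp (- w) * w ^ Suc n / fact (Suc n))"
    proof -
      have "4 * (exp (- w) * w ^ Suc n / fact (Suc n)) = exp (- w) * w ^ n / fact n * (4 * (w / (real n + 1)))"
        by (simp add: ac_simps)
      then show ?thesis by (simp only: distrib_left) simp
    qed
    finally show "ennreal (exp (- w) * w ^ n / fact n * (w powr b * mass_coeff b n)) \<le>
       2 * ennreal (exp (- w) * w ^ n / fact n) + 4 * ennreal (exp (- w) * w ^ Suc n / fact (Suc n))"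
      using w by (simp add: ennreal_mult''[symmetric] ennreal_plus[symmetric] ennreal_numeral[symmetric]
        del: ennreal_plus ennreal_numeral fact_Suc)
  qed auto
  also have "\<dots> = 2 * (\<Sum>n. ennreal (exp (- w) * w ^ n / fact n)) + 4 * (\<Sum>n. ennreal (exp (- w) * w ^ Suc n / fact (Suc n)))"
    by (subst suminf_add[symmetric]) (auto simp: ennreal_suminf_cmult)
  also have "\<dots> \<le> 2 * 1 + 4 * 1"
    using w by (intro add_mono mult_left_mono poisson_suminf_Suc eq_refl[OF poisson_suminf]) auto
  finally show ?thesis by simp
qed

text \<open>For positive \<open>b\<close> the coefficients are Beta integrals, and the Poisson sum can be carried out
  under the integral sign.\<close>

lemma mass_coeff_Beta:
  assumes b: "b > 0"
  shows "ennreal (mass_coeff b n) =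
    (\<integral>\<^sup>+u. ennreal (1 / Gamma b * (u powr (b - 1) * ((1 - u) ^ n * (1 - u) powr (b - 1 / 2)))) * indicator {0<..<1} u \<partial>lborel)"
proof -
  have G: "Gamma b > 0" using b by (rule Gamma_real_pos)
  have "((\<lambda>u. u powr (b - 1) * (1 - u) powr (real n + b + 1 / 2 - 1)) has_integral Beta b (real n + b + 1 / 2)) {0<..<1}"
    using has_integral_Beta_real[of b "real n + b + 1 / 2"] b by (simp add: has_integral_Icc_iff_Ioo)
  from has_integral_mult_right[OF this, of "1 / Gamma b"]
  have "((\<lambda>u. 1 / Gamma b * (u powr (b - 1) * (1 - u) powr (real n + b + 1 / 2 - 1))) has_integral mass_coeff b n) {0<..<1}"
    using G by (simp add: Beta_def mass_coeff_def add_ac)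
  from nn_integral_has_integral_lebesgue'[OF _ this] G
  have "ennreal (mass_coeff b n) = (\<integral>\<^sup>+u. ennreal (1 / Gamma b * (u powr (b - 1) * (1 - u) powr (real n + b + 1 / 2 - 1))) * indicator {0<..<1} u \<partial>lborel)"
    by simp
  also have "\<dots> = (\<integral>\<^sup>+u. ennreal (1 / Gamma b * (u powr (b - 1) * ((1 - u) ^ n * (1 - u) powr (b - 1 / 2)))) * indicator {0<..<1} u \<partial>lborel)"
  proof (intro nn_integral_cong)
    fix u :: real
    have "(1 - u) powr (real n + b + 1 / 2 - 1) = (1 - u) ^ n * (1 - u) powr (b - 1 / 2)" if "u < 1"
    proof -
      have "real n + b + 1 / 2 - 1 = real n + (b - 1 / 2)" by simp
      then show ?thesis using that by (simp only: powr_add) (simp add: powr_realpow)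
    qed
    then show "ennreal (1 / Gamma b * (u powr (b - 1) * (1 - u) powr (real n + b + 1 / 2 - 1))) * indicator {0<..<1} u =
      ennreal (1 / Gamma b * (u powr (b - 1) * ((1 - u) ^ n * (1 - u) powr (b - 1 / 2)))) * indicator {0<..<1} u"
      by (auto simp: indicator_def)
  qed
  finally show ?thesis .
qed

lemma mass_series_integral:
  assumes b: "b > 0" and w: "w > 0"
  shows "mass_series b w =
    (\<integral>\<^sup>+u. ennreal (w powr b / Gamma b * (u powr (b - 1) * exp (- (w * u))) * (1 - u) powr (b - 1 / 2)) * indicator {0<..<1} u \<partial>lborel)"
proof -
  have G: "Gamma b > 0" using b by (rule Gamma_real_pos)
  let ?c = "\<lambda>n. exp (- w) * w ^ n / fact n * w powr b"
  let ?g = "\<lambda>n u. 1 / Gamma b * (u powr (b - 1) * ((1 - u) ^ n * (1 - u) powr (b - 1 / 2)))"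
  have c: "?c n \<ge> 0" for n using w by simp
  have "ennreal (exp (- w) * w ^ n / fact n * (w powr b * mass_coeff b n)) =
     (\<integral>\<^sup>+u. ennreal (?c n * ?g n u) * indicator {0<..<1} u \<partial>lborel)" for n
  proof -
    have "ennreal (exp (- w) * w ^ n / fact n * (w powr b * mass_coeff b n)) = ennreal (?c n) * ennreal (mass_coeff b n)"
      using w by (simp add: ennreal_mult''[symmetric] mass_coeff_nonneg b less_imp_le mult_ac)
    also have "\<dots> = (\<integral>\<^sup>+u. ennreal (?c n) * (ennreal (?g n u) * indicator {0<..<1} u) \<partial>lborel)"
      unfolding mass_coeff_Beta[OF b] by (rule nn_integral_cmult[symmetric]) measurable
    also have "\<dots> = (\<integral>\<^sup>+u. ennreal (?c n * ?g n u) * indicator {0<..<1} u \<partial>lborel)"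
      unfolding mult.assoc[symmetric] ennreal_mult'[OF c, symmetric] ..
    finally show ?thesis .
  qed
  then have "mass_series b w =
     (\<integral>\<^sup>+u. (\<Sum>n. ennreal (?c n * ?g n u) * indicator {0<..<1} u) \<partial>lborel)"
    unfolding mass_series_def by (simp only:) (rule nn_integral_suminf[symmetric], measurable)
  also have "\<dots> = (\<integral>\<^sup>+u. ennreal (w powr b / Gamma b * (u powr (b - 1) * exp (- (w * u))) * (1 - u) powr (b - 1 / 2)) * indicator {0<..<1} u \<partial>lborel)"
  proof (intro nn_integral_cong)
    fix u :: real
    have "(\<Sum>n. ennreal (?c n * ?g n u)) = ennreal (w powr b / Gamma b * (u powr (b - 1) * exp (- (w * u))) * (1 - u) powr (b - 1 / 2))" if u: "0 < u" "u < 1"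
    proof -
      let ?h = "w powr b / Gamma b * (u powr (b - 1) * exp (- (w * u))) * (1 - u) powr (b - 1 / 2)"
      \<comment> \<open>Splitting exp(-w) into exp(-w u) and exp(-w (1 - u)) leaves the Poisson
        weights of parameter w (1 - u), which sum to 1.\<close>
      have "(\<lambda>n. ?h * (exp (- (w * (1 - u))) * (w * (1 - u)) ^ n / fact n)) sums (?h * 1)"
        by (intro sums_mult poisson_sums)
      moreover have "?h * (exp (- (w * (1 - u))) * (w * (1 - u)) ^ n / fact n) = ?c n * ?g n u" for n
      proof -
        have "exp (- w) = exp (- (w * u)) * exp (- (w * (1 - u)))" by (simp add: mult_exp_exp algebra_simps)
        then show ?thesis by (simp add: power_mult_distrib mult_ac)
      qed
      ultimately have s: "(\<lambda>n. ?c n * ?g n u) sums ?h" by simp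
      have "(\<Sum>n. ennreal (?c n * ?g n u)) = ennreal (\<Sum>n. ?c n * ?g n u)"
        by (rule suminf_ennreal2[OF _ sums_summable[OF s]]) (use w u G in \<open>auto intro!: mult_nonneg_nonneg divide_nonneg_nonneg\<close>)
      then show ?thesis using sums_unique[OF s] by simp
    qed
    then show "(\<Sum>n. ennreal (?c n * ?g n u) * indicator {0<..<1} u) =
       ennreal (w powr b / Gamma b * (u powr (b - 1) * exp (- (w * u))) * (1 - u) powr (b - 1 / 2)) * indicator {0<..<1} u"
      by (cases "u \<in> {0<..<1}") auto
  qed
  finally show ?thesis .
qed

section \<open>Comparison of the mass with Gamma integrals\<close>

lemma gamma_density_nn_integral:
  assumes s: "s > 0" and w: "w > (0::real)"
  shows "(\<integral>\<^sup>+u. ennreal (u powr (s - 1) * exp (- (w * u))) * indicator {0<..} u \<partial>lborel) = ennreal (Gamma s / w powr s)"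
proof -
  have "ennreal (Gamma s) = (\<integral>\<^sup>+t. ennreal (indicator {0..} t * t powr (s - 1) / exp t) \<partial>lborel)"
    by (rule Gamma_conv_nn_integral_real[OF s])
  also have "\<dots> = ennreal \<bar>w\<bar> * (\<integral>\<^sup>+u. ennreal (indicator {0..} (0 + w * u) * (0 + w * u) powr (s - 1) / exp (0 + w * u)) \<partial>lborel)"
    by (rule nn_integral_real_affine) (use w in auto)
  also have "\<dots> = (\<integral>\<^sup>+u. ennreal \<bar>w\<bar> * ennreal (indicator {0..} (0 + w * u) * (0 + w * u) powr (s - 1) / exp (0 + w * u)) \<partial>lborel)"
    by (rule nn_integral_cmult[symmetric]) measurable
  also have "\<dots> = (\<integral>\<^sup>+u. ennreal (w powr s) * (ennreal (u powr (s - 1) * exp (- (w * u))) * indicator {0<..} u) \<partial>lborel)"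
  proof (intro nn_integral_cong)
    fix u :: real
    have "ennreal w * ennreal ((w * u) powr (s - 1) / exp (w * u)) = ennreal (w powr s) * ennreal (u powr (s - 1) * exp (- (w * u)))" if "u > 0"
    proof -
      have "w * ((w * u) powr (s - 1) / exp (w * u)) = w powr s * (u powr (s - 1) * exp (- (w * u)))"
        using w that powr_add[of w 1 "s - 1"] by (simp add: powr_mult exp_minus field_simps)
      then show ?thesis using w by (simp add: ennreal_mult''[symmetric])
    qed
    then show "ennreal \<bar>w\<bar> * ennreal (indicator {0..} (0 + w * u) * (0 + w * u) powr (s - 1) / exp (0 + w * u)) =
      ennreal (w powr s) * (ennreal (u powr (s - 1) * exp (- (w * u))) * indicator {0<..} u)"
      using w by (cases "u > 0"; cases "u = 0") (auto simp: indicator_def zero_le_mult_iff)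
  qed
  also have "\<dots> = ennreal (w powr s) * (\<integral>\<^sup>+u. ennreal (u powr (s - 1) * exp (- (w * u))) * indicator {0<..} u \<partial>lborel)"
    by (rule nn_integral_cmult) measurable
  finally have *: "ennreal (Gamma s) = ennreal (w powr s) * (\<integral>\<^sup>+u. ennreal (u powr (s - 1) * exp (- (w * u))) * indicator {0<..} u \<partial>lborel)" .
  have "ennreal (1 / w powr s) * ennreal (Gamma s) = ennreal (1 / w powr s * w powr s) * (\<integral>\<^sup>+u. ennreal (u powr (s - 1) * exp (- (w * u))) * indicator {0<..} u \<partial>lborel)"
    unfolding * by (subst ennreal_mult') (auto simp: mult.assoc)
  then show ?thesis using w by (simp add: ennreal_mult''[symmetric] Gamma_real_pos s less_imp_le)
qed

lemma mass_integrand_le: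
  fixes b :: real
  assumes b: "b \<ge> 1 / 2" and u: "0 < u" "u < 1"
  shows "w powr b / Gamma b * (u powr (b - 1) * exp (- (w * u))) * (1 - u) powr (b - 1 / 2) \<le>
    w powr b / Gamma b * (u powr (b - 1) * exp (- (w * u)))"
proof -
  have "(1 - u) powr (b - 1 / 2) \<le> 1" using powr_le1[of "b - 1 / 2" "1 - u"] b u by auto
  moreover have "0 \<le> w powr b / Gamma b * (u powr (b - 1) * exp (- (w * u)))"
    using Gamma_real_pos[of b] b by auto
  ultimately show ?thesis using mult_left_le by blast
qed

text \<open>For these \<open>b\<close> the factor (1 - u)^(b - 1/2) is at most 1. Dropping it and
  extending the integral to the half-line leaves the Gamma density of shape \<open>b\<close> and
  rate \<open>w\<close>.\<close>

lemma mass_series_le_1: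
  assumes b: "b \<ge> 1 / 2" and w: "w > 0"
  shows "mass_series b w \<le> 1"
proof -
  have b0: "b > 0" using b by simp
  have G: "Gamma b > 0" using b0 by (rule Gamma_real_pos)
  have "mass_series b w \<le>
     (\<integral>\<^sup>+u. ennreal (w powr b / Gamma b) * (ennreal (u powr (b - 1) * exp (- (w * u))) * indicator {0<..} u) \<partial>lborel)"
    unfolding mass_series_integral[OF b0 w]
  proof (intro nn_integral_mono)
    fix u :: real
    show "ennreal (w powr b / Gamma b * (u powr (b - 1) * exp (- (w * u))) * (1 - u) powr (b - 1 / 2)) * indicator {0<..<1} u \<le>
      ennreal (w powr b / Gamma b) * (ennreal (u powr (b - 1) * exp (- (w * u))) * indicator {0<..} u)"
    proof (cases "u \<in> {0<..<1}")
      case True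
      then show ?thesis using mass_integrand_le[OF b, of u w] G
        by (auto simp: ennreal_mult''[symmetric] intro!: ennreal_leI)
    qed auto
  qed
  also have "\<dots> = ennreal (w powr b / Gamma b) * ennreal (Gamma b / w powr b)"
    unfolding gamma_density_nn_integral[OF b0 w, symmetric] by (rule nn_integral_cmult) measurable
  also have "\<dots> = 1" using G w by (simp add: ennreal_mult''[symmetric])
  finally show ?thesis .
qed

text \<open>Here the exponential is dropped as well, and the power u^(b - 1) integrates to 1 / b
  over the unit interval. This yields the strict inequality that excludes the Markov
  property.\<close>

lemma mass_series_small:
  assumes b: "b \<ge> 1 / 2" and w: "w > 0" "w powr b < b * Gamma b"
  shows "mass_series b w < 1"
proof -
  have b0: "b > 0" using b by simp
  have G: "Gamma b > 0" using b0 by (rule Gamma_real_pos)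
  have "((\<lambda>u. u powr (b - 1)) has_integral 1 / b) {0<..<1}"
    using has_integral_powr_from_0[of "b - 1" 1] b0 by (simp add: has_integral_Icc_iff_Ioo)
  from nn_integral_has_integral_lebesgue'[OF _ this]
  have i: "(\<integral>\<^sup>+u. ennreal (u powr (b - 1)) * indicator {0<..<1::real} u \<partial>lborel) = ennreal (1 / b)" by simp
  have "mass_series b w \<le>
     (\<integral>\<^sup>+u. ennreal (w powr b / Gamma b) * (ennreal (u powr (b - 1)) * indicator {0<..<1} u) \<partial>lborel)"
    unfolding mass_series_integral[OF b0 w(1)]
  proof (intro nn_integral_mono)
    fix u :: real
    show "ennreal (w powr b / Gamma b * (u powr (b - 1) * exp (- (w * u))) * (1 - u) powr (b - 1 / 2)) * indicator {0<..<1} u \<le>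
      ennreal (w powr b / Gamma b) * (ennreal (u powr (b - 1)) * indicator {0<..<1} u)"
    proof (cases "u \<in> {0<..<1}")
      case True
      have "w powr b / Gamma b * (u powr (b - 1) * exp (- (w * u))) \<le> w powr b / Gamma b * (u powr (b - 1) * 1)"
        using True G w by (intro mult_left_mono) auto
      then show ?thesis using mass_integrand_le[OF b, of u w] G True
        by (auto simp: ennreal_mult''[symmetric] intro!: ennreal_leI)
    qed auto
  qed
  also have "\<dots> = ennreal (w powr b / Gamma b) * ennreal (1 / b)"
    unfolding i[symmetric] by (rule nn_integral_cmult) measurable
  also have "\<dots> = ennreal (w powr b / (b * Gamma b))" using G b0 by (simp add: ennreal_mult''[symmetric] mult_ac)
  also have "\<dots> < 1" using w G b0 by (simp add: ennreal_less_one_iff)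
  finally show ?thesis .
qed

lemma gamma_density_affine:
  fixes b g v :: real
  assumes b: "b > 0" and g: "g \<ge> 0" and v: "v > 0"
  shows "(\<integral>\<^sup>+u. ennreal (w powr b / Gamma b * (u powr (b - 1) * exp (- (v * u))) * (1 + g * u)) * indicator {0<..} u \<partial>lborel) =
    ennreal (w powr b / v powr b * (1 + g * b / v))"
proof -
  have G: "Gamma b > 0" using b by (rule Gamma_real_pos)
  have "(\<integral>\<^sup>+u. ennreal (w powr b / Gamma b * (u powr (b - 1) * exp (- (v * u))) * (1 + g * u)) * indicator {0<..} u \<partial>lborel) =
    (\<integral>\<^sup>+u. ennreal (w powr b / Gamma b) * (ennreal (u powr (b - 1) * exp (- (v * u))) * indicator {0<..} u) +
      ennreal (w powr b / Gamma b * g) * (ennreal (u powr (b + 1 - 1) * exp (- (v * u))) * indicator {0<..} u) \<partial>lborel)"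
  proof (intro nn_integral_cong)
    fix u :: real
    have "w powr b / Gamma b * (u powr (b - 1) * exp (- (v * u))) * (1 + g * u) =
       w powr b / Gamma b * (u powr (b - 1) * exp (- (v * u))) + w powr b / Gamma b * g * (u powr (b + 1 - 1) * exp (- (v * u)))" if "u > 0"
      using that powr_add[of u 1 "b - 1"] by (simp add: algebra_simps add_divide_distrib)
    then show "ennreal (w powr b / Gamma b * (u powr (b - 1) * exp (- (v * u))) * (1 + g * u)) * indicator {0<..} u =
      ennreal (w powr b / Gamma b) * (ennreal (u powr (b - 1) * exp (- (v * u))) * indicator {0<..} u) +
      ennreal (w powr b / Gamma b * g) * (ennreal (u powr (b + 1 - 1) * exp (- (v * u))) * indicator {0<..} u)"
      using G g by (cases "u > 0") (auto simp: ennreal_mult''[symmetric] ennreal_plus[symmetric] simp del: ennreal_plus)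
  qed
  also have "\<dots> = ennreal (w powr b / Gamma b) * (\<integral>\<^sup>+u. ennreal (u powr (b - 1) * exp (- (v * u))) * indicator {0<..} u \<partial>lborel) +
     ennreal (w powr b / Gamma b * g) * (\<integral>\<^sup>+u. ennreal (u powr (b + 1 - 1) * exp (- (v * u))) * indicator {0<..} u \<partial>lborel)"
    by (subst nn_integral_add) (auto simp: nn_integral_cmult)
  also have "\<dots> = ennreal (w powr b / Gamma b) * ennreal (Gamma b / v powr b) + ennreal (w powr b / Gamma b * g) * ennreal (Gamma (b + 1) / v powr (b + 1))"
    using b v by (simp only: gamma_density_nn_integral)
  also have "\<dots> = ennreal (w powr b / Gamma b * (Gamma b / v powr b) + w powr b / Gamma b * g * (Gamma (b + 1) / v powr (b + 1)))"
    using G b g by (simp add: ennreal_mult''[symmetric] ennreal_plus[symmetric] Gamma_plus1_pos del: ennreal_plus)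
  also have "w powr b / Gamma b * (Gamma b / v powr b) + w powr b / Gamma b * g * (Gamma (b + 1) / v powr (b + 1)) = w powr b / v powr b * (1 + g * b / v)"
    unfolding Gamma_plus1_pos[OF b] using less_imp_neq[OF G] b v by (simp add: powr_add field_simps)
  finally show ?thesis .
qed

text \<open>The Beta integral over \<open>{0<..<1}\<close> is compared with the Gamma integral over \<open>{0<..}\<close>: the factor
  \<open>(1 - u) powr (b - 1 / 2) \<ge> 1 + g * u\<close> contributes a gain of order \<open>1 / w\<close>, which beats the
  exponentially small tail.\<close>

lemma mass_series_gt_1:
  assumes b: "0 < b" "b < 1 / 2" and w: "w > 64 / ((1 / 2 - b) * b)"
  shows "1 < mass_series b w" (is "1 < ?S")
proof -
  define g where "g = 1 / 2 - b"
  have g: "g > 0" "g < 1 / 2" using b by (auto simp: g_def)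
  have gb: "0 < g * b" "g * b \<le> 1 / 4" using g b mult_mono[of g "1 / 2" b "1 / 2"] by auto
  have wgb: "64 < w * (g * b)" using w gb unfolding g_def by (simp add: pos_divide_less_eq)
  have "w > 0" using wgb gb(1) by (smt (verit) mult_nonpos_nonneg)
  moreover have "w * (g * b) \<le> w * (1 / 4)" using gb \<open>w > 0\<close> by (intro mult_left_mono) auto
  ultimately have w1: "w > 1" using wgb by linarith
  have G: "Gamma b > 0" using b by (intro Gamma_real_pos)
  let ?F = "\<lambda>v u. w powr b / Gamma b * (u powr (b - 1) * exp (- (v * u))) * (1 + g * u)"
  let ?H = "\<lambda>u. w powr b / Gamma b * (u powr (b - 1) * exp (- (w * u))) * (1 - u) powr (b - 1 / 2)"
  have F0: "?F v u \<ge> 0" if "u > 0" for v u using that g G by (auto intro!: mult_nonneg_nonneg)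
  \<comment> \<open>On the unit interval the Gamma integrand is below the Beta integrand. Beyond 1
    half of the rate is traded for the small factor exp(- w / 2), with a Gamma integrand of rate w /
    2 left over.\<close>
  have pw: "ennreal (?F w u) * indicator {0<..} u \<le> ennreal (?H u) * indicator {0<..<1} u + ennreal (exp (- (w / 2))) * (ennreal (?F (w / 2) u) * indicator {0<..} u)" for u
  proof (cases "u > 0")
    case u: True
    show ?thesis
    proof (cases "u < 1")
      case True
      \<comment> \<open>Two standard inequalities, ln(1 - u) \<le> - u and 1 + s \<le> exp s, give
        (1 - u)^(-g) \<ge> 1 + g u.\<close>
      have "ln (1 - u) \<le> - u" using ln_le_minus_one[of "1 - u"] True by simp
      then have "g * u \<le> - (g * ln (1 - u))" using g mult_left_mono[of "ln (1 - u)" "- u" g] by simp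
      then have "1 + g * u \<le> exp (- (g * ln (1 - u)))" using exp_ge_add_one_self[of "- (g * ln (1 - u))"] by linarith
      also have "\<dots> = (1 - u) powr (b - 1 / 2)" using True by (simp add: powr_def g_def algebra_simps)
      finally have "?F w u \<le> ?H u" using G by (intro mult_left_mono) auto
      then have "ennreal (?F w u) \<le> ennreal (?H u)" by (rule ennreal_leI)
      then show ?thesis using u True by (simp add: add_increasing2)
    next
      case False
      then have "w / 2 \<le> w / 2 * u" using w1 by simp
      then have "exp (- (w * u)) \<le> exp (- (w / 2)) * exp (- (w / 2 * u))"
        by (simp add: mult_exp_exp)
      then have "?F w u \<le> w powr b / Gamma b * (u powr (b - 1) * (exp (- (w / 2)) * exp (- (w / 2 * u)))) * (1 + g * u)"
        using G g u by (intro mult_right_mono mult_left_mono) auto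
      also have "\<dots> = exp (- (w / 2)) * ?F (w / 2) u" by (simp add: mult_ac)
      finally have "ennreal (?F w u) \<le> ennreal (exp (- (w / 2))) * ennreal (?F (w / 2) u)"
        by (subst ennreal_mult'[symmetric]) (auto intro: ennreal_leI)
      then show ?thesis using u False by simp
    qed
  qed auto
  have "ennreal (1 + g * b / w) = (\<integral>\<^sup>+u. ennreal (?F w u) * indicator {0<..} u \<partial>lborel)"
    using gamma_density_affine[of b g w w] b g w1 by simp
  also have "\<dots> \<le> (\<integral>\<^sup>+u. ennreal (?H u) * indicator {0<..<1} u + ennreal (exp (- (w / 2))) * (ennreal (?F (w / 2) u) * indicator {0<..} u) \<partial>lborel)"
    by (intro nn_integral_mono pw)
  also have "\<dots> = (\<integral>\<^sup>+u. ennreal (?H u) * indicator {0<..<1} u \<partial>lborel) + ennreal (exp (- (w / 2))) * (\<integral>\<^sup>+u. ennreal (?F (w / 2) u) * indicator {0<..} u \<partial>lborel)"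
    by (subst nn_integral_add) (auto simp: nn_integral_cmult)
  also have "\<dots> = ?S + ennreal (exp (- (w / 2)) * (w powr b / (w / 2) powr b * (1 + g * b / (w / 2))))"
  proof -
    have 1: "(\<integral>\<^sup>+u. ennreal (?H u) * indicator {0<..<1} u \<partial>lborel) = ?S"
      by (rule mass_series_integral[symmetric]) (use b w1 in auto)
    have 2: "(\<integral>\<^sup>+u. ennreal (?F (w / 2) u) * indicator {0<..} u \<partial>lborel) = ennreal (w powr b / (w / 2) powr b * (1 + g * b / (w / 2)))"
      by (rule gamma_density_affine) (use b g w1 in auto)
    show ?thesis unfolding 1 2 ennreal_mult'[OF exp_ge_zero] ..
  qed
  also have "w powr b / (w / 2) powr b = 2 powr b" using w1 by (simp add: powr_divide)
  finally have le: "ennreal (1 + g * b / w) \<le> ?S + ennreal (exp (- (w / 2)) * (2 powr b * (1 + g * b / (w / 2))))" .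
  \<comment> \<open>Here the 64 of the hypothesis originates: the tail is at most 4 exp(- w / 2),
    and exp(w / 2) \<ge> (w / 4)^2, so it is at most 64 / w^2. This is below the gain g b / w
    exactly when w g b > 64.\<close>
  have "exp (- (w / 2)) * (2 powr b * (1 + g * b / (w / 2))) < g * b / w"
  proof -
    have "2 powr b \<le> 2 powr 1" using b by (intro powr_mono) auto
    moreover have "g * b / (w / 2) \<le> 1" using gb w1 by (simp add: field_simps)
    ultimately have "2 powr b * (1 + g * b / (w / 2)) \<le> 2 * 2" using gb w1 by (intro mult_mono) auto
    moreover have "(w / 4) * (w / 4) \<le> exp (w / 4) * exp (w / 4)"
    proof -
      have "w / 4 \<le> exp (w / 4)" using exp_ge_add_one_self[of "w / 4"] by linarith
      then show ?thesis using w1 by (intro mult_mono) auto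
    qed
    then have "(w / 4) * (w / 4) \<le> exp (w / 2)" by (simp add: mult_exp_exp)
    then have "exp (- (w / 2)) \<le> 1 / ((w / 4) * (w / 4))"
      unfolding exp_minus inverse_eq_divide using w1 by (intro divide_left_mono) auto
    ultimately have "exp (- (w / 2)) * (2 powr b * (1 + g * b / (w / 2))) \<le> 1 / ((w / 4) * (w / 4)) * 4"
      using gb w1 by (intro mult_mono) auto
    also have "\<dots> < g * b / w" using wgb w1 by (simp add: field_simps)
    finally show ?thesis .
  qed
  moreover define T where "T = exp (- (w / 2)) * (2 powr b * (1 + g * b / (w / 2)))"
  ultimately have T: "T < g * b / w" "T \<ge> 0" using gb w1 by auto
  show ?thesis
  proof (rule ccontr)
    assume "\<not> 1 < ?S"
    then have "?S + ennreal T \<le> 1 + ennreal T" by (intro add_right_mono) simp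
    also have "\<dots> = ennreal (1 + T)" using T by simp
    finally have "ennreal (1 + g * b / w) \<le> ennreal (1 + T)" using le unfolding T_def by (rule order_trans[rotated])
    then show False using T by (subst (asm) ennreal_le_iff) auto
  qed
qed

section \<open>Approximation by continuous functions\<close>

text \<open>For 0 < a \<le> b a trapezoid: it rises on [a/2, a], equals 1 on [a, b] and falls to 0
  on [b, 2 b].\<close>

definition cutoff :: "real \<Rightarrow> real \<Rightarrow> real \<Rightarrow> real" where
  "cutoff a b x = max 0 (min 1 (min (2 * x / a - 1) (2 - x / b)))"

lemma cutoff_continuous [continuous_intros]: "continuous_on UNIV (cutoff a b)"
  unfolding cutoff_def by (cases "a = 0"; cases "b = 0") (auto intro!: continuous_intros)

lemma cutoff_bounds: "0 \<le> cutoff a b x" "cutoff a b x \<le> 1"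
  by (auto simp: cutoff_def)

lemma cutoff_eq_1: "0 < a \<Longrightarrow> a \<le> x \<Longrightarrow> x \<le> b \<Longrightarrow> cutoff a b x = 1"
  by (auto simp: cutoff_def field_simps)

lemma cutoff_eq_0:
  assumes "0 < a" "a \<le> b" "x \<notin> {a / 2..2 * b}"
  shows "cutoff a b x = 0"
proof -
  have "2 * x / a - 1 < 0 \<or> 2 - x / b < 0" using assms by (auto simp: field_simps)
  then show ?thesis by (auto simp: cutoff_def)
qed

text \<open>The support is kept away from 0, so that these functions may be divided by
  y^(\<open>\<alpha>\<close> + 1/2), which vanishes at 0 for \<open>\<alpha>\<close> > -
  1/2.\<close>

definition L2_nice :: "(real \<Rightarrow> complex) \<Rightarrow> bool" where
  "L2_nice g \<longleftrightarrow> continuous_on UNIV g \<and> (\<exists>a b. 0 < a \<and> a < b \<and> (\<forall>x. x \<notin> {a..b} \<longrightarrow> g x = 0))"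

lemma sigma_finite_halfline: "sigma_finite_measure halfline"
  by (rule sigma_finite_measure_restrict_space) (auto intro: lborel.sigma_finite_measure_axioms)

lemma sq_norm_halfline:
  "f \<in> borel_measurable borel \<Longrightarrow> sq_norm halfline f \<le> (\<integral>\<^sup>+x. ennreal ((norm (f x))\<^sup>2) \<partial>lborel)"
  unfolding sq_norm_def
  by (subst nn_integral_restrict_space) (auto intro!: nn_integral_mono simp: indicator_def)

text \<open>The offset 2 makes every interval nondegenerate, including the first one: 1 / (n + 2) <
  n + 2, as the definition of compact support demands.\<close>

lemma eventually_in_exhaustion:
  assumes y: "y > (0::real)"
  shows "\<forall>\<^sub>F n in sequentially. y \<in> {1 / real (n + 2)..real (n + 2)}"
proof -
  obtain N :: nat where "max y (1 / y) \<le> real N" using real_arch_simple by blast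
  then have N: "y \<le> real N" "1 / y \<le> real N" by auto
  show ?thesis
  proof (rule eventually_sequentiallyI[of N])
    fix n assume "N \<le> n"
    then have "real N \<le> real (n + 2)" by simp
    then have "1 / y \<le> real (n + 2)" "y \<le> real (n + 2)" using N by linarith+
    moreover from this have "1 / real (n + 2) \<le> y" using y by (simp add: field_simps)
    ultimately show "y \<in> {1 / real (n + 2)..real (n + 2)}" by simp
  qed
qed

lemma truncate_L2:
  assumes f: "f \<in> Lp 2 halfline"
  shows "(\<lambda>n. sq_norm halfline (\<lambda>x. (if norm (f x) \<le> real n \<and> x \<in> {1 / real n..real n} then f x else 0) - f x)) \<longlonglongrightarrow> 0"
proof -
  have [measurable]: "f \<in> borel_measurable halfline" using f by (simp add: in_L2_iff)
  have [measurable]: "(\<lambda>x. x) \<in> borel_measurable halfline" by (rule halfline_borel) simp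
  let ?f = "\<lambda>n x. if norm (f x) \<le> real n \<and> x \<in> {1 / real n..real n} then f x else 0"
  have "(\<lambda>n. (\<integral>\<^sup>+x. ennreal ((norm (?f n x - f x))\<^sup>2) \<partial>halfline)) \<longlonglongrightarrow> (\<integral>\<^sup>+x. 0 \<partial>halfline)"
  proof (rule nn_integral_dominated_convergence[where w = "\<lambda>x. ennreal ((norm (f x))\<^sup>2)"])
    show "(\<integral>\<^sup>+x. ennreal ((norm (f x))\<^sup>2) \<partial>halfline) < \<infinity>" using f by (simp add: in_L2_iff sq_norm_def)
    show "AE x in halfline. (\<lambda>n. ennreal ((norm (?f n x - f x))\<^sup>2)) \<longlonglongrightarrow> 0"
    proof (rule AE_I2)
      fix x assume x: "x \<in> space halfline"
      obtain N :: nat where "max (norm (f x)) (max x (1 / x)) \<le> real N" using real_arch_simple by blast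
      then have N: "real N \<ge> norm (f x)" "real N \<ge> x" "real N \<ge> 1 / x" by auto
      have "\<forall>\<^sub>F n in sequentially. ennreal ((norm (?f n x - f x))\<^sup>2) = 0"
      proof (rule eventually_sequentiallyI[of "max 1 N"])
        fix n assume n: "max 1 N \<le> n"
        then have "real n \<ge> real N" "real n > 0" by auto
        then have "norm (f x) \<le> real n" "x \<le> real n" "1 / x \<le> real n" using N by linarith+
        moreover have "1 / real n \<le> x" using \<open>1 / x \<le> real n\<close> \<open>real n > 0\<close> x by (simp add: field_simps)
        ultimately show "ennreal ((norm (?f n x - f x))\<^sup>2) = 0" by simp
      qed
      then show "(\<lambda>n. ennreal ((norm (?f n x - f x))\<^sup>2)) \<longlonglongrightarrow> 0" by (rule tendsto_eventually)
    qed
  qed (auto intro!: ennreal_leI)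
  then show ?thesis by (simp add: sq_norm_def)
qed

text \<open>A measurable function is an almost everywhere limit of continuous ones. These have no
  common majorant, so they are first forced into the ball of radius \<open>K\<close> and into a
  fixed compact set; dominated convergence then applies.\<close>

lemma L2_nice_approx_bounded:
  assumes f: "f \<in> borel_measurable halfline" and N: "0 < a" "a < b" "0 < K"
    and supp: "\<And>x. x \<notin> {a..b} \<Longrightarrow> f x = 0" and bd: "\<And>x. norm (f x) \<le> K"
  obtains G where "\<And>n::nat. L2_nice (G n)" "(\<lambda>n. sq_norm halfline (\<lambda>x. G n x - f x)) \<longlonglongrightarrow> 0"
proof -
  have "(\<lambda>x. indicator {0<..} x *\<^sub>R f x) \<in> borel_measurable lborel"
    using f by (subst (asm) borel_measurable_restrict_space_iff) auto
  moreover have "(\<lambda>x. indicator {0<..} x *\<^sub>R f x) = f" using supp N by (auto simp: indicator_def)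
  ultimately have fb: "f \<in> borel_measurable borel" by simp
  then have "f \<in> borel_measurable lebesgue" using measurable_completion by (metis measurable_lborel2)
  then have "f measurable_on UNIV" by (intro lebesgue_measurable_imp_measurable_on) auto
  then obtain Z g where Z: "negligible Z" and g: "\<And>n::nat. continuous_on UNIV (g n)"
    and lim: "\<And>x. x \<notin> Z \<Longrightarrow> (\<lambda>n. g n x) \<longlonglongrightarrow> f x"
    by (auto simp: measurable_on_def)
  \<comment> \<open>The scalar K / max K |z| projects radially onto the ball of radius
    \<open>K\<close>. Projection and cutoff are continuous and both fix the limit
    \<open>f\<close>.\<close>
  define G where "G = (\<lambda>n x. cutoff a b x *\<^sub>R (K / max K (norm (g n x))) *\<^sub>R g n x)"
  have cG: "continuous_on UNIV (G n)" for n
    unfolding G_def by (intro continuous_intros g) (use N in \<open>auto simp: max_def\<close>)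
  have G0: "G n x = 0" if "x \<notin> {a / 2..2 * b}" for n x
    unfolding G_def using cutoff_eq_0[of a b x] N that by simp
  have nice: "L2_nice (G n)" for n
    unfolding L2_nice_def using N G0 cG by (intro conjI exI[of _ "a / 2"] exI[of _ "2 * b"]) auto
  have GK: "norm (G n x) \<le> K" for n x
  proof -
    have "norm (G n x) = cutoff a b x * (K / max K (norm (g n x)) * norm (g n x))"
      unfolding G_def using N cutoff_bounds[of a b x] by (simp add: max_def)
    also have "\<dots> \<le> 1 * K" using N cutoff_bounds[of a b x]
      by (intro mult_mono) (auto simp: max_def field_simps)
    finally show ?thesis by simp
  qed
  have Glim: "(\<lambda>n. G n x) \<longlonglongrightarrow> f x" if x: "x \<notin> Z" for x
  proof -
    have "(\<lambda>n. G n x) \<longlonglongrightarrow> cutoff a b x *\<^sub>R (K / max K (norm (f x))) *\<^sub>R f x"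
      unfolding G_def by (intro tendsto_intros lim x) (use N in \<open>auto simp: max_def\<close>)
    moreover have "max K (norm (f x)) = K" using bd[of x] by simp
    moreover have "cutoff a b x *\<^sub>R f x = f x"
      using supp[of x] cutoff_eq_1[of a x b] N by (cases "x \<in> {a..b}") auto
    ultimately show ?thesis using N by simp
  qed
  have [measurable]: "G n \<in> borel_measurable borel" for n
    by (rule borel_measurable_continuous_onI[OF cG])
  note [measurable] = fb
  have "(\<lambda>n. (\<integral>\<^sup>+x. ennreal ((norm (G n x - f x))\<^sup>2) \<partial>lborel)) \<longlonglongrightarrow> (\<integral>\<^sup>+x. 0 \<partial>(lborel :: real measure))"
  proof (rule nn_integral_dominated_convergence[where w = "\<lambda>x. ennreal ((2 * K)\<^sup>2) * indicator {a / 2..2 * b} x"])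
    show "(\<integral>\<^sup>+x. ennreal ((2 * K)\<^sup>2) * indicator {a / 2..2 * b} x \<partial>lborel) < \<infinity>"
      by (subst nn_integral_cmult_indicator) (auto simp: ennreal_mult_less_top emeasure_lborel_Icc_eq)
    show "AE x in lborel. ennreal ((norm (G n x - f x))\<^sup>2) \<le> ennreal ((2 * K)\<^sup>2) * indicator {a / 2..2 * b} x" for n
    proof (rule AE_I2)
      fix x
      have "norm (G n x - f x) \<le> 2 * K" using norm_triangle_ineq4[of "G n x" "f x"] GK[of n x] bd[of x] by linarith
      then have "(norm (G n x - f x))\<^sup>2 \<le> (2 * K)\<^sup>2" by (intro power_mono) auto
      then show "ennreal ((norm (G n x - f x))\<^sup>2) \<le> ennreal ((2 * K)\<^sup>2) * indicator {a / 2..2 * b} x"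
        using G0[of x n] supp[of x] N by (cases "x \<in> {a / 2..2 * b}") (auto intro: ennreal_leI)
    qed
    have "AE x in lebesgue. x \<notin> Z" using Z by (metis AE_not_in negligible_iff_null_sets)
    then have "AE x in lebesgue. (\<lambda>n. ennreal ((norm (G n x - f x))\<^sup>2)) \<longlonglongrightarrow> 0"
    proof eventually_elim
      case (elim x)
      from Glim[OF elim] have "(\<lambda>n. ennreal ((norm (G n x - f x))\<^sup>2)) \<longlonglongrightarrow> ennreal ((norm (f x - f x))\<^sup>2)"
        by (intro tendsto_ennrealI tendsto_intros)
      then show ?case by simp
    qed
    then show "AE x in lborel. (\<lambda>n. ennreal ((norm (G n x - f x))\<^sup>2)) \<longlonglongrightarrow> 0"
      by (simp add: AE_completion_iff)
  qed measurable
  then have "(\<lambda>n. (\<integral>\<^sup>+x. ennreal ((norm (G n x - f x))\<^sup>2) \<partial>lborel)) \<longlonglongrightarrow> 0" by simp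
  from tendsto_sandwich[OF _ _ tendsto_const this, of "\<lambda>n. sq_norm halfline (\<lambda>x. G n x - f x)"]
  have "(\<lambda>n. sq_norm halfline (\<lambda>x. G n x - f x)) \<longlonglongrightarrow> 0"
    by (simp add: sq_norm_halfline)
  then show ?thesis using that nice by blast
qed

lemma L2_nice_measurable: "L2_nice g \<Longrightarrow> g \<in> borel_measurable halfline"
  by (auto simp: L2_nice_def intro!: halfline_borel borel_measurable_continuous_onI)

lemma L2_nice_bounded:
  assumes "L2_nice g"
  obtains K a b where "K > 0" "0 < a" "a < b" "\<And>x. norm (g x) \<le> K" "\<And>x. x \<notin> {a..b} \<Longrightarrow> g x = 0"
proof -
  obtain a b where ab: "0 < a" "a < b" "\<And>x. x \<notin> {a..b} \<Longrightarrow> g x = 0" and c: "continuous_on UNIV g"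
    using assms by (auto simp: L2_nice_def)
  have "bounded (g ` {a..b})" by (intro compact_imp_bounded compact_continuous_image continuous_on_subset[OF c]) auto
  then obtain K where K: "K > 0" "\<And>x. x \<in> {a..b} \<Longrightarrow> norm (g x) \<le> K" by (auto simp: bounded_pos)
  have "norm (g x) \<le> K" for x using K ab(3)[of x] by (cases "x \<in> {a..b}") auto
  then show ?thesis using that K(1) ab by blast
qed

lemma L2_bounded_support:
  assumes "g \<in> borel_measurable halfline" "\<And>x. norm (g x) \<le> K" "\<And>x. x \<notin> {a..b} \<Longrightarrow> g x = 0"
  shows "g \<in> Lp 2 halfline"
proof -
  have K: "K \<ge> 0" using assms(2)[of 0] norm_ge_zero[of "g 0"] by linarith
  have "sq_norm halfline g \<le> (\<integral>\<^sup>+x. ennreal (K\<^sup>2) * indicator {a..b} x \<partial>halfline)"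
    unfolding sq_norm_def
  proof (intro nn_integral_mono)
    fix x
    have "(norm (g x))\<^sup>2 \<le> K\<^sup>2" using assms(2) by (intro power_mono) auto
    then show "ennreal ((norm (g x))\<^sup>2) \<le> ennreal (K\<^sup>2) * indicator {a..b} x"
      using assms(3)[of x] by (cases "x \<in> {a..b}") (auto intro: ennreal_leI)
  qed
  also have "\<dots> \<le> (\<integral>\<^sup>+x. ennreal (K\<^sup>2) * indicator {a..b} x \<partial>lborel)"
    by (subst nn_integral_restrict_space) (auto intro!: nn_integral_mono simp: indicator_def)
  also have "\<dots> < \<infinity>" by (subst nn_integral_cmult_indicator) (auto simp: ennreal_mult_less_top emeasure_lborel_Icc_eq)
  finally show ?thesis using assms(1) by (simp add: in_L2_iff)
qed

lemma L2_nice_in_L2: "L2_nice g \<Longrightarrow> g \<in> Lp 2 halfline"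
  by (metis L2_nice_bounded L2_bounded_support L2_nice_measurable)

lemma L2_nice_dense:
  assumes f: "f \<in> Lp 2 halfline" and e: "e > 0"
  obtains g where "L2_nice g" "sq_norm halfline (\<lambda>x. g x - f x) \<le> ennreal e"
proof -
  have fm[measurable]: "f \<in> borel_measurable halfline" using f by (simp add: in_L2_iff)
  have [measurable]: "(\<lambda>x. x) \<in> borel_measurable halfline" by (rule halfline_borel) simp
  let ?f = "\<lambda>n x. if norm (f x) \<le> real n \<and> x \<in> {1 / real n..real n} then f x else 0"
  have "\<forall>\<^sub>F n in sequentially. sq_norm halfline (\<lambda>x. ?f n x - f x) < ennreal (e / 4)"
    using order_tendstoD(2)[OF truncate_L2[OF f]] e by simp
  then obtain N where N: "\<And>n. n \<ge> N \<Longrightarrow> sq_norm halfline (\<lambda>x. ?f n x - f x) < ennreal (e / 4)"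
    unfolding eventually_sequentially by blast
  \<comment> \<open>At least 2, so that 1 / n < n and the truncated function lives on a proper
    interval.\<close>
  define n where "n = max 2 N"
  have n: "n \<ge> 2" "sq_norm halfline (\<lambda>x. ?f n x - f x) < ennreal (e / 4)"
    using N[of n] by (auto simp: n_def)
  have "2 * 2 \<le> real n * real n" using n(1) by (intro mult_mono) auto
  then have "1 / real n < real n" using n by (simp add: divide_less_eq)
  then obtain G where G: "\<And>m::nat. L2_nice (G m)" "(\<lambda>m. sq_norm halfline (\<lambda>x. G m x - ?f n x)) \<longlonglongrightarrow> 0"
    using n by (elim L2_nice_approx_bounded[of "?f n" "1 / real n" "real n" "real n", rotated 6]) auto
  have "\<forall>\<^sub>F m in sequentially. sq_norm halfline (\<lambda>x. G m x - ?f n x) < ennreal (e / 4)"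
    using order_tendstoD(2)[OF G(2)] e by simp
  then obtain m where m: "sq_norm halfline (\<lambda>x. G m x - ?f n x) < ennreal (e / 4)"
    unfolding eventually_sequentially by auto
  have [measurable]: "G m \<in> borel_measurable halfline" using G(1) by (rule L2_nice_measurable)
  have "sq_norm halfline (\<lambda>x. G m x - f x) \<le> 2 * sq_norm halfline (\<lambda>x. G m x - ?f n x) + 2 * sq_norm halfline (\<lambda>x. ?f n x - f x)"
    by (rule sq_norm_diff_triangle) measurable
  also have "\<dots> \<le> 2 * ennreal (e / 4) + 2 * ennreal (e / 4)"
    using m n by (intro add_mono mult_left_mono) auto
  also have "\<dots> = ennreal e"
  proof -
    have "2 * ennreal (e / 4) = ennreal (e / 2)" using e by (simp add: ennreal_mult'[symmetric] ennreal_numeral[symmetric] del: ennreal_numeral)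
    then show ?thesis using e by (simp add: ennreal_plus[symmetric] del: ennreal_plus)
  qed
  finally show ?thesis using that G(1) by blast
qed

section \<open>Strong continuity of the kernel operators\<close>

text \<open>The constant in Schur's test: the sharp value 1 where contractivity is claimed, and
  otherwise the crude value of \<open>mass_series_bound\<close>.\<close>

definition mass_bound :: "real \<Rightarrow> real" where
  "mass_bound \<alpha> = (if \<alpha> = - 1 / 2 \<or> 1 / 2 \<le> \<alpha> then 1 else 6)"

text \<open>The case b = 0: all coefficients are 1 and the Poisson weights sum to 1. The kernel is
  the heat kernel with reflection at 0, which conserves mass.\<close>

lemma bessel_kernel_mass_half:
  assumes x: "x > 0" and t: "t > 0"
  shows "(\<integral>\<^sup>+y. ennreal (bessel_kernel (- 1 / 2) t x y) \<partial>halfline) = 1"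
proof -
  define w where "w = x\<^sup>2 / (4 * t)"
  have w: "w > 0" using x t by (simp add: w_def)
  have c: "w powr 0 * mass_coeff 0 n = 1" for n
    using Gamma_real_neq_0[of "real n + 1 / 2"] w by (simp add: mass_coeff_def)
  have "(\<integral>\<^sup>+y. ennreal (bessel_kernel (- 1 / 2) t x y) \<partial>halfline) = mass_series 0 w"
    by (rule bessel_kernel_mass) (use x t in \<open>auto simp: w_def\<close>)
  then show ?thesis unfolding mass_series_def c mult_1_right poisson_suminf[OF less_imp_le[OF w]] .
qed

lemma bessel_kernel_mass_le:
  assumes \<alpha>: "- 1 / 2 \<le> \<alpha>" and x: "x > 0" and t: "t > 0"
  shows "(\<integral>\<^sup>+y. ennreal (bessel_kernel \<alpha> t x y) \<partial>halfline) \<le> ennreal (mass_bound \<alpha>)"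
proof -
  define b where "b = \<alpha> / 2 + 1 / 4"
  have b: "b \<ge> 0" "\<alpha> = 2 * b - 1 / 2" using \<alpha> by (auto simp: b_def)
  have w: "x\<^sup>2 / (4 * t) > 0" using x t by simp
  note m = bessel_kernel_mass[OF b(2,1) x t refl]
  consider "\<alpha> = - 1 / 2" | "\<alpha> \<ge> 1 / 2" | "\<alpha> \<noteq> - 1 / 2" "\<alpha> < 1 / 2" by linarith
  then show ?thesis
  proof cases
    case 1
    then show ?thesis using bessel_kernel_mass_half[OF x t] by (simp add: mass_bound_def)
  next
    case 2
    then have "b \<ge> 1 / 2" by (simp add: b_def)
    from mass_series_le_1[OF this w] show ?thesis using 2 unfolding m by (simp add: mass_bound_def)
  next
    case 3
    then have "b \<le> 1" by (simp add: b_def)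
    from mass_series_bound[OF b(1) this w] show ?thesis using 3 unfolding m by (simp add: mass_bound_def)
  qed
qed

lemma halfline_id_measurable: "(\<lambda>x. x) \<in> borel_measurable halfline"
  by (rule halfline_borel) simp

lemma halfline_pair_measurable [measurable]:
  "fst \<in> borel_measurable (halfline \<Otimes>\<^sub>M halfline)" "snd \<in> borel_measurable (halfline \<Otimes>\<^sub>M halfline)"
  using measurable_compose[OF measurable_fst halfline_id_measurable, of halfline]
    measurable_compose[OF measurable_snd halfline_id_measurable, of halfline] by (simp_all add: eta_contract_eq)

lemma schur_kernel_bessel:
  assumes \<alpha>: "- 1 / 2 \<le> \<alpha>" and t: "t > 0"
  shows "schur_kernel halfline (bessel_kernel \<alpha> t) (mass_bound \<alpha>)"
proof -
  interpret sigma_finite_measure halfline by (rule sigma_finite_halfline)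
  show ?thesis
  proof
    show "case_prod (bessel_kernel \<alpha> t) \<in> borel_measurable (halfline \<Otimes>\<^sub>M halfline)"
      unfolding case_prod_beta' by measurable
    show "0 \<le> bessel_kernel \<alpha> t x y" if "x \<in> space halfline" "y \<in> space halfline" for x y
      using bessel_kernel_pos[of \<alpha> x y t] \<alpha> t that by simp
    show "mass_bound \<alpha> > 0" by (simp add: mass_bound_def)
  qed (use \<alpha> t in \<open>auto simp: bessel_kernel_commute intro: bessel_kernel_mass_le\<close>)
qed

definition bessel_op :: "real \<Rightarrow> real \<Rightarrow> (real \<Rightarrow> complex) \<Rightarrow> real \<Rightarrow> complex" where
  "bessel_op \<alpha> t f x = (LINT y|halfline. bessel_kernel \<alpha> t x y *\<^sub>R f y)"

lemma bessel_op_eq: 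
  assumes "- 1 / 2 \<le> \<alpha>" "t > 0"
  shows "schur_kernel.op halfline (bessel_kernel \<alpha> t) = bessel_op \<alpha> t"
  using schur_kernel.op_def[OF schur_kernel_bessel[OF assms]] by (auto simp: bessel_op_def fun_eq_iff)

lemma bessel_op_semigroup:
  assumes \<alpha>: "- 1 / 2 \<le> \<alpha>" and s: "s > 0" and t: "t > 0" and f: "f \<in> L1_plus_Linf halfline"
  shows "AE x in halfline. bessel_op \<alpha> s (bessel_op \<alpha> t f) x = bessel_op \<alpha> (s + t) f x"
proof -
  have st: "s + t > 0" using s t by simp
  have "AE x in halfline. schur_kernel.op halfline (bessel_kernel \<alpha> s) (schur_kernel.op halfline (bessel_kernel \<alpha> t) f) x =
      schur_kernel.op halfline (bessel_kernel \<alpha> (s + t)) f x"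
    by (rule schur_kernel_compose[OF schur_kernel_bessel[OF \<alpha> s] schur_kernel_bessel[OF \<alpha> t] schur_kernel_bessel[OF \<alpha> st] _ f])
      (use \<alpha> s t in \<open>auto intro: bessel_kernel_semigroup\<close>)
  then show ?thesis using assms st by (simp add: bessel_op_eq)
qed

lemma one_le_2_ennreal: "(1::ennreal) \<le> 2"
  by (rule one_le_numeral)

lemma L2_subset_L1_plus_Linf: "f \<in> Lp 2 M \<Longrightarrow> f \<in> L1_plus_Linf M"
  using Lp_subset_L1_plus_Linf[OF one_le_2_ennreal] by blast

lemma sq_norm_bessel_op_diff:
  assumes \<alpha>: "- 1 / 2 \<le> \<alpha>" and t: "t > 0" and f: "f \<in> Lp 2 halfline" and g: "g \<in> Lp 2 halfline"
  shows "sq_norm halfline (\<lambda>x. bessel_op \<alpha> t f x - bessel_op \<alpha> t g x) \<le> ennreal ((mass_bound \<alpha>)\<^sup>2) * sq_norm halfline (\<lambda>x. f x - g x)"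
proof -
  interpret S: schur_kernel halfline "bessel_kernel \<alpha> t" "mass_bound \<alpha>" by (rule schur_kernel_bessel[OF \<alpha> t])
  note oe = bessel_op_eq[OF \<alpha> t]
  have "AE x in halfline. S.op (\<lambda>y. 1 * f y + (-1) * g y) x = 1 * S.op f x + (-1) * S.op g x"
    by (intro S.op_linear_AE L2_subset_L1_plus_Linf f g)
  then have "AE x in halfline. bessel_op \<alpha> t f x - bessel_op \<alpha> t g x = bessel_op \<alpha> t (\<lambda>x. f x - g x) x"
    unfolding oe by eventually_elim simp
  then have "sq_norm halfline (\<lambda>x. bessel_op \<alpha> t f x - bessel_op \<alpha> t g x) = sq_norm halfline (bessel_op \<alpha> t (\<lambda>x. f x - g x))"
    by (rule sq_norm_cong_AE)
  moreover have "(\<lambda>x. f x - g x) \<in> borel_measurable halfline" using L2_diff[OF f g] by (simp add: in_L2_iff)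
  ultimately show ?thesis using S.sq_norm_op_le by (simp add: oe)
qed

text \<open>The kernel \<open>bessel_kernel \<alpha> t x y * h y / h x\<close> with \<open>h y = y powr (\<alpha> + 1 / 2)\<close> is a probability
  density in \<open>y\<close> (the Bessel process), whose second moment of \<open>y\<^sup>2 - x\<^sup>2\<close> vanishes as \<open>t\<close> tends
  to 0; Chebyshev's inequality then yields the pointwise convergence.\<close>

lemma bessel_kernel_variance:
  assumes a: "\<alpha> > - 1" and x: "x > 0" and t: "t > 0"
  shows "has_bochner_integral halfline (\<lambda>y. bessel_kernel \<alpha> t x y * y powr (\<alpha> + 1 / 2) * (y\<^sup>2 - x\<^sup>2)\<^sup>2)
     (x powr (\<alpha> + 1 / 2) * (8 * t * x\<^sup>2 + 16 * t\<^sup>2 * (\<alpha> + 1) * (\<alpha> + 2)))"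
proof -
  let ?w = "x\<^sup>2 / (4 * t)"
  have G1: "Gamma (\<alpha> + 2) = (\<alpha> + 1) * Gamma (\<alpha> + 1)" "Gamma (\<alpha> + 3) = (\<alpha> + 2) * Gamma (\<alpha> + 2)"
    using Gamma_plus1_pos[of "\<alpha> + 1"] Gamma_plus1_pos[of "\<alpha> + 2"] a by (simp_all add: add_ac)
  have G0: "Gamma (\<alpha> + 1) \<noteq> 0" "Gamma (\<alpha> + 2) \<noteq> 0" "Gamma (\<alpha> + 3) \<noteq> 0"
    by (rule Gamma_real_neq_0, use a in simp)+
  have P0: "bessel_poly \<alpha> 0 w = 1" for w using G0 by (simp add: bessel_poly_def)
  have P1: "bessel_poly \<alpha> 1 w = \<alpha> + 1 + w" for w
    using G0 G1 by (simp add: bessel_poly_def numeral_eq_Suc add_ac)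
  have P2: "bessel_poly \<alpha> 2 w = (\<alpha> + 2) * (\<alpha> + 1) + 2 * (\<alpha> + 2) * w + w\<^sup>2" for w
  proof -
    have "bessel_poly \<alpha> 2 w = Gamma (\<alpha> + 3) / Gamma (\<alpha> + 1) + 2 * (Gamma (\<alpha> + 3) / Gamma (\<alpha> + 2)) * w + Gamma (\<alpha> + 3) / Gamma (\<alpha> + 3) * w\<^sup>2"
      by (simp add: bessel_poly_def numeral_2_eq_2 numeral_3_eq_3 add_ac)
    also have "Gamma (\<alpha> + 3) / Gamma (\<alpha> + 1) = (\<alpha> + 2) * (\<alpha> + 1)" using G0(1) unfolding G1 by simp
    also have "Gamma (\<alpha> + 3) / Gamma (\<alpha> + 2) = \<alpha> + 2" using G0(2) unfolding G1(2) by simp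
    finally show ?thesis using G0 by simp
  qed
  note mom = bessel_kernel_moment[OF a x t]
  \<comment> \<open>The square of y^2 - x^2 is expanded; its three terms are the moments with m = 2,
    1 and 0.\<close>
  have "has_bochner_integral halfline (\<lambda>y. bessel_kernel \<alpha> t x y * y powr (\<alpha> + 1 / 2) * y ^ (2 * 2)
      - 2 * x\<^sup>2 * (bessel_kernel \<alpha> t x y * y powr (\<alpha> + 1 / 2) * y ^ (2 * 1))
      + x\<^sup>2 * x\<^sup>2 * (bessel_kernel \<alpha> t x y * y powr (\<alpha> + 1 / 2) * y ^ (2 * 0)))
    (x powr (\<alpha> + 1 / 2) * (4 * t) ^ 2 * bessel_poly \<alpha> 2 ?w
      - 2 * x\<^sup>2 * (x powr (\<alpha> + 1 / 2) * (4 * t) ^ 1 * bessel_poly \<alpha> 1 ?w)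
      + x\<^sup>2 * x\<^sup>2 * (x powr (\<alpha> + 1 / 2) * (4 * t) ^ 0 * bessel_poly \<alpha> 0 ?w))"
    by (intro has_bochner_integral_add has_bochner_integral_diff has_bochner_integral_mult_right mom)
  moreover have "(\<lambda>y. bessel_kernel \<alpha> t x y * y powr (\<alpha> + 1 / 2) * y ^ (2 * 2)
      - 2 * x\<^sup>2 * (bessel_kernel \<alpha> t x y * y powr (\<alpha> + 1 / 2) * y ^ (2 * 1))
      + x\<^sup>2 * x\<^sup>2 * (bessel_kernel \<alpha> t x y * y powr (\<alpha> + 1 / 2) * y ^ (2 * 0))) =
      (\<lambda>y. bessel_kernel \<alpha> t x y * y powr (\<alpha> + 1 / 2) * (y\<^sup>2 - x\<^sup>2)\<^sup>2)"
    by (intro ext) (simp add: power2_eq_square power4_eq_xxxx algebra_simps)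
  moreover have "x powr (\<alpha> + 1 / 2) * (4 * t) ^ 2 * bessel_poly \<alpha> 2 ?w
      - 2 * x\<^sup>2 * (x powr (\<alpha> + 1 / 2) * (4 * t) ^ 1 * bessel_poly \<alpha> 1 ?w)
      + x\<^sup>2 * x\<^sup>2 * (x powr (\<alpha> + 1 / 2) * (4 * t) ^ 0 * bessel_poly \<alpha> 0 ?w) =
      x powr (\<alpha> + 1 / 2) * (8 * t * x\<^sup>2 + 16 * t\<^sup>2 * (\<alpha> + 1) * (\<alpha> + 2))"
    unfolding P0 P1 P2 using t by (simp add: field_simps power2_eq_square)
  ultimately show ?thesis by (simp only:)
qed

lemma bessel_op_pointwise:
  assumes \<alpha>: "- 1 / 2 \<le> \<alpha>" and g: "L2_nice g" and x: "x > 0"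
  shows "((\<lambda>t. bessel_op \<alpha> t g x) \<longlongrightarrow> g x) (at_right 0)"
proof -
  obtain K a b where K: "K > 0" and ab: "0 < a" "a < b" and gK: "\<And>x. norm (g x) \<le> K" and g0: "\<And>x. x \<notin> {a..b} \<Longrightarrow> g x = 0"
    using L2_nice_bounded[OF g] by blast
  have gc: "continuous_on UNIV g" using g by (simp add: L2_nice_def)
  have a1: "\<alpha> > - 1" using \<alpha> by simp
  let ?h = "\<lambda>y::real. y powr (\<alpha> + 1 / 2)"
  \<comment> \<open>Dividing by the weight turns the kernel operator into an average of
    \<open>\<phi>\<close> with respect to a probability density. The weight is nondecreasing because
    \<open>\<alpha>\<close> \<ge> - 1/2, so on the support of \<open>g\<close> it is smallest at
    \<open>a\<close>, which yields the bound \<open>L\<close>.\<close>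
  define \<phi> where "\<phi> = (\<lambda>y. g y /\<^sub>R ?h y)"
  define L where "L = K / ?h a"
  have L: "L > 0" using K ab by (simp add: L_def)
  have \<phi>L: "norm (\<phi> y) \<le> L" if "y > 0" for y
  proof (cases "y \<in> {a..b}")
    case True
    then have "?h a \<le> ?h y" using ab \<alpha> by (intro powr_mono2) auto
    then show ?thesis using gK[of y] ab K that by (simp add: \<phi>_def L_def divide_inverse_commute[symmetric] frac_le)
  next
    case False
    then show ?thesis using g0 L by (simp add: \<phi>_def)
  qed
  have "isCont \<phi> x" unfolding \<phi>_def
    using gc x by (intro continuous_intros) (auto simp: continuous_on_eq_continuous_at)
  have key: "\<exists>C\<ge>0. \<forall>t>0. norm (bessel_op \<alpha> t g x - g x) \<le> e * ?h x + C * (?h x * (8 * t * x\<^sup>2 + 16 * t\<^sup>2 * (\<alpha> + 1) * (\<alpha> + 2)))"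
    if e: "e > 0" for e
  proof -
    obtain d where d: "d > 0" "\<And>y. \<bar>y - x\<bar> < d \<Longrightarrow> norm (\<phi> y - \<phi> x) < e"
      using \<open>isCont \<phi> x\<close> e by (auto simp: continuous_at_eps_delta dist_norm)
    \<comment> \<open>Chebyshev: outside the d-neighbourhood of x one has |y^2 - x^2| = |y - x| (y +
      x) \<ge> d x, so this multiple of (y^2 - x^2)^2 dominates the trivial bound 2 L.\<close>
    define C where "C = 2 * L / (d * x)\<^sup>2"
    have C: "C \<ge> 0" using L by (simp add: C_def)
    have est: "norm (\<phi> y - \<phi> x) \<le> e + C * (y\<^sup>2 - x\<^sup>2)\<^sup>2" if y: "y > 0" for y
    proof (cases "\<bar>y - x\<bar> < d")
      case True
      then have "norm (\<phi> y - \<phi> x) < e" by (rule d)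
      moreover have "0 \<le> C * (y\<^sup>2 - x\<^sup>2)\<^sup>2" using C by simp
      ultimately show ?thesis by linarith
    next
      case False
      have "norm (\<phi> y - \<phi> x) \<le> 2 * L" using norm_triangle_ineq4[of "\<phi> y" "\<phi> x"] \<phi>L[OF y] \<phi>L[OF x] by linarith
      also have "\<dots> = C * (d * x)\<^sup>2" using d x by (simp add: C_def)
      also have "\<dots> \<le> C * (y\<^sup>2 - x\<^sup>2)\<^sup>2"
      proof (intro mult_left_mono C)
        have "d * x \<le> \<bar>y - x\<bar> * (y + x)" using False d x y by (intro mult_mono) auto
        also have "\<dots> = \<bar>y\<^sup>2 - x\<^sup>2\<bar>" using x y by (simp add: power2_eq_square square_diff_square_factored abs_mult mult.commute)
        finally have "(d * x)\<^sup>2 \<le> \<bar>y\<^sup>2 - x\<^sup>2\<bar>\<^sup>2" using d x by (intro power_mono) auto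
        then show "(d * x)\<^sup>2 \<le> (y\<^sup>2 - x\<^sup>2)\<^sup>2" by simp
      qed
      finally show ?thesis using e by linarith
    qed
    have "norm (bessel_op \<alpha> t g x - g x) \<le> e * ?h x + C * (?h x * (8 * t * x\<^sup>2 + 16 * t\<^sup>2 * (\<alpha> + 1) * (\<alpha> + 2)))" if t: "t > 0" for t
    proof -
      interpret S: schur_kernel halfline "bessel_kernel \<alpha> t" "mass_bound \<alpha>" by (rule schur_kernel_bessel[OF \<alpha> t])
      let ?k = "bessel_kernel \<alpha> t x"
      have k0: "?k y > 0" if "y > 0" for y using bessel_kernel_pos[OF a1 x that t] .
      have P0: "bessel_poly \<alpha> 0 w = 1" for w
        using Gamma_real_neq_0[of "\<alpha> + 1"] a1 by (simp add: bessel_poly_def)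
      have h: "has_bochner_integral halfline (\<lambda>y. ?k y * ?h y) (?h x)"
        using bessel_kernel_moment[OF a1 x t, of 0] by (simp add: P0)
      have v: "has_bochner_integral halfline (\<lambda>y. ?k y * ?h y * (y\<^sup>2 - x\<^sup>2)\<^sup>2) (?h x * (8 * t * x\<^sup>2 + 16 * t\<^sup>2 * (\<alpha> + 1) * (\<alpha> + 2)))"
        by (rule bessel_kernel_variance[OF a1 x t])
      have dom: "has_bochner_integral halfline (\<lambda>y. e * (?k y * ?h y) + C * (?k y * ?h y * (y\<^sup>2 - x\<^sup>2)\<^sup>2))
          (e * ?h x + C * (?h x * (8 * t * x\<^sup>2 + 16 * t\<^sup>2 * (\<alpha> + 1) * (\<alpha> + 2))))"
        by (intro has_bochner_integral_add has_bochner_integral_mult_right h v)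
      have [measurable]: "?k \<in> borel_measurable halfline" using S.k_measurable1 x by simp
      have [measurable]: "g \<in> borel_measurable halfline" by (rule L2_nice_measurable[OF g])
      have ig: "integrable halfline (\<lambda>y. ?k y *\<^sub>R g y)"
      proof (rule Bochner_Integration.integrable_bound)
        show "integrable halfline (\<lambda>y. L * (?k y * ?h y))" using h by (auto simp: has_bochner_integral_iff)
        show "AE y in halfline. norm (?k y *\<^sub>R g y) \<le> norm (L * (?k y * ?h y))"
        proof (rule AE_I2)
          fix y assume "y \<in> space halfline"
          then have y: "y > 0" by simp
          have "norm (g y) = norm (\<phi> y) * ?h y" using y by (simp add: \<phi>_def)
          then have "norm (g y) \<le> L * ?h y" using \<phi>L[OF y] by (simp add: mult_right_mono)
          then show "norm (?k y *\<^sub>R g y) \<le> norm (L * (?k y * ?h y))"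
            using k0[OF y] L by (simp add: abs_mult mult_left_mono mult.left_commute)
        qed
      qed measurable
      have "bessel_op \<alpha> t g x - g x = (LINT y|halfline. ?k y *\<^sub>R g y) - (LINT y|halfline. (?k y * ?h y) *\<^sub>R \<phi> x)"
        using h x by (simp add: bessel_op_def has_bochner_integral_iff \<phi>_def)
      also have "\<dots> = (LINT y|halfline. ?k y *\<^sub>R g y - (?k y * ?h y) *\<^sub>R \<phi> x)"
        using ig h by (intro Bochner_Integration.integral_diff[symmetric]) (auto simp: has_bochner_integral_iff)
      finally have diff: "bessel_op \<alpha> t g x - g x = (LINT y|halfline. ?k y *\<^sub>R g y - (?k y * ?h y) *\<^sub>R \<phi> x)" .
      have "norm (bessel_op \<alpha> t g x - g x) \<le> (LINT y|halfline. e * (?k y * ?h y) + C * (?k y * ?h y * (y\<^sup>2 - x\<^sup>2)\<^sup>2))"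
        unfolding diff
      proof (rule Bochner_Integration.integral_norm_bound_integral)
        show "integrable halfline (\<lambda>y. ?k y *\<^sub>R g y - (?k y * ?h y) *\<^sub>R \<phi> x)"
          using ig h by (intro Bochner_Integration.integrable_diff) (auto simp: has_bochner_integral_iff)
        show "integrable halfline (\<lambda>y. e * (?k y * ?h y) + C * (?k y * ?h y * (y\<^sup>2 - x\<^sup>2)\<^sup>2))"
          using dom by (simp add: has_bochner_integral_iff)
        fix y assume "y \<in> space halfline"
        then have y: "y > 0" by simp
        have "?k y *\<^sub>R g y - (?k y * ?h y) *\<^sub>R \<phi> x = (?k y * ?h y) *\<^sub>R (\<phi> y - \<phi> x)"
          using y by (simp add: \<phi>_def scaleR_diff_right)
        then have "norm (?k y *\<^sub>R g y - (?k y * ?h y) *\<^sub>R \<phi> x) = (?k y * ?h y) * norm (\<phi> y - \<phi> x)"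
          using k0[OF y] by (simp add: abs_mult)
        also have "\<dots> \<le> (?k y * ?h y) * (e + C * (y\<^sup>2 - x\<^sup>2)\<^sup>2)"
          using k0[OF y] by (intro mult_left_mono est[OF y]) auto
        also have "\<dots> = e * (?k y * ?h y) + C * (?k y * ?h y * (y\<^sup>2 - x\<^sup>2)\<^sup>2)" by (simp add: algebra_simps)
        finally show "norm (?k y *\<^sub>R g y - (?k y * ?h y) *\<^sub>R \<phi> x) \<le> \<dots>" .
      qed
      then show ?thesis using dom by (simp add: has_bochner_integral_iff)
    qed
    then show ?thesis using C by blast
  qed
  show ?thesis
  proof (rule tendstoI)
    fix \<epsilon> :: real assume \<epsilon>: "\<epsilon> > 0"
    have hx: "?h x > 0" using x by simp
    obtain C where C: "C \<ge> 0" "\<And>t. t > 0 \<Longrightarrow> norm (bessel_op \<alpha> t g x - g x) \<le> \<epsilon> / 2 / ?h x * ?h x + C * (?h x * (8 * t * x\<^sup>2 + 16 * t\<^sup>2 * (\<alpha> + 1) * (\<alpha> + 2)))"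
      using key[of "\<epsilon> / 2 / ?h x"] \<epsilon> hx by auto
    have "((\<lambda>t. C * (?h x * (8 * t * x\<^sup>2 + 16 * t\<^sup>2 * (\<alpha> + 1) * (\<alpha> + 2)))) \<longlongrightarrow> C * (?h x * (8 * 0 * x\<^sup>2 + 16 * 0\<^sup>2 * (\<alpha> + 1) * (\<alpha> + 2)))) (at_right 0)"
      by (intro tendsto_intros)
    then have "\<forall>\<^sub>F t in at_right 0. C * (?h x * (8 * t * x\<^sup>2 + 16 * t\<^sup>2 * (\<alpha> + 1) * (\<alpha> + 2))) < \<epsilon> / 2"
      using order_tendstoD(2)[of _ 0 "at_right 0" "\<epsilon> / 2"] \<epsilon> by simp
    moreover have "\<forall>\<^sub>F t in at_right (0::real). t > 0" by (rule eventually_at_right_less)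
    ultimately show "\<forall>\<^sub>F t in at_right 0. dist (bessel_op \<alpha> t g x) (g x) < \<epsilon>"
    proof eventually_elim
      case (elim t)
      then show ?case using C(2)[of t] hx by (simp add: dist_norm)
    qed
  qed
qed

section \<open>From the quadratic form to strong convergence\<close>

lemma L2_product_integrable:
  assumes f: "f \<in> Lp 2 M" and g: "g \<in> Lp 2 M"
  shows "integrable M (\<lambda>x. f x * cnj (g x))"
proof -
  have [measurable]: "f \<in> borel_measurable M" "g \<in> borel_measurable M" using f g by (auto simp: in_L2_iff)
  have "(\<integral>\<^sup>+x. ennreal (norm (f x * cnj (g x))) \<partial>M) \<le> (\<integral>\<^sup>+x. ennreal ((norm (f x))\<^sup>2) + ennreal ((norm (g x))\<^sup>2) \<partial>M)"
  proof (intro nn_integral_mono)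
    fix x
    from ennreal_leI[OF norm_mult_le_squares] show "ennreal (norm (f x * cnj (g x))) \<le> ennreal ((norm (f x))\<^sup>2) + ennreal ((norm (g x))\<^sup>2)"
      by simp
  qed
  also have "\<dots> = sq_norm M f + sq_norm M g" unfolding sq_norm_def by (rule nn_integral_add) measurable
  also have "\<dots> < \<infinity>" using f g by (simp add: in_L2_iff)
  finally show ?thesis by (intro integrableI_bounded) measurable
qed

lemma sq_norm_eq_inner:
  assumes f: "f \<in> Lp 2 M"
  shows "sq_norm M f = ennreal (Re (LINT x|M. f x * cnj (f x)))"
proof -
  have "integrable M (\<lambda>x. (norm (f x))\<^sup>2)"
    using integrable_Re[OF L2_product_integrable[OF f f]] by (simp add: complex_mult_cnj cmod_power2)
  then have "sq_norm M f = ennreal (LINT x|M. (norm (f x))\<^sup>2)"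
    unfolding sq_norm_def by (intro nn_integral_eq_integral) auto
  also have "(LINT x|M. (norm (f x))\<^sup>2) = Re (LINT x|M. f x * cnj (f x))"
    by (subst integral_Re[OF L2_product_integrable[OF f f], symmetric]) (simp add: complex_mult_cnj cmod_power2)
  finally show ?thesis .
qed

text \<open>Pairing with \<open>g\<close> restricts the integral to the bounded support of
  \<open>g\<close>, where the mass bound gives a constant majorant. For the L^2 distance itself a
  majorant on the whole half-line would have to be found, which is why the form is treated
  first.\<close>

lemma bessel_form_tendsto:
  assumes \<alpha>: "- 1 / 2 \<le> \<alpha>" and g: "L2_nice g"
  shows "((\<lambda>t. LINT x|halfline. bessel_op \<alpha> t g x * cnj (g x)) \<longlongrightarrow> (LINT x|halfline. g x * cnj (g x))) (at_right 0)"
proof (rule tendsto_at_right_sequentially[of 0 1])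
  fix S :: "nat \<Rightarrow> real" assume S: "\<And>n. 0 < S n" "S \<longlonglongrightarrow> 0"
  obtain K a b where K: "K > 0" and ab: "0 < a" "a < b" and gK: "\<And>x. norm (g x) \<le> K" and g0: "\<And>x. x \<notin> {a..b} \<Longrightarrow> g x = 0"
    using L2_nice_bounded[OF g] by blast
  have gm[measurable]: "g \<in> borel_measurable halfline" by (rule L2_nice_measurable[OF g])
  have om[measurable]: "bessel_op \<alpha> (S n) g \<in> borel_measurable halfline" for n
    using schur_kernel.op_measurable[OF schur_kernel_bessel[OF \<alpha> S(1)] gm] by (simp add: bessel_op_eq[OF \<alpha> S(1)])
  have bd: "norm (bessel_op \<alpha> (S n) g x) \<le> mass_bound \<alpha> * K" if x: "x > 0" for n x
  proof -
    interpret S: schur_kernel halfline "bessel_kernel \<alpha> (S n)" "mass_bound \<alpha>" by (rule schur_kernel_bessel[OF \<alpha> S(1)])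
    have "ennreal (norm (bessel_op \<alpha> (S n) g x)) \<le> (\<integral>\<^sup>+y. ennreal (bessel_kernel \<alpha> (S n) x y) * ennreal (norm (g y)) \<partial>halfline)"
      using S.op_norm_le[OF gm, of x] x by (simp add: bessel_op_eq[OF \<alpha> S(1)])
    also have "\<dots> \<le> (\<integral>\<^sup>+y. ennreal (bessel_kernel \<alpha> (S n) x y) * ennreal K \<partial>halfline)"
      by (intro nn_integral_mono mult_left_mono ennreal_leI gK) auto
    also have "\<dots> = (\<integral>\<^sup>+y. ennreal (bessel_kernel \<alpha> (S n) x y) \<partial>halfline) * ennreal K"
      by (rule nn_integral_multc) (use S.k_measurable1[of x] x in simp)
    also have "\<dots> \<le> ennreal (mass_bound \<alpha>) * ennreal K" using S.mass_le[of x] x by (intro mult_right_mono) auto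
    also have "\<dots> = ennreal (mass_bound \<alpha> * K)" using K by (simp add: ennreal_mult'')
    finally show ?thesis using K S.c_pos by (subst (asm) ennreal_le_iff) auto
  qed
  have c0: "mass_bound \<alpha> > 0" by (simp add: mass_bound_def)
  show "(\<lambda>n. LINT x|halfline. bessel_op \<alpha> (S n) g x * cnj (g x)) \<longlonglongrightarrow> (LINT x|halfline. g x * cnj (g x))"
  proof (rule integral_dominated_convergence[where w = "\<lambda>x. mass_bound \<alpha> * K * K * indicator {a..b} x"])
    show "integrable halfline (\<lambda>x. mass_bound \<alpha> * K * K * indicator {a..b} x)"
    proof -
      have "integrable lborel (\<lambda>x. mass_bound \<alpha> * K * K * indicator {a..b} x)"
        by (intro integrable_mult_right integrable_real_indicator) (auto simp: emeasure_lborel_Icc_eq)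
      then have "integrable lborel (\<lambda>x. indicator {0<..} x *\<^sub>R (mass_bound \<alpha> * K * K * indicator {a..b} x))"
        by (rule integrable_mult_indicator[rotated]) auto
      then show ?thesis by (subst integrable_restrict_space) (auto simp: set_integrable_def)
    qed
    show "AE x in halfline. (\<lambda>n. bessel_op \<alpha> (S n) g x * cnj (g x)) \<longlonglongrightarrow> g x * cnj (g x)"
    proof (rule AE_I2)
      fix x assume "x \<in> space halfline"
      then have x: "x > 0" by simp
      have "filterlim S (at_right 0) sequentially" using S less_imp_neq[OF S(1)] by (auto simp: filterlim_at)
      from filterlim_compose[OF bessel_op_pointwise[OF \<alpha> g x] this]
      show "(\<lambda>n. bessel_op \<alpha> (S n) g x * cnj (g x)) \<longlonglongrightarrow> g x * cnj (g x)" by (intro tendsto_intros)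
    qed
    show "AE x in halfline. norm (bessel_op \<alpha> (S n) g x * cnj (g x)) \<le> mass_bound \<alpha> * K * K * indicator {a..b} x" for n
    proof (rule AE_I2)
      fix x assume "x \<in> space halfline"
      then have x: "x > 0" by simp
      show "norm (bessel_op \<alpha> (S n) g x * cnj (g x)) \<le> mass_bound \<alpha> * K * K * indicator {a..b} x"
      proof (cases "x \<in> {a..b}")
        case True
        have "norm (bessel_op \<alpha> (S n) g x * cnj (g x)) \<le> mass_bound \<alpha> * K * K"
          unfolding norm_mult using bd[OF x, of n] gK[of x] K c0 by (intro mult_mono) auto
        then show ?thesis using True by simp
      qed (use g0 in auto)
    qed
  qed measurable
qed auto

text \<open>Self-adjointness and the composition of kernels turn the squared distance of T g and g
  at time t into Q(2 t) - 2 Q(t) + N, where Q is the quadratic form and N its limit. Convergence of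
  the form is thus strong convergence.\<close>

lemma bessel_op_tendsto_nice:
  assumes \<alpha>: "- 1 / 2 \<le> \<alpha>" and g: "L2_nice g"
  shows "((\<lambda>t. sq_norm halfline (\<lambda>x. bessel_op \<alpha> t g x - g x)) \<longlongrightarrow> 0) (at_right 0)"
proof -
  let ?Q = "\<lambda>t. LINT x|halfline. bessel_op \<alpha> t g x * cnj (g x)"
  let ?N = "LINT x|halfline. g x * cnj (g x)"
  have gL: "g \<in> Lp 2 halfline" by (rule L2_nice_in_L2[OF g])
  have gm[measurable]: "g \<in> borel_measurable halfline" using gL by (simp add: in_L2_iff)
  have eq: "sq_norm halfline (\<lambda>x. bessel_op \<alpha> t g x - g x) = ennreal (Re (?Q (2 * t)) - 2 * Re (?Q t) + Re ?N)" if t: "t > 0" for t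
  proof -
    interpret S: schur_kernel halfline "bessel_kernel \<alpha> t" "mass_bound \<alpha>" by (rule schur_kernel_bessel[OF \<alpha> t])
    note oe = bessel_op_eq[OF \<alpha> t]
    let ?u = "bessel_op \<alpha> t g"
    have uL: "?u \<in> Lp 2 halfline" using S.op_in_Lp[OF one_le_2_ennreal gL] by (simp add: oe)
    have uuL: "bessel_op \<alpha> t ?u \<in> Lp 2 halfline" using S.op_in_Lp[OF one_le_2_ennreal uL] by (simp add: oe)
    have t2: "2 * t > 0" using t by simp
    have u2L: "bessel_op \<alpha> (2 * t) g \<in> Lp 2 halfline"
      using schur_kernel.op_in_Lp[OF schur_kernel_bessel[OF \<alpha> t2] one_le_2_ennreal gL] by (simp add: bessel_op_eq[OF \<alpha> t2])
    have m: "?u \<in> borel_measurable halfline" "bessel_op \<alpha> t ?u \<in> borel_measurable halfline" "bessel_op \<alpha> (2 * t) g \<in> borel_measurable halfline"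
      using uL uuL u2L by (auto simp: in_L2_iff)
    have "(LINT x|halfline. ?u x * cnj (?u x)) = (LINT x|halfline. bessel_op \<alpha> t ?u x * cnj (g x))"
      using S.op_selfadjoint[OF uL gL] by (simp add: oe)
    also have "\<dots> = ?Q (2 * t)"
    proof (rule integral_cong_AE)
      show "AE x in halfline. bessel_op \<alpha> t ?u x * cnj (g x) = bessel_op \<alpha> (2 * t) g x * cnj (g x)"
        using bessel_op_semigroup[OF \<alpha> t t L2_subset_L1_plus_Linf[OF gL]] by eventually_elim simp
    qed (use m in measurable)
    finally have uu: "(LINT x|halfline. ?u x * cnj (?u x)) = ?Q (2 * t)" .
    have gu: "(LINT x|halfline. g x * cnj (?u x)) = ?Q t"
      using S.op_selfadjoint[OF gL gL] by (simp add: oe)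
    have "(LINT x|halfline. (?u x - g x) * cnj (?u x - g x)) =
      (LINT x|halfline. (?u x * cnj (?u x) - ?u x * cnj (g x)) - (g x * cnj (?u x) - g x * cnj (g x)))"
      by (intro Bochner_Integration.integral_cong) (auto simp: algebra_simps)
    also have "\<dots> = (?Q (2 * t) - ?Q t) - (?Q t - ?N)"
      unfolding uu[symmetric] gu[symmetric]
      using L2_product_integrable[OF uL uL] L2_product_integrable[OF uL gL] L2_product_integrable[OF gL uL] L2_product_integrable[OF gL gL] gu
      by simp
    finally have D: "(LINT x|halfline. (?u x - g x) * cnj (?u x - g x)) = (?Q (2 * t) - ?Q t) - (?Q t - ?N)" .
    show ?thesis unfolding sq_norm_eq_inner[OF L2_diff[OF uL gL]] D by (simp add: algebra_simps)
  qed
  have "((\<lambda>t. Re (?Q (2 * t)) - 2 * Re (?Q t) + Re ?N) \<longlongrightarrow> Re ?N - 2 * Re ?N + Re ?N) (at_right 0)"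
  proof (intro tendsto_intros bessel_form_tendsto[OF \<alpha> g])
    have "filterlim (\<lambda>t::real. 2 * t) (at_right 0) (at_right 0)"
      by (rule filterlim_times_pos[of _ 0 "at_right 0" 2 0]) (auto simp: filterlim_ident)
    from filterlim_compose[OF bessel_form_tendsto[OF \<alpha> g] this]
    show "((\<lambda>t. ?Q (2 * t)) \<longlongrightarrow> ?N) (at_right 0)" .
  qed
  then have "((\<lambda>t. ennreal (Re (?Q (2 * t)) - 2 * Re (?Q t) + Re ?N)) \<longlongrightarrow> ennreal 0) (at_right 0)"
    by (intro tendsto_ennrealI) simp
  moreover have "\<forall>\<^sub>F t in at_right 0. ennreal (Re (?Q (2 * t)) - 2 * Re (?Q t) + Re ?N) = sq_norm halfline (\<lambda>x. bessel_op \<alpha> t g x - g x)"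
    using eventually_at_right_less[of "0::real"] by eventually_elim (simp add: eq)
  ultimately show ?thesis by (simp add: Lim_transform_eventually)
qed

lemma bessel_op_tendsto:
  assumes \<alpha>: "- 1 / 2 \<le> \<alpha>" and f: "f \<in> Lp 2 halfline"
  shows "((\<lambda>t. sq_norm halfline (\<lambda>x. bessel_op \<alpha> t f x - f x)) \<longlongrightarrow> 0) (at_right 0)"
proof (rule ennreal_tendsto_0I)
  fix e :: real assume e: "e > 0"
  define c where "c = mass_bound \<alpha>"
  have c: "c \<ge> 1" by (simp add: c_def mass_bound_def)
  \<comment> \<open>Approximation by \<open>g\<close> costs c^2 d = e / 16 on the side of the
    operator and at most e / 16 on the other. The two nested squared triangle inequalities have
    coefficients 2, 4 and 4, in total 10 / 16 < 1.\<close>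
  define d where "d = e / (16 * c\<^sup>2)"
  have d: "d > 0" using e c by (simp add: d_def)
  obtain g where g: "L2_nice g" "sq_norm halfline (\<lambda>x. g x - f x) \<le> ennreal d"
    using L2_nice_dense[OF f d] by blast
  have gL: "g \<in> Lp 2 halfline" by (rule L2_nice_in_L2[OF g(1)])
  have m[measurable]: "f \<in> borel_measurable halfline" "g \<in> borel_measurable halfline" using f gL by (auto simp: in_L2_iff)
  have "\<forall>\<^sub>F t in at_right 0. sq_norm halfline (\<lambda>x. bessel_op \<alpha> t g x - g x) < ennreal (e / 16)"
    using order_tendstoD(2)[OF bessel_op_tendsto_nice[OF \<alpha> g(1)]] e by simp
  then show "\<forall>\<^sub>F t in at_right 0. sq_norm halfline (\<lambda>x. bessel_op \<alpha> t f x - f x) \<le> ennreal e"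
    using eventually_at_right_less[of "0::real"]
  proof eventually_elim
    case (elim t)
    interpret S: schur_kernel halfline "bessel_kernel \<alpha> t" "mass_bound \<alpha>" by (rule schur_kernel_bessel[OF \<alpha> elim(2)])
    note oe = bessel_op_eq[OF \<alpha> elim(2)]
    have [measurable]: "bessel_op \<alpha> t f \<in> borel_measurable halfline" "bessel_op \<alpha> t g \<in> borel_measurable halfline"
      using S.op_measurable[OF m(1)] S.op_measurable[OF m(2)] by (auto simp: oe)
    let ?s = "sq_norm halfline"
    have "?s (\<lambda>x. bessel_op \<alpha> t f x - bessel_op \<alpha> t g x) \<le> ennreal (c\<^sup>2) * ?s (\<lambda>x. f x - g x)"
      unfolding c_def by (rule sq_norm_bessel_op_diff[OF \<alpha> elim(2) f gL])
    also have "\<dots> \<le> ennreal (c\<^sup>2) * ennreal d"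
      using g(2) unfolding sq_norm_minus[of _ f g] by (rule mult_left_mono) simp
    also have "\<dots> = ennreal (e / 16)" using c d by (simp add: ennreal_mult''[symmetric] d_def)
    finally have 1: "?s (\<lambda>x. bessel_op \<alpha> t f x - bessel_op \<alpha> t g x) \<le> ennreal (e / 16)" .
    have "d \<le> e / 16" using c e by (simp add: d_def field_simps)
    then have 3: "?s (\<lambda>x. g x - f x) \<le> ennreal (e / 16)" using g(2) by (meson ennreal_leI order_trans)
    have "?s (\<lambda>x. bessel_op \<alpha> t f x - f x) \<le> 2 * ?s (\<lambda>x. bessel_op \<alpha> t f x - bessel_op \<alpha> t g x) + 2 * ?s (\<lambda>x. bessel_op \<alpha> t g x - f x)"
      by (rule sq_norm_diff_triangle) measurable
    also have "?s (\<lambda>x. bessel_op \<alpha> t g x - f x) \<le> 2 * ?s (\<lambda>x. bessel_op \<alpha> t g x - g x) + 2 * ?s (\<lambda>x. g x - f x)"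
      by (rule sq_norm_diff_triangle) measurable
    also have "2 * ?s (\<lambda>x. bessel_op \<alpha> t f x - bessel_op \<alpha> t g x) + 2 * (2 * ?s (\<lambda>x. bessel_op \<alpha> t g x - g x) + 2 * ?s (\<lambda>x. g x - f x)) \<le>
      2 * ennreal (e / 16) + 2 * (2 * ennreal (e / 16) + 2 * ennreal (e / 16))"
      using 1 3 elim(1) by (intro add_mono mult_left_mono) auto
    also have "\<dots> = ennreal (10 * (e / 16))"
    proof -
      have two: "2 * ennreal r = ennreal (2 * r)" if "r \<ge> 0" for r using that by (simp add: ennreal_mult')
      show ?thesis using e by (simp add: two ennreal_plus[symmetric] del: ennreal_plus)
    qed
    also have "\<dots> \<le> ennreal e" using e by (intro ennreal_leI) simp
    finally show ?case by (simp add: mult_left_mono)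
  qed
qed

section \<open>The Hankel transform\<close>

lemma bessel_psi_commute: "bessel_psi \<alpha> l x = bessel_psi \<alpha> x l"
  by (simp add: bessel_psi_def mult.commute)

text \<open>The series of the eigenfunction with all signs made positive, at the right end of the
  range 0 < x \<le> b. It grows exponentially in \<open>l\<close>, which any Gaussian factor
  absorbs.\<close>

definition psi_bound :: "real \<Rightarrow> real \<Rightarrow> real \<Rightarrow> real" where
  "psi_bound \<alpha> b l = (b powr (\<alpha> + 1 / 2) / 2 powr \<alpha>) * l powr (\<alpha> + 1 / 2) * bessel_entire \<alpha> (b\<^sup>2 / 4 * l\<^sup>2)"

lemma psi_bound_nonneg: "\<alpha> > - 1 \<Longrightarrow> 0 \<le> psi_bound \<alpha> b l"
  unfolding psi_bound_def by (intro mult_nonneg_nonneg less_imp_le[OF bessel_entire_pos]) auto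

lemma psi_bound_measurable [measurable]: "psi_bound \<alpha> b \<in> borel_measurable borel"
  unfolding psi_bound_def[abs_def] by measurable

lemma abs_bessel_psi_le:
  assumes \<alpha>: "- 1 / 2 \<le> \<alpha>" and x: "0 < x" "x \<le> b" and l: "l > 0"
  shows "\<bar>bessel_psi \<alpha> l x\<bar> \<le> psi_bound \<alpha> b l"
proof -
  have a: "\<alpha> > - 1" using \<alpha> by simp
  have "\<bar>bessel_entire \<alpha> (- (x\<^sup>2 / 4) * l\<^sup>2)\<bar> \<le> bessel_entire \<alpha> \<bar>- (x\<^sup>2 / 4) * l\<^sup>2\<bar>" by (rule abs_bessel_entire_le[OF a])
  also have "\<dots> \<le> bessel_entire \<alpha> (b\<^sup>2 / 4 * l\<^sup>2)"
    using x by (intro bessel_entire_mono a) (auto simp: abs_mult intro!: mult_right_mono power_mono)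
  finally have "x powr (\<alpha> + 1 / 2) / 2 powr \<alpha> * l powr (\<alpha> + 1 / 2) * \<bar>bessel_entire \<alpha> (- (x\<^sup>2 / 4) * l\<^sup>2)\<bar> \<le> psi_bound \<alpha> b l"
    unfolding psi_bound_def using x l \<alpha> by (intro mult_mono divide_right_mono powr_mono2) auto
  then show ?thesis unfolding bessel_psi_eq[OF x(1) l] by (simp add: abs_mult)
qed

lemma psi_bound_sq_integrable:
  assumes \<alpha>: "\<alpha> > - 1" and t: "t > 0"
  shows "integrable halfline (\<lambda>l. exp (- t * l\<^sup>2) * (psi_bound \<alpha> b l)\<^sup>2)"
proof -
  let ?D = "b powr (\<alpha> + 1 / 2) / 2 powr \<alpha>"
  have "integrable halfline (\<lambda>l. ?D\<^sup>2 * (l powr (2 * \<alpha> + 1) * exp (- t * l\<^sup>2) * bessel_entire \<alpha> (b\<^sup>2 / 4 * l\<^sup>2) * bessel_entire \<alpha> (b\<^sup>2 / 4 * l\<^sup>2)))"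
    using weber_integral[OF \<alpha> t, of "b\<^sup>2 / 4" "b\<^sup>2 / 4"] by (auto simp: has_bochner_integral_iff)
  moreover have "?D\<^sup>2 * (l powr (2 * \<alpha> + 1) * exp (- t * l\<^sup>2) * bessel_entire \<alpha> (b\<^sup>2 / 4 * l\<^sup>2) * bessel_entire \<alpha> (b\<^sup>2 / 4 * l\<^sup>2)) =
      exp (- t * l\<^sup>2) * (psi_bound \<alpha> b l)\<^sup>2" for l
  proof -
    have "l powr (2 * \<alpha> + 1) = (l powr (\<alpha> + 1 / 2))\<^sup>2" by (simp add: power2_eq_square powr_add[symmetric])
    then show ?thesis by (simp add: psi_bound_def power_mult_distrib power2_eq_square)
  qed
  ultimately show ?thesis by (simp only:)
qed

lemma L2_compact_supportE:
  assumes "f \<in> L2_compact_support"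
  obtains a b where "f \<in> Lp 2 halfline" "0 < a" "a < b" "\<And>x. x \<notin> {a..b} \<Longrightarrow> f x = 0"
  using assms unfolding L2_compact_support_def by blast

lemma L2_compact_support_measurable: "f \<in> L2_compact_support \<Longrightarrow> f \<in> borel_measurable halfline"
  by (auto simp: L2_compact_support_def in_L2_iff)

text \<open>On the bounded support |f| \<le> 1 + |f|^2, and both terms have finite integrals
  there.\<close>

lemma L2_compact_support_integrable:
  assumes "f \<in> L2_compact_support"
  shows "integrable halfline f"
proof -
  obtain a b where f: "f \<in> Lp 2 halfline" and ab: "0 < a" "a < b" and f0: "\<And>x. x \<notin> {a..b} \<Longrightarrow> f x = 0"
    using assms by (elim L2_compact_supportE) blast
  have [measurable]: "f \<in> borel_measurable halfline" using f by (simp add: in_L2_iff)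
  have [measurable]: "(indicator {a..b} :: real \<Rightarrow> ennreal) \<in> borel_measurable halfline" by (rule halfline_borel) simp
  have "(\<integral>\<^sup>+x. ennreal (norm (f x)) \<partial>halfline) \<le> (\<integral>\<^sup>+x. indicator {a..b} x + ennreal ((norm (f x))\<^sup>2) \<partial>halfline)"
  proof (intro nn_integral_mono)
    fix x
    have "2 * 1 * norm (f x) \<le> 1\<^sup>2 + (norm (f x))\<^sup>2" by (rule sum_squares_bound)
    then have "norm (f x) \<le> 1 + (norm (f x))\<^sup>2" using norm_ge_zero[of "f x"] unfolding power_one by linarith
    from ennreal_leI[OF this] show "ennreal (norm (f x)) \<le> indicator {a..b} x + ennreal ((norm (f x))\<^sup>2)"
      using f0[of x] by (cases "x \<in> {a..b}") auto
  qed
  also have "\<dots> = (\<integral>\<^sup>+x. indicator {a..b} x \<partial>halfline) + sq_norm halfline f"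
    unfolding sq_norm_def by (rule nn_integral_add) measurable
  also have "(\<integral>\<^sup>+x. indicator {a..b} x \<partial>halfline) \<le> (\<integral>\<^sup>+x. indicator {a..b} x \<partial>lborel)"
    by (subst nn_integral_restrict_space, simp, intro nn_integral_mono) (auto simp: indicator_def)
  also have "(\<integral>\<^sup>+x. indicator {a..b} x \<partial>lborel) = ennreal (b - a)" using ab by simp
  also have "ennreal (b - a) + sq_norm halfline f < \<infinity>" using f by (simp add: in_L2_iff)
  finally show ?thesis by (intro integrableI_bounded) (auto simp: add_right_mono)
qed

lemma L2_compact_support_diff:
  assumes f: "f \<in> L2_compact_support" and g: "g \<in> L2_compact_support"
  shows "(\<lambda>x. f x - g x) \<in> L2_compact_support"
proof -
  obtain a b where f: "f \<in> Lp 2 halfline" and ab: "0 < a" "a < b" and f0: "\<And>x. x \<notin> {a..b} \<Longrightarrow> f x = 0"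
    using f by (elim L2_compact_supportE) blast
  obtain c d where g: "g \<in> Lp 2 halfline" and cd: "0 < c" "c < d" and g0: "\<And>x. x \<notin> {c..d} \<Longrightarrow> g x = 0"
    using g by (elim L2_compact_supportE) blast
  have "f x - g x = 0" if "x \<notin> {min a c..max b d}" for x
  proof -
    have "x \<notin> {a..b}" "x \<notin> {c..d}" using that by (auto simp: min_le_iff_disj le_max_iff_disj)
    then show ?thesis using f0[of x] g0[of x] by simp
  qed
  then show ?thesis using L2_diff[OF f g] ab cd unfolding L2_compact_support_def
    by (intro CollectI conjI exI[of _ "min a c"] exI[of _ "max b d"]) auto
qed

lemma L2_nice_compact_support: "L2_nice g \<Longrightarrow> g \<in> L2_compact_support"
  unfolding L2_compact_support_def using L2_nice_in_L2[of g] by (auto simp: L2_nice_def)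

context
  fixes \<alpha> :: real
  assumes \<alpha>: "- 1 / 2 \<le> \<alpha>"
begin

lemma \<alpha>_gt: "\<alpha> > - 1"
  using \<alpha> by simp

lemma psi_integrable:
  assumes f: "f \<in> L2_compact_support" and l: "l > 0"
  shows "integrable halfline (\<lambda>x. bessel_psi \<alpha> l x *\<^sub>R f x)"
proof -
  obtain a b where ab: "0 < a" "a < b" and f0: "\<And>x. x \<notin> {a..b} \<Longrightarrow> f x = 0"
    using f by (elim L2_compact_supportE) blast
  have [measurable]: "f \<in> borel_measurable halfline" using f by (rule L2_compact_support_measurable)
  have [measurable]: "(\<lambda>x. x) \<in> borel_measurable halfline" by (rule halfline_id_measurable)
  show ?thesis
  proof (rule Bochner_Integration.integrable_bound)
    show "integrable halfline (\<lambda>x. psi_bound \<alpha> b l *\<^sub>R f x)"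
      using L2_compact_support_integrable[OF f] by simp
    show "AE x in halfline. norm (bessel_psi \<alpha> l x *\<^sub>R f x) \<le> norm (psi_bound \<alpha> b l *\<^sub>R f x)"
    proof (rule AE_I2)
      fix x assume "x \<in> space halfline"
      then show "norm (bessel_psi \<alpha> l x *\<^sub>R f x) \<le> norm (psi_bound \<alpha> b l *\<^sub>R f x)"
        using abs_bessel_psi_le[OF \<alpha>, of x b l] l f0[of x] psi_bound_nonneg[OF \<alpha>_gt, of b l]
        by (cases "x \<in> {a..b}") (auto intro!: mult_right_mono)
    qed
  qed measurable
qed

lemma hankel_integral_measurable:
  assumes f: "f \<in> L2_compact_support"
  shows "hankel_integral \<alpha> f \<in> borel_measurable halfline"
proof -
  interpret sigma_finite_measure halfline by (rule sigma_finite_halfline)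
  have [measurable]: "f \<in> borel_measurable halfline" using f by (rule L2_compact_support_measurable)
  show ?thesis unfolding hankel_integral_def[abs_def]
    by (rule borel_measurable_lebesgue_integral) measurable
qed

lemma norm_hankel_integral_le:
  assumes f: "f \<in> L2_compact_support" and f0: "\<And>x. x \<notin> {a..b} \<Longrightarrow> f x = 0" and l: "l > 0"
  shows "norm (hankel_integral \<alpha> f l) \<le> psi_bound \<alpha> b l * (LINT x|halfline. norm (f x))"
proof -
  have "norm (hankel_integral \<alpha> f l) \<le> (LINT x|halfline. psi_bound \<alpha> b l * norm (f x))"
    unfolding hankel_integral_def
  proof (rule Bochner_Integration.integral_norm_bound_integral)
    show "integrable halfline (\<lambda>x. psi_bound \<alpha> b l * norm (f x))"
      using L2_compact_support_integrable[OF f] by simp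
    show "norm (bessel_psi \<alpha> l x *\<^sub>R f x) \<le> psi_bound \<alpha> b l * norm (f x)" if "x \<in> space halfline" for x
      using that abs_bessel_psi_le[OF \<alpha>, of x b l] l f0[of x]
      by (cases "x \<in> {a..b}") (auto intro!: mult_right_mono)
  qed (rule psi_integrable[OF f l])
  then show ?thesis by simp
qed

lemma hankel_integral_diff:
  assumes f: "f \<in> L2_compact_support" and g: "g \<in> L2_compact_support" and l: "l > 0"
  shows "hankel_integral \<alpha> (\<lambda>x. f x - g x) l = hankel_integral \<alpha> f l - hankel_integral \<alpha> g l"
  unfolding hankel_integral_def scaleR_diff_right
  by (rule Bochner_Integration.integral_diff) (intro psi_integrable f g l)+

lemma heat_hankel_integrable:
  assumes f: "f \<in> L2_compact_support" and t: "t > 0" and x: "x > 0"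
  shows "integrable halfline (\<lambda>l. exp (- t * l\<^sup>2) *\<^sub>R (bessel_psi \<alpha> l x *\<^sub>R hankel_integral \<alpha> f l))"
proof -
  obtain a b where ab: "0 < a" "a < b" and f0: "\<And>x. x \<notin> {a..b} \<Longrightarrow> f x = 0"
    using f by (elim L2_compact_supportE) blast
  \<comment> \<open>Enlarging the right end to cover \<open>x\<close> lets a single majorant control
    both the eigenfunction at \<open>x\<close> and the transform of \<open>f\<close>.\<close>
  let ?b = "max b x"
  have f0': "f y = 0" if "y \<notin> {a..?b}" for y using that by (intro f0) (auto simp: le_max_iff_disj)
  have [measurable]: "hankel_integral \<alpha> f \<in> borel_measurable halfline" by (rule hankel_integral_measurable[OF f])
  have [measurable]: "(\<lambda>x. x) \<in> borel_measurable halfline" by (rule halfline_id_measurable)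
  show ?thesis
  proof (rule Bochner_Integration.integrable_bound)
    show "integrable halfline (\<lambda>l. (LINT x|halfline. norm (f x)) * (exp (- t * l\<^sup>2) * (psi_bound \<alpha> ?b l)\<^sup>2))"
      using psi_bound_sq_integrable[OF \<alpha>_gt t, of ?b] by simp
    show "AE l in halfline. norm (exp (- t * l\<^sup>2) *\<^sub>R (bessel_psi \<alpha> l x *\<^sub>R hankel_integral \<alpha> f l)) \<le>
        norm ((LINT x|halfline. norm (f x)) * (exp (- t * l\<^sup>2) * (psi_bound \<alpha> ?b l)\<^sup>2))"
    proof (rule AE_I2)
      fix l assume "l \<in> space halfline"
      then have l: "l > 0" by simp
      have "\<bar>bessel_psi \<alpha> l x\<bar> * norm (hankel_integral \<alpha> f l) \<le> psi_bound \<alpha> ?b l * (psi_bound \<alpha> ?b l * (LINT x|halfline. norm (f x)))"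
        using abs_bessel_psi_le[OF \<alpha> x _ l, of ?b] norm_hankel_integral_le[OF f f0' l] psi_bound_nonneg[OF \<alpha>_gt, of ?b l]
        by (intro mult_mono) auto
      then have "exp (- t * l\<^sup>2) * (\<bar>bessel_psi \<alpha> l x\<bar> * norm (hankel_integral \<alpha> f l)) \<le>
         exp (- t * l\<^sup>2) * (psi_bound \<alpha> ?b l * (psi_bound \<alpha> ?b l * (LINT x|halfline. norm (f x))))"
        by (intro mult_left_mono) auto
      also have "\<dots> = norm ((LINT x|halfline. norm (f x)) * (exp (- t * l\<^sup>2) * (psi_bound \<alpha> ?b l)\<^sup>2))"
        by (simp add: abs_mult power2_eq_square integral_nonneg_AE mult_ac)
      finally show "norm (exp (- t * l\<^sup>2) *\<^sub>R (bessel_psi \<alpha> l x *\<^sub>R hankel_integral \<alpha> f l)) \<le> \<dots>"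
        unfolding norm_scaleR abs_exp_cancel .
    qed
  qed measurable
qed

text \<open>Once the transform is written out, Fubini leaves the Gaussian integral of a product of
  eigenfunctions, which is the heat kernel. The identity holds at every \<open>x\<close>, so
  pointwise limits can be compared with it later.\<close>

lemma heat_hankel_eq_bessel_op:
  assumes f: "f \<in> L2_compact_support" and t: "t > 0" and x: "x > 0"
  shows "(LINT l|halfline. exp (- t * l\<^sup>2) *\<^sub>R (bessel_psi \<alpha> l x *\<^sub>R hankel_integral \<alpha> f l)) = bessel_op \<alpha> t f x"
proof -
  obtain a b where ab: "0 < a" "a < b" and f0: "\<And>x. x \<notin> {a..b} \<Longrightarrow> f x = 0"
    using f by (elim L2_compact_supportE) blast
  let ?b = "max b x"
  have fm[measurable]: "f \<in> borel_measurable halfline" using f by (rule L2_compact_support_measurable)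
  have [measurable]: "(\<lambda>x. x) \<in> borel_measurable halfline" by (rule halfline_id_measurable)
  let ?F = "\<lambda>l y. (exp (- t * l\<^sup>2) * (bessel_psi \<alpha> l x * bessel_psi \<alpha> l y)) *\<^sub>R f y"
  have fin: "(\<integral>\<^sup>+l. (\<integral>\<^sup>+y. ennreal (norm (?F l y)) \<partial>halfline) \<partial>halfline) < \<infinity>"
  proof -
    have "(\<integral>\<^sup>+l. (\<integral>\<^sup>+y. ennreal (norm (?F l y)) \<partial>halfline) \<partial>halfline) \<le>
      (\<integral>\<^sup>+l. (\<integral>\<^sup>+y. ennreal (exp (- t * l\<^sup>2) * (psi_bound \<alpha> ?b l)\<^sup>2) * ennreal (norm (f y)) \<partial>halfline) \<partial>halfline)"
    proof (intro nn_integral_mono)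
      fix l y assume "l \<in> space halfline" "y \<in> space halfline"
      then have l: "l > 0" and y: "y > 0" by auto
      have "norm (?F l y) \<le> exp (- t * l\<^sup>2) * (psi_bound \<alpha> ?b l)\<^sup>2 * norm (f y)"
      proof (cases "y \<in> {a..b}")
        case True
        then have "\<bar>bessel_psi \<alpha> l x\<bar> * \<bar>bessel_psi \<alpha> l y\<bar> \<le> psi_bound \<alpha> ?b l * psi_bound \<alpha> ?b l"
          using abs_bessel_psi_le[OF \<alpha> x _ l, of ?b] abs_bessel_psi_le[OF \<alpha> y _ l, of ?b] psi_bound_nonneg[OF \<alpha>_gt, of ?b l]
          by (intro mult_mono) auto
        then have "exp (- t * l\<^sup>2) * (\<bar>bessel_psi \<alpha> l x\<bar> * \<bar>bessel_psi \<alpha> l y\<bar>) * norm (f y) \<le> exp (- t * l\<^sup>2) * (psi_bound \<alpha> ?b l * psi_bound \<alpha> ?b l) * norm (f y)"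
          by (intro mult_right_mono mult_left_mono) auto
        then show ?thesis by (simp add: abs_mult power2_eq_square)
      qed (use f0 in auto)
      then show "ennreal (norm (?F l y)) \<le> ennreal (exp (- t * l\<^sup>2) * (psi_bound \<alpha> ?b l)\<^sup>2) * ennreal (norm (f y))"
        by (simp add: ennreal_mult''[symmetric] ennreal_leI)
    qed
    also have "\<dots> = (\<integral>\<^sup>+l. ennreal (exp (- t * l\<^sup>2) * (psi_bound \<alpha> ?b l)\<^sup>2) \<partial>halfline) * (\<integral>\<^sup>+y. ennreal (norm (f y)) \<partial>halfline)"
      by (simp add: nn_integral_cmult nn_integral_multc)
    also have "\<dots> < \<infinity>"
      using psi_bound_sq_integrable[OF \<alpha>_gt t, of ?b] L2_compact_support_integrable[OF f]
      by (simp add: integrable_iff_bounded ennreal_mult_less_top)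
    finally show ?thesis .
  qed
  have "(LINT l|halfline. exp (- t * l\<^sup>2) *\<^sub>R (bessel_psi \<alpha> l x *\<^sub>R hankel_integral \<alpha> f l)) = (LINT l|halfline. LINT y|halfline. ?F l y)"
    unfolding hankel_integral_def by (simp add: integral_scaleR_right[symmetric] del: integral_scaleR_right)
  also have "\<dots> = (LINT y|halfline. LINT l|halfline. ?F l y)"
    by (rule complex_Fubini(1)[OF sigma_finite_halfline _ fin]) measurable
  also have "\<dots> = bessel_op \<alpha> t f x"
    unfolding bessel_op_def
  proof (intro Bochner_Integration.integral_cong refl)
    fix y assume "y \<in> space halfline"
    then have y: "y > 0" by simp
    have h: "has_bochner_integral halfline (\<lambda>l. exp (- t * l\<^sup>2) * (bessel_psi \<alpha> l x * bessel_psi \<alpha> l y)) (bessel_kernel \<alpha> t x y)"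
      by (rule bessel_psi_heat[OF \<alpha>_gt x y t])
    have "(LINT l|halfline. ?F l y) = (LINT l|halfline. exp (- t * l\<^sup>2) * (bessel_psi \<alpha> l x * bessel_psi \<alpha> l y)) *\<^sub>R f y"
      by (rule integral_scaleR_left) (use h in \<open>simp add: has_bochner_integral_iff\<close>)
    then show "(LINT l|halfline. ?F l y) = bessel_kernel \<alpha> t x y *\<^sub>R f y" using h by (simp add: has_bochner_integral_iff)
  qed
  finally show ?thesis .
qed

text \<open>In |H f|^2 only the conjugate factor is written out as an integral. After Fubini the
  other factor stands under the integral over \<open>l\<close> that has just been evaluated as the
  kernel operator.\<close>

lemma heat_hankel_form:
  assumes f: "f \<in> L2_compact_support" and t: "t > 0"
  shows "(\<integral>\<^sup>+l. ennreal (exp (- t * l\<^sup>2) * (norm (hankel_integral \<alpha> f l))\<^sup>2) \<partial>halfline) =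
    ennreal (Re (LINT x|halfline. bessel_op \<alpha> t f x * cnj (f x)))"
proof -
  obtain a b where ab: "0 < a" "a < b" and f0: "\<And>x. x \<notin> {a..b} \<Longrightarrow> f x = 0"
    using f by (elim L2_compact_supportE) blast
  have fm[measurable]: "f \<in> borel_measurable halfline" using f by (rule L2_compact_support_measurable)
  have [measurable]: "(\<lambda>x. x) \<in> borel_measurable halfline" by (rule halfline_id_measurable)
  let ?H = "hankel_integral \<alpha> f"
  have Hm[measurable]: "?H \<in> borel_measurable halfline" by (rule hankel_integral_measurable[OF f])
  define I where "I = (LINT x|halfline. norm (f x))"
  have I: "I \<ge> 0" unfolding I_def by (rule integral_nonneg_AE) simp
  let ?F = "\<lambda>l x. (exp (- t * l\<^sup>2) * bessel_psi \<alpha> l x) *\<^sub>R (?H l * cnj (f x))"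
  have fin: "(\<integral>\<^sup>+l. (\<integral>\<^sup>+x. ennreal (norm (?F l x)) \<partial>halfline) \<partial>halfline) < \<infinity>"
  proof -
    have "(\<integral>\<^sup>+l. (\<integral>\<^sup>+x. ennreal (norm (?F l x)) \<partial>halfline) \<partial>halfline) \<le>
      (\<integral>\<^sup>+l. (\<integral>\<^sup>+x. ennreal (I * (exp (- t * l\<^sup>2) * (psi_bound \<alpha> b l)\<^sup>2)) * ennreal (norm (f x)) \<partial>halfline) \<partial>halfline)"
    proof (intro nn_integral_mono)
      fix l x assume "l \<in> space halfline" "x \<in> space halfline"
      then have l: "l > 0" and x: "x > 0" by auto
      have "norm (?F l x) \<le> I * (exp (- t * l\<^sup>2) * (psi_bound \<alpha> b l)\<^sup>2) * norm (f x)"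
      proof (cases "x \<in> {a..b}")
        case True
        then have "\<bar>bessel_psi \<alpha> l x\<bar> * norm (?H l) \<le> psi_bound \<alpha> b l * (psi_bound \<alpha> b l * I)"
          using abs_bessel_psi_le[OF \<alpha> x _ l, of b] norm_hankel_integral_le[OF f f0 l] psi_bound_nonneg[OF \<alpha>_gt, of b l]
          by (intro mult_mono) (auto simp: I_def)
        then have "exp (- t * l\<^sup>2) * (\<bar>bessel_psi \<alpha> l x\<bar> * norm (?H l)) * norm (f x) \<le> exp (- t * l\<^sup>2) * (psi_bound \<alpha> b l * (psi_bound \<alpha> b l * I)) * norm (f x)"
          by (intro mult_right_mono mult_left_mono) auto
        then show ?thesis by (simp add: norm_mult abs_mult power2_eq_square mult_ac)
      qed (use f0 in auto)
      then show "ennreal (norm (?F l x)) \<le> ennreal (I * (exp (- t * l\<^sup>2) * (psi_bound \<alpha> b l)\<^sup>2)) * ennreal (norm (f x))"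
        by (simp add: ennreal_mult''[symmetric] ennreal_leI)
    qed
    also have "\<dots> = (\<integral>\<^sup>+l. ennreal (I * (exp (- t * l\<^sup>2) * (psi_bound \<alpha> b l)\<^sup>2)) \<partial>halfline) * (\<integral>\<^sup>+x. ennreal (norm (f x)) \<partial>halfline)"
      by (simp add: nn_integral_cmult nn_integral_multc)
    also have "(\<integral>\<^sup>+l. ennreal (I * (exp (- t * l\<^sup>2) * (psi_bound \<alpha> b l)\<^sup>2)) \<partial>halfline) = ennreal I * (\<integral>\<^sup>+l. ennreal (exp (- t * l\<^sup>2) * (psi_bound \<alpha> b l)\<^sup>2) \<partial>halfline)"
      unfolding ennreal_mult'[OF I] by (rule nn_integral_cmult) measurable
    also have "\<dots> * (\<integral>\<^sup>+x. ennreal (norm (f x)) \<partial>halfline) < \<infinity>"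
      using psi_bound_sq_integrable[OF \<alpha>_gt t, of b] L2_compact_support_integrable[OF f]
      by (simp add: integrable_iff_bounded ennreal_mult_less_top)
    finally show ?thesis .
  qed
  have inner: "(LINT x|halfline. ?F l x) = complex_of_real (exp (- t * l\<^sup>2) * (norm (?H l))\<^sup>2)" for l
  proof -
    have "cnj (?H l) = (LINT x|halfline. cnj (bessel_psi \<alpha> l x *\<^sub>R f x))"
      unfolding hankel_integral_def by (rule Bochner_Integration.integral_cnj[symmetric])
    then have "exp (- t * l\<^sup>2) *\<^sub>R (?H l * cnj (?H l)) = (LINT x|halfline. exp (- t * l\<^sup>2) *\<^sub>R (?H l * cnj (bessel_psi \<alpha> l x *\<^sub>R f x)))"
      by (simp only: integral_scaleR_right integral_mult_right_zero)
    also have "\<dots> = (LINT x|halfline. ?F l x)"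
      by (intro Bochner_Integration.integral_cong refl) (simp add: scaleR_conv_of_real mult_ac)
    finally have "(LINT x|halfline. ?F l x) = exp (- t * l\<^sup>2) *\<^sub>R (?H l * cnj (?H l))" ..
    moreover have "?H l * cnj (?H l) = complex_of_real ((norm (?H l))\<^sup>2)"
      by (rule complex_norm_square[symmetric])
    ultimately show ?thesis by (simp only: scaleR_conv_of_real of_real_mult)
  qed
  have F1: "(LINT l|halfline. LINT x|halfline. ?F l x) = (LINT x|halfline. LINT l|halfline. ?F l x)"
    and F2: "integrable halfline (\<lambda>l. LINT x|halfline. ?F l x)"
    by (rule complex_Fubini[OF sigma_finite_halfline _ fin], measurable)+
  have "(LINT x|halfline. LINT l|halfline. ?F l x) = (LINT x|halfline. bessel_op \<alpha> t f x * cnj (f x))"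
  proof (intro Bochner_Integration.integral_cong refl)
    fix x assume "x \<in> space halfline"
    then have x: "x > 0" by simp
    have "bessel_op \<alpha> t f x * cnj (f x) = (LINT l|halfline. exp (- t * l\<^sup>2) *\<^sub>R (bessel_psi \<alpha> l x *\<^sub>R ?H l) * cnj (f x))"
      unfolding heat_hankel_eq_bessel_op[OF f t x, symmetric] by (simp only: integral_mult_left_zero)
    also have "\<dots> = (LINT l|halfline. ?F l x)"
      by (intro Bochner_Integration.integral_cong refl) (simp add: scaleR_conv_of_real mult_ac)
    finally show "(LINT l|halfline. ?F l x) = bessel_op \<alpha> t f x * cnj (f x)" ..
  qed
  with F1 have "(LINT x|halfline. bessel_op \<alpha> t f x * cnj (f x)) = (LINT l|halfline. complex_of_real (exp (- t * l\<^sup>2) * (norm (?H l))\<^sup>2))"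
    unfolding inner by simp
  also have "\<dots> = complex_of_real (LINT l|halfline. exp (- t * l\<^sup>2) * (norm (?H l))\<^sup>2)" by (rule integral_complex_of_real)
  finally have R: "Re (LINT x|halfline. bessel_op \<alpha> t f x * cnj (f x)) = (LINT l|halfline. exp (- t * l\<^sup>2) * (norm (?H l))\<^sup>2)" by simp
  have "integrable halfline (\<lambda>l. exp (- t * l\<^sup>2) * (norm (?H l))\<^sup>2)"
    using integrable_Re[OF F2] unfolding inner by simp
  then show ?thesis unfolding R by (intro nn_integral_eq_integral) auto
qed

text \<open>The isometry has to be shown for functions of compact support that need not be
  continuous. Strong convergence gives the convergence of the form, with the weighted inequality |w
  f| \<le> |w|^2 / d + d |f|^2 in the role of Cauchy-Schwarz.\<close>

lemma bessel_form_tendsto_L2: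
  assumes f: "f \<in> Lp 2 halfline"
  shows "((\<lambda>t. Re (LINT x|halfline. bessel_op \<alpha> t f x * cnj (f x))) \<longlongrightarrow> Re (LINT x|halfline. f x * cnj (f x))) (at_right 0)"
proof (rule tendstoI)
  fix e :: real assume e: "e > 0"
  have fm[measurable]: "f \<in> borel_measurable halfline" using f by (simp add: in_L2_iff)
  obtain N where N: "sq_norm halfline f = ennreal N" "N \<ge> 0"
    using f by (cases "sq_norm halfline f") (auto simp: in_L2_iff)
  \<comment> \<open>Chosen so that d times the squared norm of \<open>f\<close> is at most e / 2;
    the first term will contribute e / 4, in total 3 e / 4.\<close>
  define d where "d = e / (2 * (N + 1))"
  have d: "d > 0" "d * N \<le> e / 2" using e N by (auto simp: d_def field_simps)
  have "\<forall>\<^sub>F t in at_right 0. sq_norm halfline (\<lambda>x. bessel_op \<alpha> t f x - f x) < ennreal (d * (e / 4))"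
    using order_tendstoD(2)[OF bessel_op_tendsto[OF \<alpha> f]] e d by simp
  then show "\<forall>\<^sub>F t in at_right 0. dist (Re (LINT x|halfline. bessel_op \<alpha> t f x * cnj (f x))) (Re (LINT x|halfline. f x * cnj (f x))) < e"
    using eventually_at_right_less[of "0::real"]
  proof eventually_elim
    case (elim t)
    interpret S: schur_kernel halfline "bessel_kernel \<alpha> t" "mass_bound \<alpha>" by (rule schur_kernel_bessel[OF \<alpha> elim(2)])
    have uL: "bessel_op \<alpha> t f \<in> Lp 2 halfline" using S.op_in_Lp[OF one_le_2_ennreal f] by (simp add: bessel_op_eq[OF \<alpha> elim(2)])
    have [measurable]: "bessel_op \<alpha> t f \<in> borel_measurable halfline" using uL by (simp add: in_L2_iff)
    let ?w = "\<lambda>x. bessel_op \<alpha> t f x - f x"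
    have wL: "?w \<in> Lp 2 halfline" by (rule L2_diff[OF uL f])
    have i: "integrable halfline (\<lambda>x. ?w x * cnj (f x))" by (rule L2_product_integrable[OF wL f])
    have "(LINT x|halfline. bessel_op \<alpha> t f x * cnj (f x)) - (LINT x|halfline. f x * cnj (f x)) = (LINT x|halfline. ?w x * cnj (f x))"
      using L2_product_integrable[OF uL f] L2_product_integrable[OF f f]
      by (simp add: left_diff_distrib)
    then have d1: "dist (Re (LINT x|halfline. bessel_op \<alpha> t f x * cnj (f x))) (Re (LINT x|halfline. f x * cnj (f x))) \<le> norm (LINT x|halfline. ?w x * cnj (f x))"
      by (metis abs_Re_le_cmod dist_real_def minus_complex.simps(1))
    have "ennreal (norm (LINT x|halfline. ?w x * cnj (f x))) \<le> (\<integral>\<^sup>+x. ennreal (norm (?w x * cnj (f x))) \<partial>halfline)"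
      by (rule integral_norm_bound_ennreal[OF i])
    also have "\<dots> \<le> (\<integral>\<^sup>+x. ennreal (1 / d) * ennreal ((norm (?w x))\<^sup>2) + ennreal d * ennreal ((norm (f x))\<^sup>2) \<partial>halfline)"
    proof (intro nn_integral_mono)
      fix x
      have sq: "(sqrt (1 / d))\<^sup>2 = 1 / d" "(sqrt d)\<^sup>2 = d" "sqrt (1 / d) * sqrt d = 1"
        using d by (auto simp: real_sqrt_mult[symmetric])
      have "2 * (sqrt (1 / d) * norm (?w x)) * (sqrt d * norm (f x)) \<le> (sqrt (1 / d) * norm (?w x))\<^sup>2 + (sqrt d * norm (f x))\<^sup>2"
        by (rule sum_squares_bound)
      also have "2 * (sqrt (1 / d) * norm (?w x)) * (sqrt d * norm (f x)) = 2 * (sqrt (1 / d) * sqrt d) * (norm (?w x) * norm (f x))" by simp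
      also have "\<dots> = 2 * (norm (?w x) * norm (f x))" unfolding sq by simp
      finally have "2 * (norm (?w x) * norm (f x)) \<le> 1 / d * (norm (?w x))\<^sup>2 + d * (norm (f x))\<^sup>2"
        unfolding power_mult_distrib sq .
      moreover have "0 \<le> norm (?w x) * norm (f x)" by simp
      ultimately have "norm (?w x * cnj (f x)) \<le> 1 / d * (norm (?w x))\<^sup>2 + d * (norm (f x))\<^sup>2"
        unfolding norm_mult complex_mod_cnj by linarith
      from ennreal_leI[OF this] show "ennreal (norm (?w x * cnj (f x))) \<le> ennreal (1 / d) * ennreal ((norm (?w x))\<^sup>2) + ennreal d * ennreal ((norm (f x))\<^sup>2)"
        using d by (subst (asm) ennreal_plus, simp, simp) (simp only: ennreal_mult''[OF zero_le_power2])
    qed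
    also have "\<dots> = ennreal (1 / d) * sq_norm halfline ?w + ennreal d * sq_norm halfline f"
      unfolding sq_norm_def by (subst nn_integral_add) (auto simp: nn_integral_cmult)
    also have "\<dots> \<le> ennreal (1 / d) * ennreal (d * (e / 4)) + ennreal d * ennreal N"
      using elim(1) N by (intro add_mono mult_left_mono) auto
    also have "\<dots> = ennreal (e / 4 + d * N)" using d e N by (simp add: ennreal_mult''[symmetric] ennreal_plus[symmetric] del: ennreal_plus)
    also have "\<dots> \<le> ennreal (3 / 4 * e)" using d by (intro ennreal_leI) linarith
    finally have "norm (LINT x|halfline. ?w x * cnj (f x)) \<le> 3 / 4 * e" using e by (subst (asm) ennreal_le_iff) auto
    then show ?case using d1 e by linarith
  qed
qed

text \<open>As t decreases to 0, the damped integrals of |H f|^2 increase. Monotone convergence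
  applies although the square integrability of H f is not known beforehand; it is part of the
  conclusion.\<close>

lemma hankel_isometry:
  assumes f: "f \<in> L2_compact_support"
  shows "sq_norm halfline (hankel_integral \<alpha> f) = sq_norm halfline f"
proof -
  have fL: "f \<in> Lp 2 halfline" using f by (auto elim: L2_compact_supportE)
  let ?H = "hankel_integral \<alpha> f"
  have [measurable]: "?H \<in> borel_measurable halfline" by (rule hankel_integral_measurable[OF f])
  have [measurable]: "(\<lambda>x. x) \<in> borel_measurable halfline" by (rule halfline_id_measurable)
  let ?t = "\<lambda>n. inverse (real (Suc n))"
  let ?u = "\<lambda>n l. ennreal (exp (- ?t n * l\<^sup>2) * (norm (?H l))\<^sup>2)"
  have t0: "filterlim ?t (at_right 0) sequentially"
    using LIMSEQ_inverse_real_of_nat by (auto simp: filterlim_at)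
  have inc: "incseq (\<lambda>n. ?u n l)" for l
  proof (intro incseq_SucI ennreal_leI mult_right_mono)
    fix n
    have "?t (Suc n) * l\<^sup>2 \<le> ?t n * l\<^sup>2" by (intro mult_right_mono le_imp_inverse_le) auto
    then show "exp (- ?t n * l\<^sup>2) \<le> exp (- ?t (Suc n) * l\<^sup>2)" by simp
  qed simp
  have lim: "(\<lambda>n. ?u n l) \<longlonglongrightarrow> ennreal ((norm (?H l))\<^sup>2)" for l
  proof -
    have "(\<lambda>n. exp (- ?t n * l\<^sup>2) * (norm (?H l))\<^sup>2) \<longlonglongrightarrow> exp (- 0 * l\<^sup>2) * (norm (?H l))\<^sup>2"
      by (intro tendsto_intros LIMSEQ_inverse_real_of_nat)
    then show ?thesis by (intro tendsto_ennrealI) simp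
  qed
  have "(\<lambda>n. (\<integral>\<^sup>+l. ?u n l \<partial>halfline)) \<longlonglongrightarrow> (\<integral>\<^sup>+l. ennreal ((norm (?H l))\<^sup>2) \<partial>halfline)"
    by (rule nn_integral_LIMSEQ) (use inc lim in \<open>auto simp: incseq_def le_fun_def\<close>)
  moreover have "(\<lambda>n. (\<integral>\<^sup>+l. ?u n l \<partial>halfline)) \<longlonglongrightarrow> ennreal (Re (LINT x|halfline. f x * cnj (f x)))"
    unfolding heat_hankel_form[OF f positive_imp_inverse_positive[OF of_nat_0_less_iff[THEN iffD2, OF zero_less_Suc]]]
    by (intro tendsto_ennrealI filterlim_compose[OF bessel_form_tendsto_L2[OF fL] t0])
  ultimately show ?thesis
    unfolding sq_norm_eq_inner[OF fL] unfolding sq_norm_def by (rule LIMSEQ_unique)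
qed

lemma hankel_integral_in_L2: "f \<in> L2_compact_support \<Longrightarrow> hankel_integral \<alpha> f \<in> Lp 2 halfline"
  using hankel_isometry hankel_integral_measurable by (auto simp: in_L2_iff elim: L2_compact_supportE)

lemma sq_norm_hankel_diff:
  assumes f: "f \<in> L2_compact_support" and g: "g \<in> L2_compact_support"
  shows "sq_norm halfline (\<lambda>l. hankel_integral \<alpha> f l - hankel_integral \<alpha> g l) = sq_norm halfline (\<lambda>x. f x - g x)"
proof -
  have "sq_norm halfline (\<lambda>l. hankel_integral \<alpha> f l - hankel_integral \<alpha> g l) = sq_norm halfline (hankel_integral \<alpha> (\<lambda>x. f x - g x))"
    by (rule sq_norm_cong_AE, rule AE_I2) (simp add: hankel_integral_diff[OF f g])
  then show ?thesis using hankel_isometry[OF L2_compact_support_diff[OF f g]] by simp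
qed

section \<open>Extension of the transform by continuity\<close>

lemma is_hankel_iff:
  "is_hankel \<alpha> f g \<longleftrightarrow> f \<in> Lp 2 halfline \<and> g \<in> Lp 2 halfline \<and>
    (\<exists>F :: nat \<Rightarrow> real \<Rightarrow> complex. (\<forall>n. F n \<in> L2_compact_support) \<and>
      (\<lambda>n. sq_norm halfline (\<lambda>x. F n x - f x)) \<longlonglongrightarrow> 0 \<and>
      (\<lambda>n. sq_norm halfline (\<lambda>l. hankel_integral \<alpha> (F n) l - g l)) \<longlonglongrightarrow> 0)"
proof -
  have "(\<lambda>n. Lp_norm 2 halfline (\<lambda>x. F n x - f x)) \<longlonglongrightarrow> 0 \<longleftrightarrow> (\<lambda>n. sq_norm halfline (\<lambda>x. F n x - f x)) \<longlonglongrightarrow> 0"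
    and "(\<lambda>n. Lp_norm 2 halfline (\<lambda>l. hankel_integral \<alpha> (F n) l - g l)) \<longlonglongrightarrow> 0 \<longleftrightarrow> (\<lambda>n. sq_norm halfline (\<lambda>l. hankel_integral \<alpha> (F n) l - g l)) \<longlonglongrightarrow> 0"
    if "f \<in> Lp 2 halfline" "g \<in> Lp 2 halfline" "\<forall>n. F n \<in> L2_compact_support" for F :: "nat \<Rightarrow> real \<Rightarrow> complex"
    using that L2_compact_support_measurable[of "F _"] hankel_integral_measurable[of "F _"]
    by (auto intro!: Lp_norm_2_tendsto_0_iff always_eventually borel_measurable_diff simp: in_L2_iff)
  then show ?thesis unfolding is_hankel_def by blast
qed

lemma is_hankel_compact:
  assumes "f \<in> L2_compact_support"
  shows "is_hankel \<alpha> f (hankel_integral \<alpha> f)"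
  unfolding is_hankel_iff using assms hankel_integral_in_L2[OF assms]
  by (auto simp: sq_norm_def elim: L2_compact_supportE intro!: exI[of _ "\<lambda>_. f"])

text \<open>Four nested squared triangle inequalities around the isometry on the dense subspace give
  the factor 2^4. For f = f' the bound says that two representatives of the transform agree almost
  everywhere.\<close>

lemma is_hankel_diff_bound:
  assumes h: "is_hankel \<alpha> f g" and h': "is_hankel \<alpha> f' g'"
  shows "sq_norm halfline (\<lambda>l. g l - g' l) \<le> 16 * sq_norm halfline (\<lambda>x. f x - f' x)"
proof -
  let ?s = "sq_norm halfline" and ?H = "hankel_integral \<alpha>"
  obtain F where F: "\<And>n. F n \<in> L2_compact_support" "(\<lambda>n. ?s (\<lambda>x. F n x - f x)) \<longlonglongrightarrow> 0" "(\<lambda>n. ?s (\<lambda>l. ?H (F n) l - g l)) \<longlonglongrightarrow> 0"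
    using h unfolding is_hankel_iff by blast
  obtain F' where F': "\<And>n. F' n \<in> L2_compact_support" "(\<lambda>n. ?s (\<lambda>x. F' n x - f' x)) \<longlonglongrightarrow> 0" "(\<lambda>n. ?s (\<lambda>l. ?H (F' n) l - g' l)) \<longlonglongrightarrow> 0"
    using h' unfolding is_hankel_iff by blast
  have [measurable]: "f \<in> borel_measurable halfline" "g \<in> borel_measurable halfline" "f' \<in> borel_measurable halfline" "g' \<in> borel_measurable halfline"
    using h h' unfolding is_hankel_iff by (auto simp: in_L2_iff)
  have [measurable]: "F n \<in> borel_measurable halfline" "F' n \<in> borel_measurable halfline"
    "?H (F n) \<in> borel_measurable halfline" "?H (F' n) \<in> borel_measurable halfline" for n
    using F(1) F'(1) by (auto intro: L2_compact_support_measurable hankel_integral_measurable)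
  let ?A = "\<lambda>n. 2 * ?s (\<lambda>l. ?H (F n) l - g l) + 2 * (2 * (2 * ?s (\<lambda>x. F n x - f x) + 2 * (2 * ?s (\<lambda>x. f x - f' x) + 2 * ?s (\<lambda>x. F' n x - f' x))) + 2 * ?s (\<lambda>l. ?H (F' n) l - g' l))"
  have le: "?s (\<lambda>l. g l - g' l) \<le> ?A n" for n
  proof -
    have "?s (\<lambda>l. g l - g' l) \<le> 2 * ?s (\<lambda>l. g l - ?H (F n) l) + 2 * ?s (\<lambda>l. ?H (F n) l - g' l)"
      by (rule sq_norm_diff_triangle) measurable
    also have "?s (\<lambda>l. g l - ?H (F n) l) = ?s (\<lambda>l. ?H (F n) l - g l)" by (rule sq_norm_minus)
    also have "?s (\<lambda>l. ?H (F n) l - g' l) \<le> 2 * ?s (\<lambda>l. ?H (F n) l - ?H (F' n) l) + 2 * ?s (\<lambda>l. ?H (F' n) l - g' l)"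
      by (rule sq_norm_diff_triangle) measurable
    also have "?s (\<lambda>l. ?H (F n) l - ?H (F' n) l) = ?s (\<lambda>x. F n x - F' n x)"
      by (rule sq_norm_hankel_diff[OF F(1) F'(1)])
    also have "?s (\<lambda>x. F n x - F' n x) \<le> 2 * ?s (\<lambda>x. F n x - f x) + 2 * ?s (\<lambda>x. f x - F' n x)"
      by (rule sq_norm_diff_triangle) measurable
    also have "?s (\<lambda>x. f x - F' n x) \<le> 2 * ?s (\<lambda>x. f x - f' x) + 2 * ?s (\<lambda>x. f' x - F' n x)"
      by (rule sq_norm_diff_triangle) measurable
    also have "?s (\<lambda>x. f' x - F' n x) = ?s (\<lambda>x. F' n x - f' x)" by (rule sq_norm_minus)
    finally show ?thesis by (simp add: add_left_mono mult_left_mono)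
  qed
  have "?A \<longlonglongrightarrow> 2 * 0 + 2 * (2 * (2 * 0 + 2 * (2 * ?s (\<lambda>x. f x - f' x) + 2 * 0)) + 2 * 0)"
    by (intro tendsto_add ennreal_tendsto_cmult tendsto_const F F') auto
  then have "?s (\<lambda>l. g l - g' l) \<le> 2 * 0 + 2 * (2 * (2 * 0 + 2 * (2 * ?s (\<lambda>x. f x - f' x) + 2 * 0)) + 2 * 0)"
    by (rule LIMSEQ_le_const) (use le in auto)
  then show ?thesis by (simp add: mult.assoc[symmetric])
qed

lemma sq_norm_diff_0D:
  assumes "sq_norm M (\<lambda>x. f x - g x) = 0" "f \<in> borel_measurable M" "g \<in> borel_measurable M"
  shows "AE x in M. f x = g x"
proof -
  note [measurable] = assms(2,3)
  have "AE x in M. ennreal ((norm (f x - g x))\<^sup>2) = 0"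
    using assms(1) unfolding sq_norm_def by (subst (asm) nn_integral_0_iff_AE) auto
  then show ?thesis by eventually_elim simp
qed

text \<open>The isometry carries a rapidly convergent approximation of \<open>f\<close> to a rapidly
  Cauchy sequence of transforms. The quarter in the approximation error offsets the two factors 2 of
  the squared triangle inequality.\<close>

lemma is_hankel_exists:
  assumes f: "f \<in> Lp 2 halfline"
  shows "\<exists>g. is_hankel \<alpha> f g"
proof -
  let ?s = "sq_norm halfline" and ?H = "hankel_integral \<alpha>"
  have [measurable]: "f \<in> borel_measurable halfline" using f by (simp add: in_L2_iff)
  have "\<forall>n. \<exists>g. L2_nice g \<and> ?s (\<lambda>x. g x - f x) \<le> ennreal ((1 / 8) ^ n / 4)"
  proof
    fix n
    have "(1 / 8) ^ n / 4 > (0::real)" by simp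
    from L2_nice_dense[OF f this] show "\<exists>g. L2_nice g \<and> ?s (\<lambda>x. g x - f x) \<le> ennreal ((1 / 8) ^ n / 4)" by blast
  qed
  then obtain F where F: "\<And>n. L2_nice (F n)" "\<And>n. ?s (\<lambda>x. F n x - f x) \<le> ennreal ((1 / 8) ^ n / 4)" by metis
  have Fc: "F n \<in> L2_compact_support" for n using F(1) by (rule L2_nice_compact_support)
  have [measurable]: "F n \<in> borel_measurable halfline" for n using Fc by (rule L2_compact_support_measurable)
  have C: "?s (\<lambda>l. ?H (F m) l - ?H (F n) l) \<le> ennreal ((1 / 8) ^ n)" if "n \<le> m" for n m
  proof -
    have "?s (\<lambda>l. ?H (F m) l - ?H (F n) l) = ?s (\<lambda>x. F m x - F n x)" by (rule sq_norm_hankel_diff[OF Fc Fc])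
    also have "\<dots> \<le> 2 * ?s (\<lambda>x. F m x - f x) + 2 * ?s (\<lambda>x. f x - F n x)"
      by (rule sq_norm_diff_triangle) measurable
    also have "?s (\<lambda>x. f x - F n x) = ?s (\<lambda>x. F n x - f x)" by (rule sq_norm_minus)
    also have "2 * ?s (\<lambda>x. F m x - f x) + 2 * ?s (\<lambda>x. F n x - f x) \<le> 2 * ennreal ((1 / 8) ^ n / 4) + 2 * ennreal ((1 / 8) ^ n / 4)"
    proof (intro add_mono mult_left_mono F(2))
      have "(1 / 8 :: real) ^ m \<le> (1 / 8) ^ n" using that by (intro power_decreasing) auto
      then show "?s (\<lambda>x. F m x - f x) \<le> ennreal ((1 / 8) ^ n / 4)"
        by (intro order_trans[OF F(2)] ennreal_leI) simp
    qed auto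
    also have "\<dots> = ennreal ((1 / 8) ^ n)"
    proof -
      have two: "2 * ennreal r = ennreal (2 * r)" for r by (simp add: ennreal_mult')
      show ?thesis unfolding two by (simp add: ennreal_plus[symmetric] del: ennreal_plus)
    qed
    finally show ?thesis .
  qed
  obtain g where g: "g \<in> Lp 2 halfline" "(\<lambda>n. ?s (\<lambda>l. ?H (F n) l - g l)) \<longlonglongrightarrow> 0"
    using L2_rapidly_Cauchy_converges[of "\<lambda>n. ?H (F n)" halfline] hankel_integral_in_L2[OF Fc] C by blast
  have "(\<lambda>n. ?s (\<lambda>x. F n x - f x)) \<longlonglongrightarrow> 0"
  proof (rule tendsto_sandwich[OF _ _ tendsto_const])
    have "(\<lambda>n. ennreal ((1 / 8) ^ n / 4)) \<longlonglongrightarrow> ennreal (0 / 4)"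
      by (intro tendsto_ennrealI tendsto_divide LIMSEQ_power_zero tendsto_const) auto
    then show "(\<lambda>n. ennreal ((1 / 8) ^ n / 4)) \<longlonglongrightarrow> 0" by simp
  qed (use F(2) in auto)
  then show ?thesis unfolding is_hankel_iff using f g Fc by blast
qed

lemma is_hankel_hankel: "f \<in> Lp 2 halfline \<Longrightarrow> is_hankel \<alpha> f (hankel \<alpha> f)"
  unfolding hankel_def by (rule someI_ex[OF is_hankel_exists])

lemma sq_norm_exp_le: "t \<ge> 0 \<Longrightarrow> sq_norm M (\<lambda>l. exp (- t * (h l)\<^sup>2) *\<^sub>R g l) \<le> sq_norm M g"
  unfolding sq_norm_def
  by (intro nn_integral_mono ennreal_leI power_mono) (auto intro!: mult_left_le_one_le)

lemma exp_mult_in_L2: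
  assumes g: "g \<in> Lp 2 halfline" and t: "t \<ge> 0"
  shows "(\<lambda>l. exp (- t * l\<^sup>2) *\<^sub>R g l) \<in> Lp 2 halfline"
proof -
  have [measurable]: "g \<in> borel_measurable halfline" using g by (simp add: in_L2_iff)
  have [measurable]: "(\<lambda>x. x) \<in> borel_measurable halfline" by (rule halfline_id_measurable)
  have "(\<lambda>l. exp (- t * l\<^sup>2) *\<^sub>R g l) \<in> borel_measurable halfline" by measurable
  then show ?thesis using sq_norm_exp_le[OF t, of halfline "\<lambda>l. l" g] g by (auto simp: in_L2_iff intro: order.strict_trans1)
qed

text \<open>The transform of the truncations converges pointwise to the heat kernel integral and in the
  mean to the Hankel transform; by Fatou's lemma the two limits agree.\<close>

lemma is_hankel_heat_compact:
  assumes f: "f \<in> L2_compact_support" and t: "t > 0"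
    and V: "is_hankel \<alpha> (\<lambda>l. exp (- t * l\<^sup>2) *\<^sub>R hankel_integral \<alpha> f l) V"
  shows "AE x in halfline. bessel_op \<alpha> t f x = V x"
proof -
  let ?s = "sq_norm halfline" and ?H = "hankel_integral \<alpha>"
  let ?u = "\<lambda>l. exp (- t * l\<^sup>2) *\<^sub>R ?H f l"
  \<comment> \<open>Cutting off near 0 and near infinity puts the damped transform into the space on
    which the transform is given by the integral.\<close>
  let ?U = "\<lambda>n l. if l \<in> {1 / real (n + 2)..real (n + 2)} then ?u l else 0"
  have [measurable]: "(\<lambda>x. x) \<in> borel_measurable halfline" by (rule halfline_id_measurable)
  have uL: "?u \<in> Lp 2 halfline" using exp_mult_in_L2[OF hankel_integral_in_L2[OF f]] t by simp
  have um[measurable]: "?u \<in> borel_measurable halfline" using uL by (simp add: in_L2_iff)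
  have Um[measurable]: "?U n \<in> borel_measurable halfline" for n by measurable
  have UL: "?U n \<in> L2_compact_support" for n
  proof -
    have "?U n \<in> Lp 2 halfline" by (rule L2_mono[OF Um uL]) auto
    moreover have "1 / real (n + 2) < real (n + 2)"
    proof -
      have "1 / real (n + 2) \<le> 1" "1 < real (n + 2)" by auto
      then show ?thesis by linarith
    qed
    moreover have "0 < 1 / real (n + 2)" by simp
    ultimately show ?thesis unfolding L2_compact_support_def by (intro CollectI conjI exI) auto
  qed
  have HUm[measurable]: "?H (?U n) \<in> borel_measurable halfline" for n by (rule hankel_integral_measurable[OF UL])
  have Vm[measurable]: "V \<in> borel_measurable halfline" using V by (simp add: is_hankel_iff in_L2_iff)
  have fm[measurable]: "f \<in> borel_measurable halfline" using f by (rule L2_compact_support_measurable)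
  have om[measurable]: "bessel_op \<alpha> t f \<in> borel_measurable halfline"
    using schur_kernel.op_measurable[OF schur_kernel_bessel[OF \<alpha> t] fm] by (simp add: bessel_op_eq[OF \<alpha> t])
  have ev: "\<forall>\<^sub>F n in sequentially. ?U n l = ?u l" if "l > 0" for l
    using eventually_in_exhaustion[OF that] by eventually_elim simp
  have lim: "(\<lambda>n. ?H (?U n) x) \<longlonglongrightarrow> bessel_op \<alpha> t f x" if x: "x > 0" for x
  proof -
    let ?g = "\<lambda>l. exp (- t * l\<^sup>2) *\<^sub>R (bessel_psi \<alpha> l x *\<^sub>R ?H f l)"
    have gm[measurable]: "?g \<in> borel_measurable halfline" using hankel_integral_measurable[OF f] by measurable
    \<comment> \<open>The transform is now taken in the variable \<open>l\<close> and evaluated at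
      \<open>x\<close>; the eigenfunctions are symmetric in both variables, so the integrand is the
      one of the heat identity.\<close>
    have "(\<lambda>n. LINT l|halfline. bessel_psi \<alpha> x l *\<^sub>R ?U n l) \<longlonglongrightarrow> (LINT l|halfline. ?g l)"
    proof (rule integral_dominated_convergence[where w = "\<lambda>l. norm (?g l)"])
      show "integrable halfline (\<lambda>l. norm (?g l))" using heat_hankel_integrable[OF f t x] by (rule integrable_norm)
      show "AE l in halfline. (\<lambda>n. bessel_psi \<alpha> x l *\<^sub>R ?U n l) \<longlonglongrightarrow> ?g l"
      proof (rule AE_I2)
        fix l assume "l \<in> space halfline"
        then have "l > 0" by simp
        from ev[OF this] have "\<forall>\<^sub>F n in sequentially. bessel_psi \<alpha> x l *\<^sub>R ?U n l = ?g l"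
        proof eventually_elim
          case (elim n)
          show ?case unfolding elim by (simp add: bessel_psi_commute[of \<alpha> x] mult.commute)
        qed
        then show "(\<lambda>n. bessel_psi \<alpha> x l *\<^sub>R ?U n l) \<longlonglongrightarrow> ?g l" by (rule tendsto_eventually)
      qed
      show "AE l in halfline. norm (bessel_psi \<alpha> x l *\<^sub>R ?U n l) \<le> norm (?g l)" for n
        by (rule AE_I2) (simp add: bessel_psi_commute[of \<alpha> x] abs_mult mult_ac)
    qed measurable
    then show ?thesis unfolding hankel_integral_def[of \<alpha> "?U _" x] heat_hankel_eq_bessel_op[OF f t x] .
  qed
  have Ulim: "(\<lambda>n. ?s (\<lambda>l. ?U n l - ?u l)) \<longlonglongrightarrow> 0"
  proof -
    have "(\<lambda>n. (\<integral>\<^sup>+l. ennreal ((norm (?U n l - ?u l))\<^sup>2) \<partial>halfline)) \<longlonglongrightarrow> (\<integral>\<^sup>+l. 0 \<partial>halfline)"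
    proof (rule nn_integral_dominated_convergence[where w = "\<lambda>l. ennreal ((norm (?u l))\<^sup>2)"])
      show "(\<integral>\<^sup>+l. ennreal ((norm (?u l))\<^sup>2) \<partial>halfline) < \<infinity>" using uL by (simp add: in_L2_iff sq_norm_def)
      show "AE l in halfline. (\<lambda>n. ennreal ((norm (?U n l - ?u l))\<^sup>2)) \<longlonglongrightarrow> 0"
      proof (rule AE_I2)
        fix l assume "l \<in> space halfline"
        then have "l > 0" by simp
        from ev[OF this] have "\<forall>\<^sub>F n in sequentially. ennreal ((norm (?U n l - ?u l))\<^sup>2) = 0"
        proof eventually_elim
          case (elim n)
          show ?case unfolding elim by simp
        qed
        then show "(\<lambda>n. ennreal ((norm (?U n l - ?u l))\<^sup>2)) \<longlonglongrightarrow> 0" by (rule tendsto_eventually)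
      qed
      show "AE l in halfline. ennreal ((norm (?U n l - ?u l))\<^sup>2) \<le> ennreal ((norm (?u l))\<^sup>2)" for n
        by (rule AE_I2) auto
    qed measurable
    then show ?thesis by (simp add: sq_norm_def)
  qed
  have "?s (\<lambda>x. bessel_op \<alpha> t f x - V x) = (\<integral>\<^sup>+x. liminf (\<lambda>n. ennreal ((norm (?H (?U n) x - V x))\<^sup>2)) \<partial>halfline)"
    unfolding sq_norm_def
  proof (rule nn_integral_cong)
    fix x assume "x \<in> space halfline"
    then have x: "x > 0" by simp
    have "(\<lambda>n. ennreal ((norm (?H (?U n) x - V x))\<^sup>2)) \<longlonglongrightarrow> ennreal ((norm (bessel_op \<alpha> t f x - V x))\<^sup>2)"
      by (intro tendsto_ennrealI tendsto_intros lim x)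
    then show "ennreal ((norm (bessel_op \<alpha> t f x - V x))\<^sup>2) = liminf (\<lambda>n. ennreal ((norm (?H (?U n) x - V x))\<^sup>2))"
      by (rule lim_imp_Liminf[OF trivial_limit_sequentially, symmetric])
  qed
  also have "\<dots> \<le> liminf (\<lambda>n. ?s (\<lambda>x. ?H (?U n) x - V x))"
    unfolding sq_norm_def by (rule nn_integral_liminf) measurable
  also have "\<dots> \<le> liminf (\<lambda>n. 16 * ?s (\<lambda>l. ?U n l - ?u l))"
    by (intro Liminf_mono always_eventually allI is_hankel_diff_bound[OF is_hankel_compact[OF UL] V])
  also have "\<dots> = 16 * 0"
    by (intro lim_imp_Liminf[OF trivial_limit_sequentially] ennreal_tendsto_cmult Ulim) auto
  finally have "?s (\<lambda>x. bessel_op \<alpha> t f x - V x) = 0" by simp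
  then show ?thesis by (rule sq_norm_diff_0D) measurable
qed

text \<open>Both sides depend continuously on \<open>f\<close>: the kernel operator by Schur's test,
  the double transform by \<open>is_hankel_diff_bound\<close>, since damping by the Gaussian does
  not increase the norm. Hence the case of compact support suffices.\<close>

lemma is_hankel_heat:
  assumes h: "is_hankel \<alpha> f g" and t: "t > 0" and V: "is_hankel \<alpha> (\<lambda>l. exp (- t * l\<^sup>2) *\<^sub>R g l) V"
  shows "AE x in halfline. bessel_op \<alpha> t f x = V x"
proof -
  let ?s = "sq_norm halfline" and ?H = "hankel_integral \<alpha>"
  interpret S: schur_kernel halfline "bessel_kernel \<alpha> t" "mass_bound \<alpha>" by (rule schur_kernel_bessel[OF \<alpha> t])
  note oe = bessel_op_eq[OF \<alpha> t]
  obtain F where F: "\<And>n. F n \<in> L2_compact_support" "(\<lambda>n. ?s (\<lambda>x. F n x - f x)) \<longlonglongrightarrow> 0" "(\<lambda>n. ?s (\<lambda>l. ?H (F n) l - g l)) \<longlonglongrightarrow> 0"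
    using h unfolding is_hankel_iff by blast
  have fL: "f \<in> Lp 2 halfline" and gL: "g \<in> Lp 2 halfline" using h unfolding is_hankel_iff by auto
  have FL: "F n \<in> Lp 2 halfline" for n using F(1)[of n] by (auto elim: L2_compact_supportE)
  have m[measurable]: "f \<in> borel_measurable halfline" "V \<in> borel_measurable halfline" "F n \<in> borel_measurable halfline" for n
    using fL FL V by (auto simp: in_L2_iff is_hankel_iff)
  have om[measurable]: "bessel_op \<alpha> t f \<in> borel_measurable halfline" "bessel_op \<alpha> t (F n) \<in> borel_measurable halfline" for n
    using S.op_measurable[OF m(1)] S.op_measurable[OF m(3)] by (auto simp: oe)
  have 1: "?s (\<lambda>x. bessel_op \<alpha> t f x - bessel_op \<alpha> t (F n) x) \<le> ennreal ((mass_bound \<alpha>)\<^sup>2) * ?s (\<lambda>x. F n x - f x)" for n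
    using sq_norm_bessel_op_diff[OF \<alpha> t fL FL[of n]] unfolding sq_norm_minus[of _ f "F n"] .
  have 2: "?s (\<lambda>x. bessel_op \<alpha> t (F n) x - V x) \<le> 16 * ?s (\<lambda>l. ?H (F n) l - g l)" for n
  proof -
    have eL: "(\<lambda>l. exp (- t * l\<^sup>2) *\<^sub>R ?H (F n) l) \<in> Lp 2 halfline"
      using exp_mult_in_L2[OF hankel_integral_in_L2[OF F(1)]] t by simp
    obtain W where W: "is_hankel \<alpha> (\<lambda>l. exp (- t * l\<^sup>2) *\<^sub>R ?H (F n) l) W" using is_hankel_exists[OF eL] by blast
    have "?s (\<lambda>x. bessel_op \<alpha> t (F n) x - V x) = ?s (\<lambda>x. W x - V x)"
      by (rule sq_norm_cong_AE) (use is_hankel_heat_compact[OF F(1) t W] in eventually_elim, simp)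
    also have "\<dots> \<le> 16 * ?s (\<lambda>l. exp (- t * l\<^sup>2) *\<^sub>R ?H (F n) l - exp (- t * l\<^sup>2) *\<^sub>R g l)"
      by (rule is_hankel_diff_bound[OF W V])
    also have "\<dots> \<le> 16 * ?s (\<lambda>l. ?H (F n) l - g l)"
      unfolding scaleR_diff_right[symmetric] using t by (intro mult_left_mono sq_norm_exp_le) auto
    finally show ?thesis .
  qed
  let ?A = "\<lambda>n. 2 * (ennreal ((mass_bound \<alpha>)\<^sup>2) * ?s (\<lambda>x. F n x - f x)) + 2 * (16 * ?s (\<lambda>l. ?H (F n) l - g l))"
  have le: "?s (\<lambda>x. bessel_op \<alpha> t f x - V x) \<le> ?A n" for n
  proof -
    have "?s (\<lambda>x. bessel_op \<alpha> t f x - V x) \<le> 2 * ?s (\<lambda>x. bessel_op \<alpha> t f x - bessel_op \<alpha> t (F n) x) + 2 * ?s (\<lambda>x. bessel_op \<alpha> t (F n) x - V x)"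
      by (rule sq_norm_diff_triangle) measurable
    also have "\<dots> \<le> ?A n" by (intro add_mono mult_left_mono 1 2) auto
    finally show ?thesis .
  qed
  have "?A \<longlonglongrightarrow> 2 * (ennreal ((mass_bound \<alpha>)\<^sup>2) * 0) + 2 * (16 * 0)"
    by (intro tendsto_add ennreal_tendsto_cmult F) auto
  then have "?s (\<lambda>x. bessel_op \<alpha> t f x - V x) \<le> 2 * (ennreal ((mass_bound \<alpha>)\<^sup>2) * 0) + 2 * (16 * 0)"
    by (rule LIMSEQ_le_const) (use le in auto)
  then have "?s (\<lambda>x. bessel_op \<alpha> t f x - V x) = 0" by simp
  then show ?thesis by (rule sq_norm_diff_0D) measurable
qed

text \<open>The bridge between the two descriptions: on L^2 the arbitrary representatives chosen by
  \<open>hankel\<close> agree almost everywhere with the kernel operator, elsewhere the two coincide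
  by definition. All further properties are transferred from the kernel.\<close>

lemma bessel_semigroup_measurable_AE:
  assumes f: "f \<in> borel_measurable halfline" and t: "t > 0"
  shows "bessel_semigroup \<alpha> t f \<in> borel_measurable halfline"
    and "AE x in halfline. bessel_semigroup \<alpha> t f x = bessel_op \<alpha> t f x"
proof -
  have "bessel_semigroup \<alpha> t f \<in> borel_measurable halfline \<and> (AE x in halfline. bessel_semigroup \<alpha> t f x = bessel_op \<alpha> t f x)"
  proof (cases "f \<in> Lp 2 halfline")
    case True
    have h: "is_hankel \<alpha> f (hankel \<alpha> f)" by (rule is_hankel_hankel[OF True])
    then have "hankel \<alpha> f \<in> Lp 2 halfline" by (simp add: is_hankel_iff)
    then have "(\<lambda>l. exp (- t * l\<^sup>2) *\<^sub>R hankel \<alpha> f l) \<in> Lp 2 halfline" using t by (intro exp_mult_in_L2) auto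
    from is_hankel_hankel[OF this]
    have h2: "is_hankel \<alpha> (\<lambda>l. exp (- t * l\<^sup>2) *\<^sub>R hankel \<alpha> f l) (bessel_semigroup \<alpha> t f)"
      using True t by (simp add: bessel_semigroup_def)
    have "AE x in halfline. bessel_op \<alpha> t f x = bessel_semigroup \<alpha> t f x" by (rule is_hankel_heat[OF h t h2])
    then have "AE x in halfline. bessel_semigroup \<alpha> t f x = bessel_op \<alpha> t f x" by eventually_elim simp
    moreover have "bessel_semigroup \<alpha> t f \<in> borel_measurable halfline" using h2 by (simp add: is_hankel_iff in_L2_iff)
    ultimately show ?thesis by blast
  next
    case False
    then have "bessel_semigroup \<alpha> t f = bessel_op \<alpha> t f"
      using t by (auto simp: bessel_semigroup_def bessel_op_def fun_eq_iff)
    then show ?thesis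
      using schur_kernel.op_measurable[OF schur_kernel_bessel[OF \<alpha> t] f] by (simp add: bessel_op_eq[OF \<alpha> t])
  qed
  then show "bessel_semigroup \<alpha> t f \<in> borel_measurable halfline"
    and "AE x in halfline. bessel_semigroup \<alpha> t f x = bessel_op \<alpha> t f x" by auto
qed

end

section \<open>The semigroup\<close>

lemma bessel_semigroup_0 [simp]: "bessel_semigroup \<alpha> 0 f = f"
  by (simp add: bessel_semigroup_def)

context
  fixes \<alpha> t :: real
  assumes \<alpha>: "- 1 / 2 \<le> \<alpha>" and t: "t > 0"
begin

interpretation S: schur_kernel halfline "bessel_kernel \<alpha> t" "mass_bound \<alpha>"
  by (rule schur_kernel_bessel[OF \<alpha> t])

lemma bessel_semigroup_norm_le:
  assumes p: "1 \<le> p" and f: "f \<in> borel_measurable halfline"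
  shows "Lp_norm p halfline (bessel_semigroup \<alpha> t f) \<le> ennreal (mass_bound \<alpha>) * Lp_norm p halfline f"
proof -
  have om: "bessel_op \<alpha> t f \<in> borel_measurable halfline"
    using S.op_measurable[OF f] by (simp add: bessel_op_eq[OF \<alpha> t])
  have "Lp_norm p halfline (bessel_semigroup \<alpha> t f) = Lp_norm p halfline (bessel_op \<alpha> t f)"
    by (intro Lp_norm_cong_AE bessel_semigroup_measurable_AE[OF \<alpha> f t] om)
  then show ?thesis using S.Lp_norm_op_le[OF p f] by (simp add: bessel_op_eq[OF \<alpha> t])
qed

lemma bessel_semigroup_in_Lp:
  assumes p: "1 \<le> p" and f: "f \<in> Lp p halfline"
  shows "bessel_semigroup \<alpha> t f \<in> Lp p halfline"
proof -
  have fm: "f \<in> borel_measurable halfline" and "Lp_norm p halfline f < \<infinity>" using f by (auto simp: Lp_def)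
  then have "ennreal (mass_bound \<alpha>) * Lp_norm p halfline f < \<infinity>" by (simp add: ennreal_mult_less_top)
  then show ?thesis using bessel_semigroup_norm_le[OF p fm] bessel_semigroup_measurable_AE(1)[OF \<alpha> fm t]
    by (auto simp: Lp_def intro: order.strict_trans1)
qed

lemma bessel_semigroup_cong_AE:
  assumes f: "f \<in> borel_measurable halfline" and g: "g \<in> borel_measurable halfline"
    and eq: "AE x in halfline. f x = g x"
  shows "AE x in halfline. bessel_semigroup \<alpha> t f x = bessel_semigroup \<alpha> t g x"
  using bessel_semigroup_measurable_AE(2)[OF \<alpha> f t] bessel_semigroup_measurable_AE(2)[OF \<alpha> g t] AE_space
proof eventually_elim
  case (elim x)
  then show ?case using S.op_cong_AE[OF eq f g, of x] by (simp add: bessel_op_eq[OF \<alpha> t])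
qed

lemma bessel_semigroup_linear:
  assumes f: "f \<in> L1_plus_Linf halfline" and g: "g \<in> L1_plus_Linf halfline"
  shows "AE x in halfline. bessel_semigroup \<alpha> t (\<lambda>y. a * f y + b * g y) x = a * bessel_semigroup \<alpha> t f x + b * bessel_semigroup \<alpha> t g x"
proof -
  have m: "f \<in> borel_measurable halfline" "g \<in> borel_measurable halfline" "(\<lambda>y. a * f y + b * g y) \<in> borel_measurable halfline"
    using f g L1_plus_Linf_linear[OF f g, of a b] by (auto intro: L1_plus_Linf_measurable)
  show ?thesis
    using bessel_semigroup_measurable_AE(2)[OF \<alpha> m(1) t] bessel_semigroup_measurable_AE(2)[OF \<alpha> m(2) t]
      bessel_semigroup_measurable_AE(2)[OF \<alpha> m(3) t] S.op_linear_AE[OF f g, of a b]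
    unfolding bessel_op_eq[OF \<alpha> t] by eventually_elim simp
qed

lemma bessel_semigroup_nonneg:
  assumes f: "f \<in> borel_measurable halfline" "AE x in halfline. 0 \<le> f x"
  shows "AE x in halfline. 0 \<le> bessel_semigroup \<alpha> t f x"
  using bessel_semigroup_measurable_AE(2)[OF \<alpha> f(1) t] AE_space
proof eventually_elim
  case (elim x)
  then show ?case using S.op_nonneg[OF f, of x] by (simp add: bessel_op_eq[OF \<alpha> t])
qed

lemma bessel_semigroup_selfadjoint:
  assumes f: "f \<in> Lp 2 halfline" and g: "g \<in> Lp 2 halfline"
  shows "(LINT x|halfline. bessel_semigroup \<alpha> t f x * cnj (g x)) = (LINT x|halfline. f x * cnj (bessel_semigroup \<alpha> t g x))"
proof -
  have m[measurable]: "f \<in> borel_measurable halfline" "g \<in> borel_measurable halfline" using f g by (auto simp: in_L2_iff)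
  note [measurable] = bessel_semigroup_measurable_AE(1)[OF \<alpha> m(1) t] bessel_semigroup_measurable_AE(1)[OF \<alpha> m(2) t]
  have [measurable]: "bessel_op \<alpha> t f \<in> borel_measurable halfline" "bessel_op \<alpha> t g \<in> borel_measurable halfline"
    using S.op_measurable[OF m(1)] S.op_measurable[OF m(2)] by (auto simp: bessel_op_eq[OF \<alpha> t])
  have "(LINT x|halfline. bessel_semigroup \<alpha> t f x * cnj (g x)) = (LINT x|halfline. bessel_op \<alpha> t f x * cnj (g x))"
    by (rule integral_cong_AE, measurable) (use bessel_semigroup_measurable_AE(2)[OF \<alpha> m(1) t] in eventually_elim, simp)
  also have "\<dots> = (LINT x|halfline. f x * cnj (bessel_op \<alpha> t g x))"
    using S.op_selfadjoint[OF f g] by (simp add: bessel_op_eq[OF \<alpha> t])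
  also have "\<dots> = (LINT x|halfline. f x * cnj (bessel_semigroup \<alpha> t g x))"
    by (rule integral_cong_AE, measurable) (use bessel_semigroup_measurable_AE(2)[OF \<alpha> m(2) t] in eventually_elim, simp)
  finally show ?thesis .
qed

text \<open>Masses were computed as extended nonnegative integrals, whereas the operator yields
  complex numbers. Both are expressed here by the same real integral, which is finite by the mass
  bound.\<close>

lemma nn_integral_bessel_kernel_indicator:
  assumes x: "x > 0" and A: "A \<in> sets borel"
  shows "bessel_op \<alpha> t (\<lambda>y. indicator A y) x = complex_of_real (LINT y|halfline. bessel_kernel \<alpha> t x y * indicator A y)"
    and "(\<integral>\<^sup>+y. ennreal (bessel_kernel \<alpha> t x y) * indicator A y \<partial>halfline) = ennreal (LINT y|halfline. bessel_kernel \<alpha> t x y * indicator A y)"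
proof -
  have "bessel_op \<alpha> t (\<lambda>y. indicator A y) x = (LINT y|halfline. complex_of_real (bessel_kernel \<alpha> t x y * indicator A y))"
    unfolding bessel_op_def by (intro Bochner_Integration.integral_cong) (auto simp: indicator_def scaleR_conv_of_real)
  then show "bessel_op \<alpha> t (\<lambda>y. indicator A y) x = complex_of_real (LINT y|halfline. bessel_kernel \<alpha> t x y * indicator A y)"
    unfolding integral_complex_of_real .
  have [measurable]: "bessel_kernel \<alpha> t x \<in> borel_measurable halfline" using S.k_measurable1[of x] x by simp
  have [measurable]: "(indicator A :: real \<Rightarrow> real) \<in> borel_measurable halfline"
    by (rule halfline_borel) (use A in simp)
  have k0: "0 \<le> bessel_kernel \<alpha> t x y" if "y \<in> space halfline" for y using S.k_nonneg[of x y] x that by simp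
  have "(\<integral>\<^sup>+y. ennreal (norm (bessel_kernel \<alpha> t x y * indicator A y)) \<partial>halfline) \<le> (\<integral>\<^sup>+y. ennreal (bessel_kernel \<alpha> t x y) \<partial>halfline)"
    by (intro nn_integral_mono ennreal_leI) (use k0 in \<open>auto simp: indicator_def\<close>)
  also have "\<dots> \<le> ennreal (mass_bound \<alpha>)" using S.mass_le[of x] x by simp
  finally have "integrable halfline (\<lambda>y. bessel_kernel \<alpha> t x y * indicator A y)"
    by (intro integrableI_bounded) (auto intro: order.strict_trans1)
  then have "(\<integral>\<^sup>+y. ennreal (bessel_kernel \<alpha> t x y * indicator A y) \<partial>halfline) = ennreal (LINT y|halfline. bessel_kernel \<alpha> t x y * indicator A y)"
    by (rule nn_integral_eq_integral) (use k0 in \<open>auto simp: indicator_def intro!: AE_I2\<close>)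
  moreover have "(\<integral>\<^sup>+y. ennreal (bessel_kernel \<alpha> t x y) * indicator A y \<partial>halfline) = (\<integral>\<^sup>+y. ennreal (bessel_kernel \<alpha> t x y * indicator A y) \<partial>halfline)"
    by (intro nn_integral_cong) (auto simp: indicator_def)
  ultimately show "(\<integral>\<^sup>+y. ennreal (bessel_kernel \<alpha> t x y) * indicator A y \<partial>halfline) = ennreal (LINT y|halfline. bessel_kernel \<alpha> t x y * indicator A y)"
    by simp
qed

lemma bessel_op_1:
  assumes x: "x > 0"
  obtains m where "0 \<le> m" "bessel_op \<alpha> t (\<lambda>_. 1) x = complex_of_real m" "(\<integral>\<^sup>+y. ennreal (bessel_kernel \<alpha> t x y) \<partial>halfline) = ennreal m"
proof (rule that)
  let ?m = "LINT y|halfline. bessel_kernel \<alpha> t x y * indicator UNIV y"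
  show "0 \<le> ?m" by (rule integral_nonneg_AE, rule AE_I2) (use S.k_nonneg[of x] x in auto)
  show "bessel_op \<alpha> t (\<lambda>_. 1) x = complex_of_real ?m" "(\<integral>\<^sup>+y. ennreal (bessel_kernel \<alpha> t x y) \<partial>halfline) = ennreal ?m"
    using nn_integral_bessel_kernel_indicator[OF x, of UNIV] by auto
qed

end

section \<open>Diffusion, positivity and the image of the constant 1\<close>

lemma bessel_semigroup_semigroup:
  assumes \<alpha>: "- 1 / 2 \<le> \<alpha>" and p: "1 \<le> p" and s: "s \<ge> 0" and t: "t \<ge> 0" and f: "f \<in> Lp p halfline"
  shows "AE x in halfline. bessel_semigroup \<alpha> s (bessel_semigroup \<alpha> t f) x = bessel_semigroup \<alpha> (s + t) f x"
proof (cases "s = 0 \<or> t = 0")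
  case False
  then have st: "s > 0" "t > 0" "s + t > 0" using s t by auto
  have fm: "f \<in> borel_measurable halfline" using f by (simp add: Lp_def)
  have fD: "f \<in> L1_plus_Linf halfline" using f Lp_subset_L1_plus_Linf[OF p] by blast
  interpret Ss: schur_kernel halfline "bessel_kernel \<alpha> s" "mass_bound \<alpha>" by (rule schur_kernel_bessel[OF \<alpha> st(1)])
  interpret St: schur_kernel halfline "bessel_kernel \<alpha> t" "mass_bound \<alpha>" by (rule schur_kernel_bessel[OF \<alpha> st(2)])
  let ?u = "bessel_semigroup \<alpha> t f"
  note u = bessel_semigroup_measurable_AE[OF \<alpha> fm st(2)]
  have om: "bessel_op \<alpha> t f \<in> borel_measurable halfline"
    using St.op_measurable[OF fm] by (simp add: bessel_op_eq[OF \<alpha> st(2)])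
  from bessel_semigroup_measurable_AE(2)[OF \<alpha> u(1) st(1)] bessel_op_semigroup[OF \<alpha> st(1,2) fD]
    bessel_semigroup_measurable_AE(2)[OF \<alpha> fm st(3)] AE_space
  show ?thesis
  proof eventually_elim
    case (elim x)
    \<comment> \<open>The inner function is known only up to a null set, but the outer kernel
      integral is insensitive to that at every single \<open>x\<close>.\<close>
    have "bessel_op \<alpha> s ?u x = bessel_op \<alpha> s (bessel_op \<alpha> t f) x"
      using Ss.op_cong_AE[OF u(2,1) om elim(4)] by (simp add: bessel_op_eq[OF \<alpha> st(1)])
    then show ?case using elim by simp
  qed
qed auto

lemma bessel_semigroup_strongly_continuous:
  assumes \<alpha>: "- 1 / 2 \<le> \<alpha>" and f: "f \<in> Lp 2 halfline"
  shows "((\<lambda>t. Lp_norm 2 halfline (\<lambda>x. bessel_semigroup \<alpha> t f x - f x)) \<longlongrightarrow> 0) (at_right 0)"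
proof -
  have fm[measurable]: "f \<in> borel_measurable halfline" using f by (simp add: in_L2_iff)
  have pos: "\<forall>\<^sub>F t in at_right (0::real). t > 0" by (rule eventually_at_right_less)
  have "\<forall>\<^sub>F t in at_right 0. (\<lambda>x. bessel_semigroup \<alpha> t f x - f x) \<in> borel_measurable halfline"
    using pos by eventually_elim (intro borel_measurable_diff bessel_semigroup_measurable_AE(1) \<alpha> fm)
  moreover have "((\<lambda>t. sq_norm halfline (\<lambda>x. bessel_semigroup \<alpha> t f x - f x)) \<longlongrightarrow> 0) (at_right 0)"
  proof (rule Lim_transform_eventually[OF bessel_op_tendsto[OF \<alpha> f]], use pos in eventually_elim)
    case (elim t)
    show ?case
      by (rule sq_norm_cong_AE) (use bessel_semigroup_measurable_AE(2)[OF \<alpha> fm elim] in eventually_elim, simp)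
  qed
  ultimately show ?thesis by (simp add: Lp_norm_2_tendsto_0_iff)
qed

lemma linear_operator_family_bessel:
  assumes \<alpha>: "- 1 / 2 \<le> \<alpha>"
  shows "linear_operator_family halfline (L1_plus_Linf halfline) (bessel_semigroup \<alpha>)"
  unfolding linear_operator_family_def
proof (intro conjI allI ballI impI subsetI)
  fix t :: real and f g :: "real \<Rightarrow> complex" and a b :: complex and p :: ennreal
  show "f \<in> borel_measurable halfline" if "f \<in> L1_plus_Linf halfline" using that by (rule L1_plus_Linf_measurable)
  show "g \<in> L1_plus_Linf halfline" if "f \<in> L1_plus_Linf halfline" "g \<in> borel_measurable halfline" "AE x in halfline. f x = g x"
    using that by (rule L1_plus_Linf_cong_AE)
  show "(\<lambda>x. a * f x + b * g x) \<in> L1_plus_Linf halfline" if "f \<in> L1_plus_Linf halfline" "g \<in> L1_plus_Linf halfline"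
    using that by (rule L1_plus_Linf_linear)
  show "f \<in> L1_plus_Linf halfline" if "1 \<le> p" "f \<in> Lp p halfline"
    using that Lp_subset_L1_plus_Linf by blast
  assume t: "0 \<le> t" and f: "f \<in> L1_plus_Linf halfline"
  show "bessel_semigroup \<alpha> t f \<in> borel_measurable halfline"
    using bessel_semigroup_measurable_AE(1)[OF \<alpha> L1_plus_Linf_measurable[OF f], of t] L1_plus_Linf_measurable[OF f] t
    by (cases "t = 0") auto
  assume g: "g \<in> L1_plus_Linf halfline"
  show "AE x in halfline. bessel_semigroup \<alpha> t f x = bessel_semigroup \<alpha> t g x" if "AE x in halfline. f x = g x"
    using bessel_semigroup_cong_AE[OF \<alpha> _ L1_plus_Linf_measurable[OF f] L1_plus_Linf_measurable[OF g] that, of t] t that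
    by (cases "t = 0") auto
  show "AE x in halfline. bessel_semigroup \<alpha> t (\<lambda>y. a * f y + b * g y) x = a * bessel_semigroup \<alpha> t f x + b * bessel_semigroup \<alpha> t g x"
    using bessel_semigroup_linear[OF \<alpha> _ f g, of t a b] t by (cases "t = 0") auto
qed

lemma symmetric_diffusion_semigroup_bessel:
  assumes \<alpha>: "\<alpha> = - 1 / 2 \<or> 1 / 2 \<le> \<alpha>"
  shows "symmetric_diffusion_semigroup halfline (L1_plus_Linf halfline) (bessel_semigroup \<alpha>)"
proof -
  have \<alpha>': "- 1 / 2 \<le> \<alpha>" and c: "mass_bound \<alpha> = 1" using \<alpha> by (auto simp: mass_bound_def)
  show ?thesis
    unfolding symmetric_diffusion_semigroup_def
  proof (intro conjI allI ballI impI)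
    fix s t :: real and f g :: "real \<Rightarrow> complex" and p :: ennreal
    show "sigma_finite_measure halfline" by (rule sigma_finite_halfline)
    show "linear_operator_family halfline (L1_plus_Linf halfline) (bessel_semigroup \<alpha>)"
      by (rule linear_operator_family_bessel[OF \<alpha>'])
    show "AE x in halfline. bessel_semigroup \<alpha> 0 f x = f x" by simp
    show "((\<lambda>t. Lp_norm 2 halfline (\<lambda>x. bessel_semigroup \<alpha> t f x - f x)) \<longlongrightarrow> 0) (at_right 0)" if "f \<in> Lp 2 halfline"
      by (rule bessel_semigroup_strongly_continuous[OF \<alpha>' that])
    assume t: "0 \<le> t"
    show "(LINT x|halfline. bessel_semigroup \<alpha> t f x * cnj (g x)) = (LINT x|halfline. f x * cnj (bessel_semigroup \<alpha> t g x))"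
      if "f \<in> Lp 2 halfline" "g \<in> Lp 2 halfline"
      using bessel_semigroup_selfadjoint[OF \<alpha>' _ that, of t] t by (cases "t = 0") auto
    assume p: "1 \<le> p"
    show "AE x in halfline. bessel_semigroup \<alpha> s (bessel_semigroup \<alpha> t f) x = bessel_semigroup \<alpha> (s + t) f x"
      if "0 \<le> s" "f \<in> Lp p halfline"
      by (rule bessel_semigroup_semigroup[OF \<alpha>' p that(1) t that(2)])
    assume f: "f \<in> Lp p halfline"
    show "bessel_semigroup \<alpha> t f \<in> Lp p halfline"
      using bessel_semigroup_in_Lp[OF \<alpha>' _ p f, of t] t f by (cases "t = 0") auto
    show "Lp_norm p halfline (bessel_semigroup \<alpha> t f) \<le> Lp_norm p halfline f"
      using bessel_semigroup_norm_le[OF \<alpha>' _ p, of t f] t f by (cases "t = 0") (auto simp: c Lp_def)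
  qed
qed

lemma positivity_preserving_bessel:
  assumes \<alpha>: "- 1 / 2 \<le> \<alpha>"
  shows "positivity_preserving halfline (L1_plus_Linf halfline) (bessel_semigroup \<alpha>)"
  unfolding positivity_preserving_def
proof (intro allI ballI impI)
  fix t :: real and f :: "real \<Rightarrow> complex"
  assume t: "0 \<le> t" and f: "f \<in> L1_plus_Linf halfline" "AE x in halfline. 0 \<le> f x"
  show "AE x in halfline. 0 \<le> bessel_semigroup \<alpha> t f x"
  proof (cases "t = 0")
    case False
    with t show ?thesis by (intro bessel_semigroup_nonneg[OF \<alpha>] L1_plus_Linf_measurable f) simp
  qed (simp add: f)
qed

lemma bessel_semigroup_1_AE:
  assumes \<alpha>: "- 1 / 2 \<le> \<alpha>" and t: "t > 0"
  shows "AE x in halfline. bessel_semigroup \<alpha> t (\<lambda>_. 1) x = bessel_op \<alpha> t (\<lambda>_. 1) x"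
  by (rule bessel_semigroup_measurable_AE(2)[OF \<alpha> _ t]) simp

lemma submarkovian_bessel:
  assumes \<alpha>: "\<alpha> = - 1 / 2 \<or> 1 / 2 \<le> \<alpha>"
  shows "submarkovian_semigroup halfline (L1_plus_Linf halfline) (bessel_semigroup \<alpha>)"
proof -
  have \<alpha>': "- 1 / 2 \<le> \<alpha>" and c: "mass_bound \<alpha> = 1" using \<alpha> by (auto simp: mass_bound_def)
  have "AE x in halfline. bessel_semigroup \<alpha> t (\<lambda>_. 1) x \<le> 1" if "t \<ge> 0" for t
  proof (cases "t = 0")
    case False
    then have t: "t > 0" using that by simp
    from bessel_semigroup_1_AE[OF \<alpha>' t] AE_space show ?thesis
    proof eventually_elim
      case (elim x)
      then have x: "x > 0" by simp
      obtain m where m: "0 \<le> m" "bessel_op \<alpha> t (\<lambda>_. 1) x = complex_of_real m" "(\<integral>\<^sup>+y. ennreal (bessel_kernel \<alpha> t x y) \<partial>halfline) = ennreal m"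
        using bessel_op_1[OF \<alpha>' t x] by blast
      have "m \<le> 1" using bessel_kernel_mass_le[OF \<alpha>' x t] m by (simp add: c)
      then show ?case using elim m by (simp add: less_eq_complex_def)
    qed
  qed simp
  then show ?thesis unfolding submarkovian_semigroup_def
    using symmetric_diffusion_semigroup_bessel[OF \<alpha>] positivity_preserving_bessel[OF \<alpha>'] by blast
qed

lemma markovian_bessel_half:
  "markovian_semigroup halfline (L1_plus_Linf halfline) (bessel_semigroup (- 1 / 2))"
proof -
  have \<alpha>: "- 1 / 2 \<le> (- 1 / 2 :: real)" by simp
  have "AE x in halfline. bessel_semigroup (- 1 / 2) t (\<lambda>_. 1) x = 1" if "t \<ge> 0" for t
  proof (cases "t = 0")
    case False
    then have t: "t > 0" using that by simp
    from bessel_semigroup_1_AE[OF \<alpha> t] AE_space show ?thesis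
    proof eventually_elim
      case (elim x)
      then have x: "x > 0" by simp
      obtain m where m: "0 \<le> m" "bessel_op (- 1 / 2) t (\<lambda>_. 1) x = complex_of_real m" "(\<integral>\<^sup>+y. ennreal (bessel_kernel (- 1 / 2) t x y) \<partial>halfline) = ennreal m"
        using bessel_op_1[OF \<alpha> t x] by blast
      have "m = 1" using bessel_kernel_mass_half[OF x t] m by simp
      then show ?case using elim m by simp
    qed
  qed simp
  then show ?thesis unfolding markovian_semigroup_def
    using symmetric_diffusion_semigroup_bessel[of "- 1 / 2"] positivity_preserving_bessel[OF \<alpha>] by blast
qed

section \<open>Failure of the Markov property and of contractivity\<close>

lemma AE_halfline_exists:
  assumes P: "AE x in halfline. P x" and ab: "0 \<le> a" "a < b"
  obtains x where "a < x" "x < b" "P x"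
proof -
  have "\<exists>x. a < x \<and> x < b \<and> P x"
  proof (rule ccontr)
    assume "\<not> ?thesis"
    then have n: "\<And>x. a < x \<Longrightarrow> x < b \<Longrightarrow> \<not> P x" by blast
    have "AE x in lborel. x \<in> {0<..} \<longrightarrow> P x"
      using P by (subst (asm) AE_restrict_space_iff) auto
    \<comment> \<open>If the property failed throughout the interval, the interval would be a null
      set in spite of its positive length.\<close>
    then have "AE x in lborel. x \<notin> {a<..<b}"
      by eventually_elim (use n ab in auto)
    then have "emeasure lborel {a<..<b} = 0"
      by (subst (asm) AE_iff_measurable[of "{a<..<b}"]) auto
    then show False using ab by simp
  qed
  then show ?thesis using that by blast
qed

lemma not_markovian_bessel:
  assumes \<alpha>: "1 / 2 \<le> \<alpha>"
  shows "\<not> markovian_semigroup halfline (L1_plus_Linf halfline) (bessel_semigroup \<alpha>)"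
proof
  assume "markovian_semigroup halfline (L1_plus_Linf halfline) (bessel_semigroup \<alpha>)"
  then have 1: "AE x in halfline. bessel_semigroup \<alpha> 1 (\<lambda>_. 1) x = 1"
    unfolding markovian_semigroup_def by (metis zero_le_one)
  have \<alpha>': "- 1 / 2 \<le> \<alpha>" using \<alpha> by simp
  define b where "b = \<alpha> / 2 + 1 / 4"
  have b: "b \<ge> 1 / 2" "b \<ge> 0" "\<alpha> = 2 * b - 1 / 2" using \<alpha> by (auto simp: b_def)
  define B where "B = b * Gamma b"
  have B: "B > 0" using b Gamma_real_pos[of b] by (simp add: B_def)
  \<comment> \<open>The solution of w^b = b Gamma(b), the threshold of
    \<open>mass_series_small\<close>. At time 1 one has w = x^2 / 4, hence the bound sqrt(4 w0) on
    \<open>x\<close>.\<close>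
  define w0 where "w0 = B powr (1 / b)"
  have w0: "w0 > 0" "w0 powr b = B" using B b by (auto simp: w0_def powr_powr)
  from 1 bessel_semigroup_1_AE[OF \<alpha>' zero_less_one]
  have "AE x in halfline. bessel_op \<alpha> 1 (\<lambda>_. 1) x = 1" by eventually_elim simp
  then obtain x where x: "0 < x" "x < sqrt (4 * w0)" "bessel_op \<alpha> 1 (\<lambda>_. 1) x = 1"
    by (rule AE_halfline_exists[where a = 0 and b = "sqrt (4 * w0)"]) (use w0 in auto)
  obtain m where m: "0 \<le> m" "bessel_op \<alpha> 1 (\<lambda>_. 1) x = complex_of_real m" "(\<integral>\<^sup>+y. ennreal (bessel_kernel \<alpha> 1 x y) \<partial>halfline) = ennreal m"
    using bessel_op_1[OF \<alpha>' zero_less_one x(1)] by blast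
  then have mass: "(\<integral>\<^sup>+y. ennreal (bessel_kernel \<alpha> 1 x y) \<partial>halfline) = 1" using x(3) by simp
  define w where "w = x\<^sup>2 / (4 * 1)"
  have w: "w > 0" "w < w0"
  proof -
    have "x\<^sup>2 < (sqrt (4 * w0))\<^sup>2" using x by (intro power_strict_mono) auto
    then show "w < w0" using w0 by (simp add: w_def)
  qed (use x in \<open>simp add: w_def\<close>)
  have "w powr b < w0 powr b" using w b by (intro powr_less_mono2) auto
  then have "w powr b < b * Gamma b" unfolding w0 B_def .
  from mass_series_small[OF b(1) w(1) this] mass show False
    unfolding bessel_kernel_mass[OF b(3,2) x(1) zero_less_one w_def] by simp
qed

text \<open>The constant 1 is not square integrable, whereas contractivity is tested on L^2
  functions only. It is therefore exhausted by indicators of compact intervals; a contraction would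
  keep all their images at most 1, and so would be their limit, the mass, at points \<open>x\<close>
  where it exceeds 1.\<close>

lemma not_Lp_contractive_bessel:
  assumes \<alpha>: "- 1 / 2 < \<alpha>" "\<alpha> < 1 / 2"
  shows "\<not> Lp_contractive halfline (bessel_semigroup \<alpha>)"
proof
  assume L: "Lp_contractive halfline (bessel_semigroup \<alpha>)"
  have \<alpha>': "- 1 / 2 \<le> \<alpha>" using \<alpha> by simp
  define b where "b = \<alpha> / 2 + 1 / 4"
  have b: "0 < b" "b < 1 / 2" "\<alpha> = 2 * b - 1 / 2" using \<alpha> by (auto simp: b_def)
  have b0: "0 \<le> b" using b by simp
  let ?f = "\<lambda>n y. indicator {1 / real (n + 2)..real (n + 2)} y :: complex"
  have fm: "?f n \<in> borel_measurable halfline" for n by (rule halfline_borel) simp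
  have f1: "norm (?f n y) \<le> 1" for n y by (simp add: indicator_def)
  have "AE x in halfline. norm (bessel_op \<alpha> 1 (?f n) x) \<le> 1" for n
  proof -
    have f2: "?f n \<in> Lp 2 halfline"
      by (rule L2_bounded_support[where K = 1 and a = "1 / real (n + 2)" and b = "real (n + 2)", OF fm f1]) simp
    have fi: "?f n \<in> Lp \<infinity> halfline" unfolding in_Linf_iff using fm f1 by (auto intro!: exI[of _ 1])
    have "Lp_norm \<infinity> halfline (bessel_semigroup \<alpha> 1 (?f n)) \<le> Lp_norm \<infinity> halfline (?f n)"
      using L f2 fi unfolding Lp_contractive_def by (metis IntI zero_le_one infinity_ennreal_def top_greatest)
    also have "\<dots> \<le> ennreal 1" by (rule Lp_norm_top_le[OF fm], rule AE_I2, rule ennreal_leI, rule f1)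
    finally have le: "Lp_norm \<infinity> halfline (bessel_semigroup \<alpha> 1 (?f n)) \<le> ennreal 1" .
    note u = bessel_semigroup_measurable_AE[OF \<alpha>' fm[of n] zero_less_one]
    from u(2) AE_le_Lp_norm_top[OF u(1)] show ?thesis
    proof eventually_elim
      case (elim x)
      have "ennreal (norm (bessel_semigroup \<alpha> 1 (?f n) x)) \<le> ennreal 1" using elim(2) le by (rule order_trans)
      then show ?case unfolding elim(1) by (subst (asm) ennreal_le_iff) auto
    qed
  qed
  \<comment> \<open>There are countably many indicators, so one null set serves them all and a
    single large \<open>x\<close> can be picked outside it.\<close>
  then have "AE x in halfline. \<forall>n. norm (bessel_op \<alpha> 1 (?f n) x) \<le> 1" by (simp add: AE_all_countable)
  then obtain x where x: "sqrt (4 * (64 / ((1 / 2 - b) * b))) < x" and le: "\<And>n. norm (bessel_op \<alpha> 1 (?f n) x) \<le> 1"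
    by (rule AE_halfline_exists[where a = "sqrt (4 * (64 / ((1 / 2 - b) * b)))" and b = "sqrt (4 * (64 / ((1 / 2 - b) * b))) + 1"]) (use b in auto)
  have s0: "0 \<le> sqrt (4 * (64 / ((1 / 2 - b) * b)))" using b by simp
  then have x0: "x > 0" using x by linarith
  define w where "w = x\<^sup>2 / (4 * 1)"
  have w: "w > 64 / ((1 / 2 - b) * b)"
  proof -
    have "(sqrt (4 * (64 / ((1 / 2 - b) * b))))\<^sup>2 < x\<^sup>2" using x s0 by (intro power_strict_mono) auto
    moreover have "0 \<le> 4 * (64 / ((1 / 2 - b) * b))" using b by simp
    ultimately have "4 * (64 / ((1 / 2 - b) * b)) < x\<^sup>2" by (simp only: real_sqrt_pow2)
    then show ?thesis by (simp add: w_def)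
  qed
  let ?k = "\<lambda>y. ennreal (bessel_kernel \<alpha> 1 x y)"
  have "1 < (\<integral>\<^sup>+y. ?k y \<partial>halfline)"
    using mass_series_gt_1[OF b(1,2) w] unfolding bessel_kernel_mass[OF b(3) b0 x0 zero_less_one w_def] .
  moreover have "(\<integral>\<^sup>+y. ?k y \<partial>halfline) \<le> 1"
  proof (rule LIMSEQ_le_const2)
    let ?A = "\<lambda>n. {1 / real (n + 2)..real (n + 2)}"
    have [measurable]: "(\<lambda>y. bessel_kernel \<alpha> 1 x y) \<in> borel_measurable halfline"
      using halfline_id_measurable by measurable
    have [measurable]: "(indicator (?A n) :: real \<Rightarrow> ennreal) \<in> borel_measurable halfline" for n
      by (rule halfline_borel) simp
    show "(\<lambda>n. (\<integral>\<^sup>+y. ?k y * indicator (?A n) y \<partial>halfline)) \<longlonglongrightarrow> (\<integral>\<^sup>+y. ?k y \<partial>halfline)"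
    proof (rule nn_integral_dominated_convergence[where w = ?k])
      show "AE y in halfline. ?k y * indicator (?A n) y \<le> ?k y" for n
        by (rule AE_I2) (auto simp: indicator_def)
      show "(\<integral>\<^sup>+y. ?k y \<partial>halfline) < \<infinity>"
        using bessel_kernel_mass_le[OF \<alpha>' x0 zero_less_one] by (rule order.strict_trans1) simp
      show "AE y in halfline. (\<lambda>n. ?k y * indicator (?A n) y) \<longlonglongrightarrow> ?k y"
      proof (rule AE_I2, rule tendsto_eventually)
        fix y assume that: "y \<in> space halfline"
        have y: "y > 0" using that by simp
        from eventually_in_exhaustion[OF y]
        show "\<forall>\<^sub>F n in sequentially. ?k y * indicator (?A n) y = ?k y" by eventually_elim simp
      qed
    qed measurable
    show "\<exists>N. \<forall>n\<ge>N. (\<integral>\<^sup>+y. ?k y * indicator (?A n) y \<partial>halfline) \<le> 1"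
    proof (intro exI allI impI)
      fix n
      have "norm (complex_of_real (LINT y|halfline. bessel_kernel \<alpha> 1 x y * indicator (?A n) y)) \<le> 1"
        using le[of n] nn_integral_bessel_kernel_indicator(1)[OF \<alpha>' zero_less_one x0, of "?A n"] by simp
      then have "(LINT y|halfline. bessel_kernel \<alpha> 1 x y * indicator (?A n) y) \<le> 1" by simp
      then show "(\<integral>\<^sup>+y. ?k y * indicator (?A n) y \<partial>halfline) \<le> 1"
        using nn_integral_bessel_kernel_indicator(2)[OF \<alpha>' zero_less_one x0, of "?A n"] by (simp add: ennreal_le_1)
    qed
  qed
  ultimately show False by simp
qed

lemma Lp_opnorm_bessel_le:
  assumes \<alpha>: "- 1 / 2 \<le> \<alpha>" and p: "1 \<le> p" and t: "t > 0"
  shows "Lp_opnorm p halfline (bessel_semigroup \<alpha> t) \<le> ennreal (mass_bound \<alpha>)"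
  unfolding Lp_opnorm_def
proof (rule SUP_least)
  fix f assume "f \<in> {f \<in> Lp p halfline. Lp_norm p halfline f \<le> 1}"
  then have f: "f \<in> borel_measurable halfline" "Lp_norm p halfline f \<le> 1" by (auto simp: Lp_def)
  have "Lp_norm p halfline (bessel_semigroup \<alpha> t f) \<le> ennreal (mass_bound \<alpha>) * Lp_norm p halfline f"
    by (rule bessel_semigroup_norm_le[OF \<alpha> t p f(1)])
  also have "\<dots> \<le> ennreal (mass_bound \<alpha>) * 1" using f(2) by (intro mult_left_mono) auto
  finally show "Lp_norm p halfline (bessel_semigroup \<alpha> t f) \<le> ennreal (mass_bound \<alpha>)" by simp
qed

theorem proposition6p1:
  fixes \<alpha> :: real
  assumes "- 1 / 2 \<le> \<alpha>"
  shows "(\<alpha> \<in> {- 1 / 2} \<union> {1 / 2..} \<longrightarrow>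
      submarkovian_semigroup halfline (L1_plus_Linf halfline) (bessel_semigroup \<alpha>) \<and>
      (markovian_semigroup halfline (L1_plus_Linf halfline) (bessel_semigroup \<alpha>) \<longleftrightarrow> \<alpha> = - 1 / 2)) \<and>
    (\<alpha> \<in> {- 1 / 2<..<1 / 2} \<longrightarrow>
      \<not> Lp_contractive halfline (bessel_semigroup \<alpha>) \<and>
      (\<exists>c::real. c > 1 \<and>
        (\<forall>p::ennreal. 1 \<le> p \<longrightarrow> (\<forall>t>0. Lp_opnorm p halfline (bessel_semigroup \<alpha> t) \<le> ennreal c))))"
proof (intro conjI impI)
  assume "\<alpha> \<in> {- 1 / 2} \<union> {1 / 2..}"
  then have \<alpha>: "\<alpha> = - 1 / 2 \<or> 1 / 2 \<le> \<alpha>" by auto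
  show "submarkovian_semigroup halfline (L1_plus_Linf halfline) (bessel_semigroup \<alpha>)"
    by (rule submarkovian_bessel[OF \<alpha>])
  show "markovian_semigroup halfline (L1_plus_Linf halfline) (bessel_semigroup \<alpha>) \<longleftrightarrow> \<alpha> = - 1 / 2"
    using \<alpha> markovian_bessel_half not_markovian_bessel by blast
next
  assume \<alpha>: "\<alpha> \<in> {- 1 / 2<..<1 / 2}"
  then show "\<not> Lp_contractive halfline (bessel_semigroup \<alpha>)" by (intro not_Lp_contractive_bessel) auto
  \<comment> \<open>Inside the open interval \<open>mass_bound\<close> takes the value 6, so the
    constant obtained does not even depend on \<open>\<alpha>\<close>.\<close>
  have "mass_bound \<alpha> > 1" using \<alpha> by (simp add: mass_bound_def)
  then show "\<exists>c::real. c > 1 \<and>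
        (\<forall>p::ennreal. 1 \<le> p \<longrightarrow> (\<forall>t>0. Lp_opnorm p halfline (bessel_semigroup \<alpha> t) \<le> ennreal c))"
    using Lp_opnorm_bessel_le[OF assms] by blast
qed

end
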